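(* Let $(\mathscr{C},\mathbb{E},\mathfrak{s})$ be an extriangulated category and let $\mathcal{I}\subseteq\mathscr{C}$ be a full additive subcategory, closed under isomorphisms. If $\mathcal{I}\subseteq\mathrm{Proj}(\mathscr{C})\cap\mathrm{Inj}(\mathscr{C})$, then the ideal quotient $\mathscr{C}/\mathcal{I}$ has the structure of an extriangulated category, induced from that of $\mathscr{C}$. In particular, to any extriangulated category $(\mathscr{C},\mathbb{E},\mathfrak{s})$ we can associate an extriangulated category $\mathscr{C}'=\mathscr{C}/(\mathrm{Proj}(\mathscr{C})\cap\mathrm{Inj}(\mathscr{C}))$ satisfying $\mathrm{Proj}(\mathscr{C}')\cap\mathrm{Inj}(\mathscr{C}')=0$.
   Context: Extriangulated categories. Let $\mathscr{C}$ be an additive category and $\mathbb{E}\colon\mathscr{C}^{\mathrm{op}}\times\mathscr{C}\to\mathit{Ab}$ a functor. Elements $\delta\in\mathbb{E}(C,A)$ are called $\mathbb{E}$-extensions; for $a\colon A\to A'$ and $c\colon C'\to C$ put $a_*\delta=\mathbb{E}(C,a)(\delta)$ and $c^*\delta=\mathbb{E}(c,A)(\delta)$. A morphism $(a,c)\colon\delta\to\delta'$ from $\delta\in\mathbb{E}(C,A)$ to $\delta'\in\mathbb{E}(C',A')$ is a pair $a\colon A\to A'$, $c\colon C\to C'$ with $a_*\delta=c^*\delta'$. Sequences $A\xrightarrow{x}B\xrightarrow{y}C$ and $A\xrightarrow{x'}B'\xrightarrow{y'}C$ are equivalent if there is an isomorphism $b\colon B\to B'$ with $bx=x'$, $y'b=y$;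 the class is written $[A\xrightarrow{x}B\xrightarrow{y}C]$. A realization $\mathfrak{s}$ assigns to each $\delta\in\mathbb{E}(C,A)$ such a class $\mathfrak{s}(\delta)=[A\xrightarrow{x}B\xrightarrow{y}C]$ so that for every morphism $(a,c)\colon\delta\to\delta'$, with $\mathfrak{s}(\delta')=[A'\xrightarrow{x'}B'\xrightarrow{y'}C']$, there is $b\colon B\to B'$ with $bx=x'a$, $y'b=cy$ (then $(a,b,c)$ is said to realize $(a,c)$). It is additive if $\mathfrak{s}(0)=[A\to A\oplus C\to C]$ (canonical inclusion and projection) and $\mathfrak{s}(\delta\oplus\delta')=[A\oplus A'\xrightarrow{x\oplus x'}B\oplus B'\xrightarrow{y\oplus y'}C\oplus C']$, where $\delta\oplus\delta'\in\mathbb{E}(C\oplus C',A\oplus A')$ corresponds to $(\delta,0,0,\delta')$. If $\mathfrak{s}(\delta)=[A\xrightarrow{x}B\xrightarrow{y}C]$, the sequence is called a conflation, $x$ an inflation, $y$ a deflation, and one speaks of the $\mathbb{E}$-triangle $A\xrightarrow{x}B\xrightarrow{y}C\overset{\delta}{\dashrightarrow}$. The triple $(\mathscr{C},\mathbb{E},\mathfrak{s})$ is an extriangulated category if: (ET1) $\mathbb{E}$ is biadditive; (ET2) $\mathfrak{s}$ is an additive realization; (ET3) for $\mathbb{E}$-triangles $A\xrightarrow{x}B\xrightarrow{y}C\overset{\delta}{\dashrightarrow}$, $A'\xrightarrow{x'}B'\xrightarrow{y'}C'\overset{\delta'}{\dashrightarrow}$ and $a,b$ with $bx=x'a$ there is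 $c$ such that $(a,c)\colon\delta\to\delta'$ is a morphism realized by $(a,b,c)$; (ET3)$^{\mathrm{op}}$ for $b,c$ with $y'b=cy$ there is $a$ such that $(a,c)\colon\delta\to\delta'$ is a morphism realized by $(a,b,c)$; (ET4) for $\mathbb{E}$-triangles $A\xrightarrow{f}B\xrightarrow{f'}D\overset{\delta}{\dashrightarrow}$ and $B\xrightarrow{g}C\xrightarrow{g'}F\overset{\delta'}{\dashrightarrow}$ there are an $\mathbb{E}$-triangle $A\xrightarrow{h}C\xrightarrow{h'}E\overset{\delta''}{\dashrightarrow}$ with $h=gf$ and $d\colon D\to E$, $e\colon E\to F$ with $df'=h'g$, $eh'=g'$, such that $D\xrightarrow{d}E\xrightarrow{e}F$ realizes $f'_*\delta'$, $d^*\delta''=\delta$ and $f_*\delta''=e^*\delta'$; (ET4)$^{\mathrm{op}}$ for $\mathbb{E}$-triangles $D\xrightarrow{f'}A\xrightarrow{f}B\overset{\delta}{\dashrightarrow}$ and $F\xrightarrow{g'}B\xrightarrow{g}C\overset{\delta'}{\dashrightarrow}$ there are an $\mathbb{E}$-triangle $E\xrightarrow{h'}A\xrightarrow{h}C\overset{\delta''}{\dashrightarrow}$ with $h=gf$ and $d\colon D\to E$, $e\colon E\to F$ with $h'd=f'$, $fh'=g'e$, such that $D\xrightarrow{d}E\xrightarrow{e}F$ realizes $g'^*\delta$, $\delta'=e_*\delta''$ and $d_*\delta=g^*\delta''$. An object $P$ is projective if for every deflation $y\colon B\to C$ and every $c\colon P\to C$ there is $b\colon P\to B$ with $yb=c$;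 dually, $I$ is injective if for every inflation $x\colon A\to B$ every $A\to I$ factors through $x$. $\mathrm{Proj}(\mathscr{C})$, $\mathrm{Inj}(\mathscr{C})$ are the full subcategories of projectives and injectives. "$=0$" for a subcategory means that it consists of zero objects. $\mathscr{C}/\mathcal{I}$ is the additive quotient of $\mathscr{C}$ by the ideal of morphisms factoring through objects of $\mathcal{I}$; $\overline{f}$ denotes the class of $f$. The induced structure $(\overline{\mathbb{E}},\overline{\mathfrak{s}})$ on $\mathscr{C}/\mathcal{I}$ is: $\overline{\mathbb{E}}(C,A)=\mathbb{E}(C,A)$, $\overline{\mathbb{E}}(\overline{c},\overline{a})=\mathbb{E}(c,a)$, and $\overline{\mathfrak{s}}(\delta)=[A\xrightarrow{\overline{x}}B\xrightarrow{\overline{y}}C]$ (equivalence class in $\mathscr{C}/\mathcal{I}$) whenever $\mathfrak{s}(\delta)=[A\xrightarrow{x}B\xrightarrow{y}C]$. *)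

theory Defs
  imports "HOL-Algebra.Coset"
begin

text \<open>
  Abelian groups are \<open>comm_group\<close>s of HOL-Algebra, hence written multiplicatively:
  \<open>\<otimes>\<close> is the addition and \<open>\<one>\<close> the zero of a morphism group or of a group of extensions.
  Subcategories are always full and are given by their sets of objects.
\<close>

section \<open>Additive categories\<close>

record ('o, 'm) cat =
  Ob :: "'o set"
  Hom :: "'o \<Rightarrow> 'o \<Rightarrow> 'm monoid"
  Ident :: "'o \<Rightarrow> 'm"
  Comp :: "'m \<Rightarrow> 'm \<Rightarrow> 'm"  (infixl \<open>\<cdot>\<index>\<close> 70)

abbreviation mor :: "('o, 'm, 'z) cat_scheme \<Rightarrow> 'o \<Rightarrow> 'o \<Rightarrow> 'm set" where
  "mor \<C> A B \<equiv> carrier (Hom \<C> A B)"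

text \<open>
  Morphism sets of different pairs of objects are disjoint, so that a morphism determines its
  domain and codomain and composition needs no object arguments.
\<close>

locale preadditive_category =
  fixes \<C> :: "('o, 'm, 'z) cat_scheme" (structure)
  assumes Hom_group: "\<lbrakk>A \<in> Ob \<C>; B \<in> Ob \<C>\<rbrakk> \<Longrightarrow> comm_group (Hom \<C> A B)"
    and Hom_disjoint: "\<lbrakk>A \<in> Ob \<C>; B \<in> Ob \<C>; A' \<in> Ob \<C>; B' \<in> Ob \<C>;
        f \<in> mor \<C> A B; f \<in> mor \<C> A' B'\<rbrakk> \<Longrightarrow> A = A' \<and> B = B'"
    and Ident_closed: "A \<in> Ob \<C> \<Longrightarrow> Ident \<C> A \<in> mor \<C> A A"
    and Comp_closed: "\<lbrakk>A \<in> Ob \<C>; B \<in> Ob \<C>; C \<in> Ob \<C>; f \<in> mor \<C> A B; g \<in> mor \<C> B C\<rbrakk>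
        \<Longrightarrow> g \<cdot> f \<in> mor \<C> A C"
    and Ident_left: "\<lbrakk>A \<in> Ob \<C>; B \<in> Ob \<C>; f \<in> mor \<C> A B\<rbrakk> \<Longrightarrow> Ident \<C> B \<cdot> f = f"
    and Ident_right: "\<lbrakk>A \<in> Ob \<C>; B \<in> Ob \<C>; f \<in> mor \<C> A B\<rbrakk> \<Longrightarrow> f \<cdot> Ident \<C> A = f"
    and Comp_assoc: "\<lbrakk>A \<in> Ob \<C>; B \<in> Ob \<C>; C \<in> Ob \<C>; D \<in> Ob \<C>;
        f \<in> mor \<C> A B; g \<in> mor \<C> B C; h \<in> mor \<C> C D\<rbrakk> \<Longrightarrow> (h \<cdot> g) \<cdot> f = h \<cdot> (g \<cdot> f)"
    and Comp_add_right: "\<lbrakk>A \<in> Ob \<C>; B \<in> Ob \<C>; C \<in> Ob \<C>;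
        f \<in> mor \<C> A B; f' \<in> mor \<C> A B; g \<in> mor \<C> B C\<rbrakk>
        \<Longrightarrow> g \<cdot> (f \<otimes>\<^bsub>Hom \<C> A B\<^esub> f') = (g \<cdot> f) \<otimes>\<^bsub>Hom \<C> A C\<^esub> (g \<cdot> f')"
    and Comp_add_left: "\<lbrakk>A \<in> Ob \<C>; B \<in> Ob \<C>; C \<in> Ob \<C>;
        f \<in> mor \<C> A B; g \<in> mor \<C> B C; g' \<in> mor \<C> B C\<rbrakk>
        \<Longrightarrow> (g \<otimes>\<^bsub>Hom \<C> B C\<^esub> g') \<cdot> f = (g \<cdot> f) \<otimes>\<^bsub>Hom \<C> A C\<^esub> (g' \<cdot> f)"

definition zero_object :: "('o, 'm, 'z) cat_scheme \<Rightarrow> 'o \<Rightarrow> bool" where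
  "zero_object \<C> Z \<longleftrightarrow> Z \<in> Ob \<C> \<and>
     (\<forall>A\<in>Ob \<C>. (\<exists>!f. f \<in> mor \<C> A Z) \<and> (\<exists>!f. f \<in> mor \<C> Z A))"

definition isomorphism :: "('o, 'm, 'z) cat_scheme \<Rightarrow> 'o \<Rightarrow> 'o \<Rightarrow> 'm \<Rightarrow> bool" where
  "isomorphism \<C> A B f \<longleftrightarrow> f \<in> mor \<C> A B \<and>
     (\<exists>g\<in>mor \<C> B A. g \<cdot>\<^bsub>\<C>\<^esub> f = Ident \<C> A \<and> f \<cdot>\<^bsub>\<C>\<^esub> g = Ident \<C> B)"

record ('o, 'm) biprod =
  Sum :: 'o
  In1 :: 'm
  In2 :: 'm
  Pr1 :: 'm
  Pr2 :: 'm

definition biproduct ::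
  "('o, 'm, 'z) cat_scheme \<Rightarrow> 'o \<Rightarrow> 'o \<Rightarrow> ('o, 'm) biprod \<Rightarrow> bool" where
  "biproduct \<C> A B S \<longleftrightarrow> Sum S \<in> Ob \<C> \<and>
     In1 S \<in> mor \<C> A (Sum S) \<and> In2 S \<in> mor \<C> B (Sum S) \<and>
     Pr1 S \<in> mor \<C> (Sum S) A \<and> Pr2 S \<in> mor \<C> (Sum S) B \<and>
     Pr1 S \<cdot>\<^bsub>\<C>\<^esub> In1 S = Ident \<C> A \<and> Pr2 S \<cdot>\<^bsub>\<C>\<^esub> In2 S = Ident \<C> B \<and>
     Pr2 S \<cdot>\<^bsub>\<C>\<^esub> In1 S = \<one>\<^bsub>Hom \<C> A B\<^esub> \<and> Pr1 S \<cdot>\<^bsub>\<C>\<^esub> In2 S = \<one>\<^bsub>Hom \<C> B A\<^esub> \<and>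
     (In1 S \<cdot>\<^bsub>\<C>\<^esub> Pr1 S) \<otimes>\<^bsub>Hom \<C> (Sum S) (Sum S)\<^esub> (In2 S \<cdot>\<^bsub>\<C>\<^esub> Pr2 S) = Ident \<C> (Sum S)"

definition dsum_mor ::
  "('o, 'm, 'z) cat_scheme \<Rightarrow> ('o, 'm) biprod \<Rightarrow> ('o, 'm) biprod \<Rightarrow> 'm \<Rightarrow> 'm \<Rightarrow> 'm" where
  "dsum_mor \<C> S T f f' =
     (In1 T \<cdot>\<^bsub>\<C>\<^esub> f \<cdot>\<^bsub>\<C>\<^esub> Pr1 S) \<otimes>\<^bsub>Hom \<C> (Sum S) (Sum T)\<^esub> (In2 T \<cdot>\<^bsub>\<C>\<^esub> f' \<cdot>\<^bsub>\<C>\<^esub> Pr2 S)"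

locale additive_category = preadditive_category +
  assumes zero_object_exists: "\<exists>Z. zero_object \<C> Z"
    and biproduct_exists: "\<lbrakk>A \<in> Ob \<C>; B \<in> Ob \<C>\<rbrakk> \<Longrightarrow> \<exists>S. biproduct \<C> A B S"

definition additive_subcategory :: "('o, 'm, 'z) cat_scheme \<Rightarrow> 'o set \<Rightarrow> bool" where
  "additive_subcategory \<C> \<I> \<longleftrightarrow> \<I> \<subseteq> Ob \<C> \<and> additive_category (\<C>\<lparr>Ob := \<I>\<rparr>)"

definition closed_under_isos :: "('o, 'm, 'z) cat_scheme \<Rightarrow> 'o set \<Rightarrow> bool" where
  "closed_under_isos \<C> \<I> \<longleftrightarrow> (\<forall>A\<in>\<I>. \<forall>B\<in>Ob \<C>. (\<exists>f. isomorphism \<C> A B f) \<longrightarrow> B \<in> \<I>)"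


section \<open>Extensions and realizations\<close>

text \<open>
  \<open>Ext \<E> C A\<close> is the group \<open>\<E>(C, A)\<close>. For \<open>c : C' \<rightarrow> C\<close> and \<open>a : A \<rightarrow> A'\<close>,
  \<open>Act \<E> c a\<close> is the map \<open>\<E>(c, a) : \<E>(C, A) \<rightarrow> \<E>(C', A')\<close>.
\<close>

record ('o, 'm, 'e) bifun =
  Ext :: "'o \<Rightarrow> 'o \<Rightarrow> 'e monoid"
  Act :: "'m \<Rightarrow> 'm \<Rightarrow> 'e \<Rightarrow> 'e"

locale Ab_bifunctor = additive_category \<C>
  for \<C> :: "('o, 'm, 'z) cat_scheme" (structure)
    and \<E> :: "('o, 'm, 'e) bifun" +
  assumes Ext_group: "\<lbrakk>C \<in> Ob \<C>; A \<in> Ob \<C>\<rbrakk> \<Longrightarrow> comm_group (Ext \<E> C A)"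
    and Act_hom: "\<lbrakk>C \<in> Ob \<C>; C' \<in> Ob \<C>; A \<in> Ob \<C>; A' \<in> Ob \<C>;
        c \<in> mor \<C> C' C; a \<in> mor \<C> A A'\<rbrakk> \<Longrightarrow> Act \<E> c a \<in> hom (Ext \<E> C A) (Ext \<E> C' A')"
    and Act_Ident: "\<lbrakk>C \<in> Ob \<C>; A \<in> Ob \<C>; \<delta> \<in> carrier (Ext \<E> C A)\<rbrakk>
        \<Longrightarrow> Act \<E> (Ident \<C> C) (Ident \<C> A) \<delta> = \<delta>"
    and Act_Comp: "\<lbrakk>C \<in> Ob \<C>; C' \<in> Ob \<C>; C'' \<in> Ob \<C>; A \<in> Ob \<C>; A' \<in> Ob \<C>; A'' \<in> Ob \<C>;
        c \<in> mor \<C> C' C; c' \<in> mor \<C> C'' C'; a \<in> mor \<C> A A'; a' \<in> mor \<C> A' A'';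
        \<delta> \<in> carrier (Ext \<E> C A)\<rbrakk>
        \<Longrightarrow> Act \<E> (c \<cdot> c') (a' \<cdot> a) \<delta> = Act \<E> c' a' (Act \<E> c a \<delta>)"

locale biadditive_bifunctor = Ab_bifunctor +
  assumes Act_add_left: "\<lbrakk>C \<in> Ob \<C>; C' \<in> Ob \<C>; A \<in> Ob \<C>; A' \<in> Ob \<C>;
        c \<in> mor \<C> C' C; d \<in> mor \<C> C' C; a \<in> mor \<C> A A'; \<delta> \<in> carrier (Ext \<E> C A)\<rbrakk>
        \<Longrightarrow> Act \<E> (c \<otimes>\<^bsub>Hom \<C> C' C\<^esub> d) a \<delta> = Act \<E> c a \<delta> \<otimes>\<^bsub>Ext \<E> C' A'\<^esub> Act \<E> d a \<delta>"
    and Act_add_right: "\<lbrakk>C \<in> Ob \<C>; C' \<in> Ob \<C>; A \<in> Ob \<C>; A' \<in> Ob \<C>;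
        c \<in> mor \<C> C' C; a \<in> mor \<C> A A'; b \<in> mor \<C> A A'; \<delta> \<in> carrier (Ext \<E> C A)\<rbrakk>
        \<Longrightarrow> Act \<E> c (a \<otimes>\<^bsub>Hom \<C> A A'\<^esub> b) \<delta> = Act \<E> c a \<delta> \<otimes>\<^bsub>Ext \<E> C' A'\<^esub> Act \<E> c b \<delta>"

text \<open>
  \<open>push \<C> \<E> C a \<delta>\<close> is \<open>a\<^sub>*\<delta>\<close> for \<open>\<delta> \<in> \<E>(C, A)\<close>, and \<open>pull \<C> \<E> A c \<delta>\<close> is \<open>c\<^sup>*\<delta>\<close> for
  \<open>\<delta> \<in> \<E>(C, A)\<close>. The groups \<open>\<E>(C, A)\<close> may overlap, hence the object arguments.
\<close>

definition push ::
  "('o, 'm, 'z) cat_scheme \<Rightarrow> ('o, 'm, 'e) bifun \<Rightarrow> 'o \<Rightarrow> 'm \<Rightarrow> 'e \<Rightarrow> 'e" where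
  "push \<C> \<E> C a \<delta> = Act \<E> (Ident \<C> C) a \<delta>"

definition pull ::
  "('o, 'm, 'z) cat_scheme \<Rightarrow> ('o, 'm, 'e) bifun \<Rightarrow> 'o \<Rightarrow> 'm \<Rightarrow> 'e \<Rightarrow> 'e" where
  "pull \<C> \<E> A c \<delta> = Act \<E> c (Ident \<C> A) \<delta>"

definition ext_morphism ::
  "('o, 'm, 'z) cat_scheme \<Rightarrow> ('o, 'm, 'e) bifun \<Rightarrow> 'o \<Rightarrow> 'o \<Rightarrow> 'e \<Rightarrow> 'o \<Rightarrow> 'o \<Rightarrow> 'e
    \<Rightarrow> 'm \<Rightarrow> 'm \<Rightarrow> bool" where
  "ext_morphism \<C> \<E> C A \<delta> C' A' \<delta>' a c \<longleftrightarrow>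
     a \<in> mor \<C> A A' \<and> c \<in> mor \<C> C C' \<and> push \<C> \<E> C a \<delta> = pull \<C> \<E> A' c \<delta>'"

text \<open>The triple \<open>(x, B, y)\<close> stands for the sequence \<open>A \<rightarrow> B \<rightarrow> C\<close> with maps \<open>x\<close> and \<open>y\<close>.\<close>

definition seqs :: "('o, 'm, 'z) cat_scheme \<Rightarrow> 'o \<Rightarrow> 'o \<Rightarrow> ('m \<times> 'o \<times> 'm) set" where
  "seqs \<C> A C = {(x, B, y). B \<in> Ob \<C> \<and> x \<in> mor \<C> A B \<and> y \<in> mor \<C> B C}"

definition seq_rel :: "('o, 'm, 'z) cat_scheme \<Rightarrow> 'o \<Rightarrow> 'o \<Rightarrow> ('m \<times> 'o \<times> 'm) rel" where
  "seq_rel \<C> A C = {((x, B, y), (x', B', y')).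
     (x, B, y) \<in> seqs \<C> A C \<and> (x', B', y') \<in> seqs \<C> A C \<and>
     (\<exists>b. isomorphism \<C> B B' b \<and> b \<cdot>\<^bsub>\<C>\<^esub> x = x' \<and> y' \<cdot>\<^bsub>\<C>\<^esub> b = y)}"

definition seq_class ::
  "('o, 'm, 'z) cat_scheme \<Rightarrow> 'o \<Rightarrow> 'o \<Rightarrow> 'm \<Rightarrow> 'o \<Rightarrow> 'm \<Rightarrow> ('m \<times> 'o \<times> 'm) set" where
  "seq_class \<C> A C x B y = seq_rel \<C> A C `` {(x, B, y)}"

text \<open>\<open>s C A \<delta>\<close> is the class of sequences assigned to \<open>\<delta> \<in> \<E>(C, A)\<close>.\<close>

type_synonym ('o, 'm, 'e) realz = "'o \<Rightarrow> 'o \<Rightarrow> 'e \<Rightarrow> ('m \<times> 'o \<times> 'm) set"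

definition E_triangle ::
  "('o, 'm, 'z) cat_scheme \<Rightarrow> ('o, 'm, 'e) bifun \<Rightarrow> ('o, 'm, 'e) realz
    \<Rightarrow> 'o \<Rightarrow> 'm \<Rightarrow> 'o \<Rightarrow> 'm \<Rightarrow> 'o \<Rightarrow> 'e \<Rightarrow> bool" where
  "E_triangle \<C> \<E> s A x B y C \<delta> \<longleftrightarrow>
     A \<in> Ob \<C> \<and> C \<in> Ob \<C> \<and> \<delta> \<in> carrier (Ext \<E> C A) \<and> (x, B, y) \<in> s C A \<delta>"

definition realization ::
  "('o, 'm, 'z) cat_scheme \<Rightarrow> ('o, 'm, 'e) bifun \<Rightarrow> ('o, 'm, 'e) realz \<Rightarrow> bool" where
  "realization \<C> \<E> s \<longleftrightarrow>
     (\<forall>A\<in>Ob \<C>. \<forall>C\<in>Ob \<C>. \<forall>\<delta>\<in>carrier (Ext \<E> C A). s C A \<delta> \<in> seqs \<C> A C // seq_rel \<C> A C) \<and>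
     (\<forall>A x B y C \<delta> A' x' B' y' C' \<delta>' a c.
        E_triangle \<C> \<E> s A x B y C \<delta> \<longrightarrow> E_triangle \<C> \<E> s A' x' B' y' C' \<delta>' \<longrightarrow>
        ext_morphism \<C> \<E> C A \<delta> C' A' \<delta>' a c \<longrightarrow>
        (\<exists>b\<in>mor \<C> B B'. b \<cdot>\<^bsub>\<C>\<^esub> x = x' \<cdot>\<^bsub>\<C>\<^esub> a \<and> y' \<cdot>\<^bsub>\<C>\<^esub> b = c \<cdot>\<^bsub>\<C>\<^esub> y))"

text \<open>
  \<open>\<epsilon>\<close> is \<open>\<delta> \<oplus> \<delta>'\<close>: its components under
  \<open>\<E>(C \<oplus> C', A \<oplus> A') \<cong> \<E>(C, A) \<oplus> \<E>(C, A') \<oplus> \<E>(C', A) \<oplus> \<E>(C', A')\<close> are \<open>(\<delta>, 0, 0, \<delta>')\<close>.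
  Here \<open>U\<close> and \<open>S\<close> are biproducts \<open>C \<oplus> C'\<close> and \<open>A \<oplus> A'\<close>.
\<close>

definition is_ext_sum ::
  "('o, 'm, 'e) bifun \<Rightarrow> 'o \<Rightarrow> 'o \<Rightarrow> 'e \<Rightarrow> 'o \<Rightarrow> 'o \<Rightarrow> 'e
    \<Rightarrow> ('o, 'm) biprod \<Rightarrow> ('o, 'm) biprod \<Rightarrow> 'e \<Rightarrow> bool" where
  "is_ext_sum \<E> C A \<delta> C' A' \<delta>' U S \<epsilon> \<longleftrightarrow> \<epsilon> \<in> carrier (Ext \<E> (Sum U) (Sum S)) \<and>
     Act \<E> (In1 U) (Pr1 S) \<epsilon> = \<delta> \<and> Act \<E> (In1 U) (Pr2 S) \<epsilon> = \<one>\<^bsub>Ext \<E> C A'\<^esub> \<and>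
     Act \<E> (In2 U) (Pr1 S) \<epsilon> = \<one>\<^bsub>Ext \<E> C' A\<^esub> \<and> Act \<E> (In2 U) (Pr2 S) \<epsilon> = \<delta>'"

text \<open>
  No biproducts are singled out; additivity is required for all choices of biproducts, which
  amounts to requiring it for one choice since biproducts are unique up to isomorphism.
\<close>

definition additive_realization ::
  "('o, 'm, 'z) cat_scheme \<Rightarrow> ('o, 'm, 'e) bifun \<Rightarrow> ('o, 'm, 'e) realz \<Rightarrow> bool" where
  "additive_realization \<C> \<E> s \<longleftrightarrow> realization \<C> \<E> s \<and>
     (\<forall>A\<in>Ob \<C>. \<forall>C\<in>Ob \<C>. \<forall>S. biproduct \<C> A C S \<longrightarrow>
        s C A \<one>\<^bsub>Ext \<E> C A\<^esub> = seq_class \<C> A C (In1 S) (Sum S) (Pr2 S)) \<and>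
     (\<forall>A x B y C \<delta> A' x' B' y' C' \<delta>' S T U \<epsilon>.
        E_triangle \<C> \<E> s A x B y C \<delta> \<longrightarrow> E_triangle \<C> \<E> s A' x' B' y' C' \<delta>' \<longrightarrow>
        biproduct \<C> A A' S \<longrightarrow> biproduct \<C> B B' T \<longrightarrow> biproduct \<C> C C' U \<longrightarrow>
        is_ext_sum \<E> C A \<delta> C' A' \<delta>' U S \<epsilon> \<longrightarrow>
        s (Sum U) (Sum S) \<epsilon> =
          seq_class \<C> (Sum S) (Sum U) (dsum_mor \<C> S T x x') (Sum T) (dsum_mor \<C> T U y y'))"


section \<open>Extriangulated categories\<close>

locale extriangulated_category =
  fixes \<C> :: "('o, 'm, 'z) cat_scheme" (structure)
    and \<E> :: "('o, 'm, 'e) bifun"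
    and s :: "('o, 'm, 'e) realz"
  assumes ET1: "biadditive_bifunctor \<C> \<E>"
    and ET2: "additive_realization \<C> \<E> s"
    and ET3: "\<lbrakk>E_triangle \<C> \<E> s A x B y C \<delta>; E_triangle \<C> \<E> s A' x' B' y' C' \<delta>';
        a \<in> mor \<C> A A'; b \<in> mor \<C> B B'; b \<cdot> x = x' \<cdot> a\<rbrakk>
        \<Longrightarrow> \<exists>c. ext_morphism \<C> \<E> C A \<delta> C' A' \<delta>' a c \<and> y' \<cdot> b = c \<cdot> y"
    and ET3_op: "\<lbrakk>E_triangle \<C> \<E> s A x B y C \<delta>; E_triangle \<C> \<E> s A' x' B' y' C' \<delta>';
        b \<in> mor \<C> B B'; c \<in> mor \<C> C C'; y' \<cdot> b = c \<cdot> y\<rbrakk>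
        \<Longrightarrow> \<exists>a. ext_morphism \<C> \<E> C A \<delta> C' A' \<delta>' a c \<and> b \<cdot> x = x' \<cdot> a"
    and ET4: "\<lbrakk>E_triangle \<C> \<E> s A f B f' D \<delta>; E_triangle \<C> \<E> s B g C g' F \<delta>'\<rbrakk>
        \<Longrightarrow> \<exists>E h h' \<delta>'' d e. E_triangle \<C> \<E> s A h C h' E \<delta>'' \<and> h = g \<cdot> f \<and>
          d \<in> mor \<C> D E \<and> e \<in> mor \<C> E F \<and> d \<cdot> f' = h' \<cdot> g \<and> e \<cdot> h' = g' \<and>
          E_triangle \<C> \<E> s D d E e F (push \<C> \<E> F f' \<delta>') \<and>
          pull \<C> \<E> A d \<delta>'' = \<delta> \<and>
          push \<C> \<E> E f \<delta>'' = pull \<C> \<E> B e \<delta>'"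
    and ET4_op: "\<lbrakk>E_triangle \<C> \<E> s D f' A f B \<delta>; E_triangle \<C> \<E> s F g' B g C \<delta>'\<rbrakk>
        \<Longrightarrow> \<exists>E h h' \<delta>'' d e. E_triangle \<C> \<E> s E h' A h C \<delta>'' \<and> h = g \<cdot> f \<and>
          d \<in> mor \<C> D E \<and> e \<in> mor \<C> E F \<and> h' \<cdot> d = f' \<and> f \<cdot> h' = g' \<cdot> e \<and>
          E_triangle \<C> \<E> s D d E e F (pull \<C> \<E> D g' \<delta>) \<and>
          \<delta>' = push \<C> \<E> C e \<delta>'' \<and>
          push \<C> \<E> B d \<delta> = pull \<C> \<E> E g \<delta>''"

definition inflation ::
  "('o, 'm, 'z) cat_scheme \<Rightarrow> ('o, 'm, 'e) bifun \<Rightarrow> ('o, 'm, 'e) realz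
    \<Rightarrow> 'o \<Rightarrow> 'o \<Rightarrow> 'm \<Rightarrow> bool" where
  "inflation \<C> \<E> s A B x \<longleftrightarrow> (\<exists>y C \<delta>. E_triangle \<C> \<E> s A x B y C \<delta>)"

definition deflation ::
  "('o, 'm, 'z) cat_scheme \<Rightarrow> ('o, 'm, 'e) bifun \<Rightarrow> ('o, 'm, 'e) realz
    \<Rightarrow> 'o \<Rightarrow> 'o \<Rightarrow> 'm \<Rightarrow> bool" where
  "deflation \<C> \<E> s B C y \<longleftrightarrow> (\<exists>A x \<delta>. E_triangle \<C> \<E> s A x B y C \<delta>)"

definition Proj ::
  "('o, 'm, 'z) cat_scheme \<Rightarrow> ('o, 'm, 'e) bifun \<Rightarrow> ('o, 'm, 'e) realz \<Rightarrow> 'o set" where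
  "Proj \<C> \<E> s = {P \<in> Ob \<C>. \<forall>B C y c. deflation \<C> \<E> s B C y \<longrightarrow> c \<in> mor \<C> P C \<longrightarrow>
     (\<exists>b\<in>mor \<C> P B. y \<cdot>\<^bsub>\<C>\<^esub> b = c)}"

definition Inj ::
  "('o, 'm, 'z) cat_scheme \<Rightarrow> ('o, 'm, 'e) bifun \<Rightarrow> ('o, 'm, 'e) realz \<Rightarrow> 'o set" where
  "Inj \<C> \<E> s = {I \<in> Ob \<C>. \<forall>A B x a. inflation \<C> \<E> s A B x \<longrightarrow> a \<in> mor \<C> A I \<longrightarrow>
     (\<exists>b\<in>mor \<C> B I. b \<cdot>\<^bsub>\<C>\<^esub> x = a)}"


section \<open>Ideal quotients\<close>

definition factoring ::
  "('o, 'm, 'z) cat_scheme \<Rightarrow> 'o set \<Rightarrow> 'o \<Rightarrow> 'o \<Rightarrow> 'm set" where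
  "factoring \<C> \<I> A B = {h \<cdot>\<^bsub>\<C>\<^esub> g | g h N. N \<in> \<I> \<and> g \<in> mor \<C> A N \<and> h \<in> mor \<C> N B}"

text \<open>
  By disjointness of the morphism sets, exactly one pair \<open>(A, B)\<close> contributes to the class of a
  morphism.
\<close>

definition mor_class :: "('o, 'm, 'z) cat_scheme \<Rightarrow> 'o set \<Rightarrow> 'm \<Rightarrow> 'm set" where
  "mor_class \<C> \<I> f = {f'. \<exists>A\<in>Ob \<C>. \<exists>B\<in>Ob \<C>. f \<in> mor \<C> A B \<and>
     f' \<in> factoring \<C> \<I> A B #>\<^bsub>Hom \<C> A B\<^esub> f}"

text \<open>
  The union in the composition is taken over one and the same class \<open>[g f]\<close>, which does not
  depend on the representatives.
\<close>

definition quotient_category ::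
  "('o, 'm, 'z) cat_scheme \<Rightarrow> 'o set \<Rightarrow> ('o, 'm set) cat" where
  "quotient_category \<C> \<I> = \<lparr>
     Ob = Ob \<C>,
     Hom = (\<lambda>A B. Hom \<C> A B Mod factoring \<C> \<I> A B),
     Ident = (\<lambda>A. mor_class \<C> \<I> (Ident \<C> A)),
     Comp = (\<lambda>G F. \<Union>g\<in>G. \<Union>f\<in>F. mor_class \<C> \<I> (g \<cdot>\<^bsub>\<C>\<^esub> f))\<rparr>"

text \<open>
  The equations determine \<open>\<E>'\<close> and \<open>s'\<close> on all objects, morphisms and extensions of the
  quotient; that such \<open>\<E>'\<close> and \<open>s'\<close> exist means that the induced structure is independent of
  representatives.
\<close>

definition induced_structure ::
  "('o, 'm, 'z) cat_scheme \<Rightarrow> ('o, 'm, 'e) bifun \<Rightarrow> ('o, 'm, 'e) realz \<Rightarrow> 'o set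
    \<Rightarrow> ('o, 'm set, 'e) bifun \<Rightarrow> ('o, 'm set, 'e) realz \<Rightarrow> bool" where
  "induced_structure \<C> \<E> s \<I> \<E>' s' \<longleftrightarrow>
     (\<forall>A\<in>Ob \<C>. \<forall>C\<in>Ob \<C>. Ext \<E>' C A = Ext \<E> C A) \<and>
     (\<forall>A\<in>Ob \<C>. \<forall>A'\<in>Ob \<C>. \<forall>C\<in>Ob \<C>. \<forall>C'\<in>Ob \<C>.
        \<forall>c\<in>mor \<C> C' C. \<forall>a\<in>mor \<C> A A'. \<forall>\<delta>\<in>carrier (Ext \<E> C A).
          Act \<E>' (mor_class \<C> \<I> c) (mor_class \<C> \<I> a) \<delta> = Act \<E> c a \<delta>) \<and>
     (\<forall>A x B y C \<delta>. E_triangle \<C> \<E> s A x B y C \<delta> \<longrightarrow>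
        s' C A \<delta> = seq_class (quotient_category \<C> \<I>) A C
                     (mor_class \<C> \<I> x) B (mor_class \<C> \<I> y))"

end

theory Submission
  imports Defs
begin

text \<open>
  Extensions by or of objects of \<open>\<I>\<close> vanish, so \<open>\<E>(c, a)\<close> depends only on the classes of \<open>c\<close>
  and \<open>a\<close>, and a square commuting in the quotient can be made to commute in \<open>\<C>\<close> by changing its
  middle morphism within its class; this gives (ET3) and its dual. The remaining axioms involve
  objects that are isomorphic in the quotient but not in \<open>\<C>\<close>. They are obtained by moving extensions
  along such isomorphisms, taking direct sums and octahedra in \<open>\<C>\<close>, and moving back. This is
  possible because triangles are stable under isomorphisms of their ends, a consequence of the five
  lemma, which only needs (ET3) and its dual. Finally, objects that are projective or injective in the
  quotient are so in \<open>\<C>\<close>, and objects of \<open>\<I>\<close> become zero.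
\<close>

section \<open>Calculus of morphisms\<close>

text \<open>The obstacle is composability. Two triangles of the quotient that share an object lift
  to triangles of \<open>\<C>\<close> in which this object has two different substitutes, linked
  only by an isomorphism of the quotient; so the axioms of \<open>\<C>\<close> do not apply to the
  lifts as they stand. What does not change is the extension groups: they are the same in
  \<open>\<C>\<close> and in the quotient, so an extension can be moved in the quotient and then
  realized afresh in \<open>\<C>\<close>. That the fresh realization agrees with the moved sequence
  is a statement about the quotient, needed before the quotient is known to be extriangulated. To
  avoid this circle, the locale \<open>pre_extriangulated\<close> is interpreted twice: for
  \<open>\<C>\<close>, and for the quotient as soon as (ET3) and its dual hold there. Additivity and
  (ET4) in the quotient are proved after that second interpretation.\<close>

context preadditive_category
begin

definition arr :: "'m \<Rightarrow> 'o \<Rightarrow> 'o \<Rightarrow> bool" where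
  "arr f A B \<longleftrightarrow> A \<in> Ob \<C> \<and> B \<in> Ob \<C> \<and> f \<in> mor \<C> A B"

definition is_arr :: "'m \<Rightarrow> bool" where
  "is_arr f \<longleftrightarrow> (\<exists>A B. arr f A B)"

definition dm :: "'m \<Rightarrow> 'o" where
  "dm f = (THE A. \<exists>B. arr f A B)"

definition cd :: "'m \<Rightarrow> 'o" where
  "cd f = (THE B. \<exists>A. arr f A B)"

text \<open>The group is read off from the ends of the left summand. Sums thereby lose their object
  arguments, and the ring-like laws become conditional rewrite rules.\<close>

definition plus :: "'m \<Rightarrow> 'm \<Rightarrow> 'm"  (infixl \<open>\<oplus>\<close> 65) where
  "f \<oplus> g = f \<otimes>\<^bsub>Hom \<C> (dm f) (cd f)\<^esub> g"

definition neg :: "'m \<Rightarrow> 'm" where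
  "neg f = inv\<^bsub>Hom \<C> (dm f) (cd f)\<^esub> f"

abbreviation zr :: "'o \<Rightarrow> 'o \<Rightarrow> 'm" where
  "zr A B \<equiv> \<one>\<^bsub>Hom \<C> A B\<^esub>"

lemma arr_dm_cd: "arr f A B \<Longrightarrow> dm f = A \<and> cd f = B"
  unfolding dm_def cd_def arr_def
  by (intro conjI the_equality) (use Hom_disjoint in blast)+

text \<open>Links two styles: \<open>arr f A B\<close> is convenient in statements, while
  \<open>is_arr\<close>, \<open>dm\<close> and \<open>cd\<close> give rewrite rules whose side
  conditions contain no objects to be guessed.\<close>

lemma arr_iff: "arr f A B \<longleftrightarrow> is_arr f \<and> dm f = A \<and> cd f = B"
  using arr_dm_cd by (auto simp: is_arr_def)

lemma arrD:
  assumes "arr f A B"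
  shows "is_arr f" "dm f = A" "cd f = B" "A \<in> Ob \<C>" "B \<in> Ob \<C>" "f \<in> mor \<C> A B"
  using assms arr_iff by (auto simp: arr_def)

lemma is_arrD:
  assumes "is_arr f"
  shows "dm f \<in> Ob \<C>" "cd f \<in> Ob \<C>" "f \<in> mor \<C> (dm f) (cd f)"
  using assms arr_iff by (auto simp: arr_def)

lemma is_arr_comp:
  assumes "is_arr f" "is_arr g" "dm g = cd f"
  shows "is_arr (g \<cdot> f)" "dm (g \<cdot> f) = dm f" "cd (g \<cdot> f) = cd g"
proof -
  have "arr (g \<cdot> f) (dm f) (cd g)"
    unfolding arr_def using assms is_arrD Comp_closed by metis
  then show "is_arr (g \<cdot> f)" "dm (g \<cdot> f) = dm f" "cd (g \<cdot> f) = cd g"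
    by (auto simp: arr_iff)
qed

lemma comp_assoc:
  assumes "is_arr f" "is_arr g" "is_arr h" "dm g = cd f" "dm h = cd g"
  shows "(h \<cdot> g) \<cdot> f = h \<cdot> (g \<cdot> f)"
  using assms is_arrD Comp_assoc by metis

lemma is_arr_Ident:
  assumes "A \<in> Ob \<C>"
  shows "is_arr (Ident \<C> A)" "dm (Ident \<C> A) = A" "cd (Ident \<C> A) = A"
  using assms Ident_closed[OF assms] arr_iff[of "Ident \<C> A" A A] by (auto simp: arr_def)

lemma comp_Ident_left: "\<lbrakk>is_arr f; cd f = B\<rbrakk> \<Longrightarrow> Ident \<C> B \<cdot> f = f"
  using is_arrD Ident_left by blast

lemma comp_Ident_right: "\<lbrakk>is_arr f; dm f = A\<rbrakk> \<Longrightarrow> f \<cdot> Ident \<C> A = f"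
  using is_arrD Ident_right by blast

lemma is_arr_zr:
  assumes "A \<in> Ob \<C>" "B \<in> Ob \<C>"
  shows "is_arr (zr A B)" "dm (zr A B) = A" "cd (zr A B) = B"
proof -
  interpret comm_group "Hom \<C> A B" using Hom_group assms by blast
  have "arr (zr A B) A B" using assms by (simp add: arr_def)
  then show "is_arr (zr A B)" "dm (zr A B) = A" "cd (zr A B) = B" by (auto simp: arr_iff)
qed

lemma is_arr_plus:
  assumes "is_arr f" "is_arr g" "dm g = dm f" "cd g = cd f"
  shows "is_arr (f \<oplus> g)" "dm (f \<oplus> g) = dm f" "cd (f \<oplus> g) = cd f"
proof -
  interpret comm_group "Hom \<C> (dm f) (cd f)" using Hom_group assms is_arrD by blast
  have "arr (f \<oplus> g) (dm f) (cd f)"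
    unfolding arr_def plus_def using assms is_arrD m_closed by metis
  then show "is_arr (f \<oplus> g)" "dm (f \<oplus> g) = dm f" "cd (f \<oplus> g) = cd f" by (auto simp: arr_iff)
qed

lemma is_arr_neg:
  assumes "is_arr f"
  shows "is_arr (neg f)" "dm (neg f) = dm f" "cd (neg f) = cd f"
proof -
  interpret comm_group "Hom \<C> (dm f) (cd f)" using Hom_group assms is_arrD by blast
  have "arr (neg f) (dm f) (cd f)"
    unfolding arr_def neg_def using assms is_arrD inv_closed by metis
  then show "is_arr (neg f)" "dm (neg f) = dm f" "cd (neg f) = cd f" by (auto simp: arr_iff)
qed

lemma plus_assoc:
  assumes "is_arr f" "is_arr g" "is_arr h" "dm g = dm f" "cd g = cd f" "dm h = dm f" "cd h = cd f"
  shows "(f \<oplus> g) \<oplus> h = f \<oplus> (g \<oplus> h)"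
proof -
  interpret comm_group "Hom \<C> (dm f) (cd f)" using Hom_group assms is_arrD by blast
  show ?thesis
    using assms is_arrD(3)[of f] is_arrD(3)[of g] is_arrD(3)[of h] m_assoc
    by (simp add: plus_def is_arr_plus[unfolded plus_def])
qed

lemma plus_comm:
  assumes "is_arr f" "is_arr g" "dm g = dm f" "cd g = cd f"
  shows "f \<oplus> g = g \<oplus> f"
proof -
  interpret comm_group "Hom \<C> (dm f) (cd f)" using Hom_group assms is_arrD by blast
  show ?thesis
    using assms is_arrD(3)[of f] is_arrD(3)[of g] m_comm by (simp add: plus_def)
qed

lemma plus_left_comm:
  assumes "is_arr f" "is_arr g" "is_arr h" "dm g = dm f" "cd g = cd f" "dm h = dm f" "cd h = cd f"
  shows "f \<oplus> (g \<oplus> h) = g \<oplus> (f \<oplus> h)"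
  using assms plus_assoc[of f g h] plus_assoc[of g f h] plus_comm[of f g] by simp

lemma plus_zr:
  assumes "is_arr f" "dm f = A" "cd f = B"
  shows "f \<oplus> zr A B = f" "zr A B \<oplus> f = f"
proof -
  interpret comm_group "Hom \<C> A B" using Hom_group assms is_arrD by blast
  show "f \<oplus> zr A B = f" "zr A B \<oplus> f = f"
    using assms is_arrD[of f] is_arr_zr[of A B] by (auto simp: plus_def)
qed

lemma plus_neg:
  assumes "is_arr f"
  shows "f \<oplus> neg f = zr (dm f) (cd f)" "neg f \<oplus> f = zr (dm f) (cd f)"
proof -
  interpret comm_group "Hom \<C> (dm f) (cd f)" using Hom_group assms is_arrD by blast
  show "f \<oplus> neg f = zr (dm f) (cd f)" "neg f \<oplus> f = zr (dm f) (cd f)"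
    using assms is_arrD[of f] is_arr_neg[of f] by (auto simp: plus_def neg_def)
qed

lemma plus_neg_cancel:
  assumes "is_arr f" "is_arr g" "dm g = dm f" "cd g = cd f"
  shows "f \<oplus> (g \<oplus> neg f) = g"
proof -
  have "f \<oplus> (g \<oplus> neg f) = f \<oplus> (neg f \<oplus> g)"
    using assms by (subst plus_comm[of g]) (auto simp: is_arr_neg)
  also have "\<dots> = (f \<oplus> neg f) \<oplus> g"
    using assms by (subst plus_assoc) (auto simp: is_arr_neg)
  also have "\<dots> = g" using assms by (simp add: plus_neg plus_zr)
  finally show ?thesis .
qed

lemma comp_plus_right:
  assumes "is_arr f" "is_arr f'" "is_arr g" "dm f' = dm f" "cd f' = cd f" "dm g = cd f"
  shows "g \<cdot> (f \<oplus> f') = g \<cdot> f \<oplus> g \<cdot> f'"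
  using assms is_arrD[of f] is_arrD[of f'] is_arrD[of g]
    Comp_add_right[of "dm f" "cd f" "cd g" f f' g]
  by (simp add: plus_def is_arr_comp)

lemma comp_plus_left:
  assumes "is_arr f" "is_arr g" "is_arr g'" "dm g' = dm g" "cd g' = cd g" "dm g = cd f"
  shows "(g \<oplus> g') \<cdot> f = g \<cdot> f \<oplus> g' \<cdot> f"
  using assms is_arrD[of f] is_arrD[of g] is_arrD[of g']
    Comp_add_left[of "dm f" "cd f" "cd g" f g g']
  by (simp add: plus_def is_arr_comp)

lemma idem_plus_zr:
  assumes "is_arr f" "f \<oplus> f = f"
  shows "f = zr (dm f) (cd f)"
proof -
  have "f = f \<oplus> (f \<oplus> neg f)" using assms by (simp add: plus_neg plus_zr)
  also have "\<dots> = (f \<oplus> f) \<oplus> neg f" using assms by (subst plus_assoc) (auto simp: is_arr_neg)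
  also have "\<dots> = zr (dm f) (cd f)" using assms by (simp add: plus_neg)
  finally show ?thesis .
qed

lemma comp_zr_right:
  assumes "A \<in> Ob \<C>" "is_arr g" "dm g = B"
  shows "g \<cdot> zr A B = zr A (cd g)"
proof -
  have B: "B \<in> Ob \<C>" using assms is_arrD by blast
  have "g \<cdot> zr A B \<oplus> g \<cdot> zr A B = g \<cdot> (zr A B \<oplus> zr A B)"
    using assms B by (subst comp_plus_right) (auto simp: is_arr_zr)
  then show ?thesis using assms B idem_plus_zr[of "g \<cdot> zr A B"]
    by (simp add: is_arr_zr is_arr_comp plus_zr)
qed

lemma comp_zr_left:
  assumes "C \<in> Ob \<C>" "is_arr f" "cd f = B"
  shows "zr B C \<cdot> f = zr (dm f) C"
proof -
  have B: "B \<in> Ob \<C>" using assms is_arrD by blast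
  have "zr B C \<cdot> f \<oplus> zr B C \<cdot> f = (zr B C \<oplus> zr B C) \<cdot> f"
    using assms B by (subst comp_plus_left) (auto simp: is_arr_zr)
  then show ?thesis using assms B idem_plus_zr[of "zr B C \<cdot> f"]
    by (simp add: is_arr_zr is_arr_comp plus_zr)
qed

text \<open>Computes a normal form: composites are nested to the right and expanded over sums,
  identities and zeros disappear. Rearrangement of sums is left out and is requested only where it
  is needed.\<close>

lemmas arr_simps = is_arrD(1,2) is_arr_comp is_arr_Ident is_arr_zr is_arr_plus is_arr_neg
  comp_assoc comp_Ident_left comp_Ident_right plus_zr
  comp_plus_right comp_plus_left comp_zr_right comp_zr_left

lemma arr_compI: "\<lbrakk>arr f A B; arr g B C\<rbrakk> \<Longrightarrow> arr (g \<cdot> f) A C"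
  by (simp add: arr_iff arr_simps)

lemma arr_plusI: "\<lbrakk>arr f A B; arr g A B\<rbrakk> \<Longrightarrow> arr (f \<oplus> g) A B"
  by (simp add: arr_iff arr_simps)

lemma arr_IdentI: "A \<in> Ob \<C> \<Longrightarrow> arr (Ident \<C> A) A A"
  by (simp add: arr_iff arr_simps)

lemma plus_eq: "\<lbrakk>is_arr f; dm f = A; cd f = B\<rbrakk> \<Longrightarrow> f \<otimes>\<^bsub>Hom \<C> A B\<^esub> g = f \<oplus> g"
  by (simp add: plus_def)

text \<open>Allows a relation \<open>g f = k\<close> to be used inside a right-nested composite.\<close>

lemma comp_reassoc:
  assumes "g \<cdot> f = k" "is_arr f" "is_arr g" "is_arr t" "dm g = cd f" "dm f = cd t"
  shows "g \<cdot> (f \<cdot> t) = k \<cdot> t"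
  using assms comp_assoc[of t f g] by simp

section \<open>Isomorphisms and equivalence of sequences\<close>

definition inverses :: "'o \<Rightarrow> 'o \<Rightarrow> 'm \<Rightarrow> 'm \<Rightarrow> bool" where
  "inverses A B f g \<longleftrightarrow> arr f A B \<and> arr g B A \<and> g \<cdot> f = Ident \<C> A \<and> f \<cdot> g = Ident \<C> B"

lemma inversesD:
  assumes "inverses A B f g"
  shows "is_arr f" "dm f = A" "cd f = B" "is_arr g" "dm g = B" "cd g = A"
    "A \<in> Ob \<C>" "B \<in> Ob \<C>"
    "g \<cdot> f = Ident \<C> A" "f \<cdot> g = Ident \<C> B"
    "\<lbrakk>is_arr t; cd t = A\<rbrakk> \<Longrightarrow> g \<cdot> (f \<cdot> t) = t"
    "\<lbrakk>is_arr u; cd u = B\<rbrakk> \<Longrightarrow> f \<cdot> (g \<cdot> u) = u"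
proof -
  show *: "is_arr f" "dm f = A" "cd f = B" "is_arr g" "dm g = B" "cd g = A"
    "A \<in> Ob \<C>" "B \<in> Ob \<C>" "g \<cdot> f = Ident \<C> A" "f \<cdot> g = Ident \<C> B"
    using assms arrD[of f A B] arrD[of g B A] by (auto simp: inverses_def)
  show "\<lbrakk>is_arr t; cd t = A\<rbrakk> \<Longrightarrow> g \<cdot> (f \<cdot> t) = t" "\<lbrakk>is_arr u; cd u = B\<rbrakk> \<Longrightarrow> f \<cdot> (g \<cdot> u) = u"
    using * comp_reassoc[of g f "Ident \<C> A" t] comp_reassoc[of f g "Ident \<C> B" u]
    by (auto simp: arr_simps)
qed

lemma inverses_sym: "inverses A B f g \<Longrightarrow> inverses B A g f"
  by (auto simp: inverses_def)

lemma inverses_Ident: "A \<in> Ob \<C> \<Longrightarrow> inverses A A (Ident \<C> A) (Ident \<C> A)"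
  by (simp add: inverses_def arr_iff arr_simps)

lemma inverses_comp:
  assumes "inverses A B f f'" "inverses B C g g'"
  shows "inverses A C (g \<cdot> f) (f' \<cdot> g')"
  unfolding inverses_def arr_iff using inversesD[OF assms(1)] inversesD[OF assms(2)]
  by (simp add: arr_simps)

lemma isomorphism_iff:
  "A \<in> Ob \<C> \<Longrightarrow> B \<in> Ob \<C> \<Longrightarrow> isomorphism \<C> A B f \<longleftrightarrow> (\<exists>g. inverses A B f g)"
  by (auto simp: isomorphism_def inverses_def arr_def)

lemma inverses_left_right:
  assumes "arr b A B" "arr l B A" "arr r B A" "l \<cdot> b = Ident \<C> A" "b \<cdot> r = Ident \<C> B"
  shows "inverses A B b l"
proof -
  note a = arrD[OF assms(1)] arrD[OF assms(2)] arrD[OF assms(3)]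
  have "l = l \<cdot> (b \<cdot> r)" using a assms(5) by (simp add: arr_simps)
  also have "\<dots> = (l \<cdot> b) \<cdot> r" using a by (subst comp_assoc) auto
  also have "\<dots> = r" using a assms(4) by (simp add: arr_simps)
  finally show ?thesis using assms by (auto simp: inverses_def)
qed

lemma seq_rel_iff:
  assumes "A \<in> Ob \<C>" "C \<in> Ob \<C>"
  shows "((x, B, y), (x', B', y')) \<in> seq_rel \<C> A C \<longleftrightarrow>
    arr x A B \<and> arr y B C \<and> arr x' A B' \<and> arr y' B' C \<and>
    (\<exists>b b'. inverses B B' b b' \<and> b \<cdot> x = x' \<and> y' \<cdot> b = y)"
  unfolding seq_rel_def seqs_def arr_def using assms isomorphism_iff by fastforce

lemma seqs_iff:
  assumes "A \<in> Ob \<C>" "C \<in> Ob \<C>"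
  shows "(x, B, y) \<in> seqs \<C> A C \<longleftrightarrow> arr x A B \<and> arr y B C"
  using assms by (auto simp: seqs_def arr_def)

lemma equiv_seq_rel:
  assumes "A \<in> Ob \<C>" "C \<in> Ob \<C>"
  shows "equiv (seqs \<C> A C) (seq_rel \<C> A C)"
proof (rule equivI)
  show "seq_rel \<C> A C \<subseteq> seqs \<C> A C \<times> seqs \<C> A C"
    by (auto simp: seq_rel_def)
  show "refl_on (seqs \<C> A C) (seq_rel \<C> A C)"
  proof (rule refl_onI; clarify)
    fix x B y assume "(x, B, y) \<in> seqs \<C> A C"
    then have a: "arr x A B" "arr y B C" using seqs_iff assms by auto
    show "((x, B, y), x, B, y) \<in> seq_rel \<C> A C"
      unfolding seq_rel_iff[OF assms] using a arrD[OF a(1)] arrD[OF a(2)]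
      by (metis inverses_Ident comp_Ident_left comp_Ident_right)
  qed
  show "sym (seq_rel \<C> A C)"
  proof (rule symI; clarify)
    fix x B y x' B' y' assume "((x, B, y), (x', B', y')) \<in> seq_rel \<C> A C"
    then obtain b b' where a: "arr x A B" "arr y B C" "arr x' A B'" "arr y' B' C"
      "inverses B B' b b'" "b \<cdot> x = x'" "y' \<cdot> b = y"
      unfolding seq_rel_iff[OF assms] by blast
    note t = arrD[OF a(1)] arrD[OF a(2)] arrD[OF a(3)] arrD[OF a(4)] inversesD[OF a(5)]
    have "b' \<cdot> x' = x" "y \<cdot> b' = y'"
      using t by (simp_all add: a(6)[symmetric] a(7)[symmetric] arr_simps)
    then show "((x', B', y'), (x, B, y)) \<in> seq_rel \<C> A C"
      unfolding seq_rel_iff[OF assms] using a inverses_sym by blast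
  qed
  show "trans (seq_rel \<C> A C)"
  proof (rule transI; clarify)
    fix x B y x' B' y' x'' B'' y''
    assume "((x, B, y), (x', B', y')) \<in> seq_rel \<C> A C" "((x', B', y'), (x'', B'', y'')) \<in> seq_rel \<C> A C"
    then obtain b b' c c' where a: "arr x A B" "arr y B C" "arr x' A B'" "arr y' B' C"
      "inverses B B' b b'" "b \<cdot> x = x'" "y' \<cdot> b = y"
      "arr x'' A B''" "arr y'' B'' C" "inverses B' B'' c c'" "c \<cdot> x' = x''" "y'' \<cdot> c = y'"
      unfolding seq_rel_iff[OF assms] by blast
    note t = arrD[OF a(1)] arrD[OF a(2)] arrD[OF a(3)] arrD[OF a(4)] inversesD[OF a(5)]
      arrD[OF a(8)] arrD[OF a(9)] inversesD[OF a(10)]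
    have "(c \<cdot> b) \<cdot> x = x''" "y'' \<cdot> (c \<cdot> b) = y"
      using t a by (simp_all add: arr_simps comp_reassoc[OF a(12)])
    then show "((x, B, y), (x'', B'', y'')) \<in> seq_rel \<C> A C"
      unfolding seq_rel_iff[OF assms] using a inverses_comp by blast
  qed
qed

section \<open>Biproducts and direct sums of morphisms\<close>

lemma biproduct_iff:
  assumes "A \<in> Ob \<C>" "B \<in> Ob \<C>"
  shows "biproduct \<C> A B S \<longleftrightarrow>
    arr (In1 S) A (Sum S) \<and> arr (In2 S) B (Sum S) \<and> arr (Pr1 S) (Sum S) A \<and> arr (Pr2 S) (Sum S) B \<and>
    Pr1 S \<cdot> In1 S = Ident \<C> A \<and> Pr2 S \<cdot> In2 S = Ident \<C> B \<and>
    Pr2 S \<cdot> In1 S = zr A B \<and> Pr1 S \<cdot> In2 S = zr B A \<and>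
    In1 S \<cdot> Pr1 S \<oplus> In2 S \<cdot> Pr2 S = Ident \<C> (Sum S)"
  (is "?L \<longleftrightarrow> ?R")
proof -
  have "(In1 S \<cdot> Pr1 S) \<otimes>\<^bsub>Hom \<C> (Sum S) (Sum S)\<^esub> (In2 S \<cdot> Pr2 S) = In1 S \<cdot> Pr1 S \<oplus> In2 S \<cdot> Pr2 S"
    if "arr (In1 S) A (Sum S)" "arr (Pr1 S) (Sum S) A"
    using arrD[OF that(1)] arrD[OF that(2)] by (intro plus_eq) (simp_all add: arr_simps)
  then show ?thesis using assms unfolding biproduct_def arr_def by auto
qed

lemma biproductD:
  assumes "A \<in> Ob \<C>" "B \<in> Ob \<C>" "biproduct \<C> A B S"
  shows "is_arr (In1 S)" "dm (In1 S) = A" "cd (In1 S) = Sum S"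
    "is_arr (In2 S)" "dm (In2 S) = B" "cd (In2 S) = Sum S"
    "is_arr (Pr1 S)" "dm (Pr1 S) = Sum S" "cd (Pr1 S) = A"
    "is_arr (Pr2 S)" "dm (Pr2 S) = Sum S" "cd (Pr2 S) = B"
    "Sum S \<in> Ob \<C>"
    "Pr1 S \<cdot> In1 S = Ident \<C> A" "Pr2 S \<cdot> In2 S = Ident \<C> B"
    "Pr2 S \<cdot> In1 S = zr A B" "Pr1 S \<cdot> In2 S = zr B A"
    "In1 S \<cdot> Pr1 S \<oplus> In2 S \<cdot> Pr2 S = Ident \<C> (Sum S)"
    "\<lbrakk>is_arr t; cd t = A\<rbrakk> \<Longrightarrow> Pr1 S \<cdot> (In1 S \<cdot> t) = t"
    "\<lbrakk>is_arr t; cd t = A\<rbrakk> \<Longrightarrow> Pr2 S \<cdot> (In1 S \<cdot> t) = zr (dm t) B"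
    "\<lbrakk>is_arr u; cd u = B\<rbrakk> \<Longrightarrow> Pr2 S \<cdot> (In2 S \<cdot> u) = u"
    "\<lbrakk>is_arr u; cd u = B\<rbrakk> \<Longrightarrow> Pr1 S \<cdot> (In2 S \<cdot> u) = zr (dm u) A"
proof -
  show *: "is_arr (In1 S)" "dm (In1 S) = A" "cd (In1 S) = Sum S"
    "is_arr (In2 S)" "dm (In2 S) = B" "cd (In2 S) = Sum S"
    "is_arr (Pr1 S)" "dm (Pr1 S) = Sum S" "cd (Pr1 S) = A"
    "is_arr (Pr2 S)" "dm (Pr2 S) = Sum S" "cd (Pr2 S) = B"
    "Sum S \<in> Ob \<C>"
    "Pr1 S \<cdot> In1 S = Ident \<C> A" "Pr2 S \<cdot> In2 S = Ident \<C> B"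
    "Pr2 S \<cdot> In1 S = zr A B" "Pr1 S \<cdot> In2 S = zr B A"
    "In1 S \<cdot> Pr1 S \<oplus> In2 S \<cdot> Pr2 S = Ident \<C> (Sum S)"
    using assms(3) unfolding biproduct_iff[OF assms(1,2)] by (auto dest: arrD)
  show "\<lbrakk>is_arr t; cd t = A\<rbrakk> \<Longrightarrow> Pr1 S \<cdot> (In1 S \<cdot> t) = t"
    "\<lbrakk>is_arr t; cd t = A\<rbrakk> \<Longrightarrow> Pr2 S \<cdot> (In1 S \<cdot> t) = zr (dm t) B"
    "\<lbrakk>is_arr u; cd u = B\<rbrakk> \<Longrightarrow> Pr2 S \<cdot> (In2 S \<cdot> u) = u"
    "\<lbrakk>is_arr u; cd u = B\<rbrakk> \<Longrightarrow> Pr1 S \<cdot> (In2 S \<cdot> u) = zr (dm u) A"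
    using * assms
    by (simp_all add: comp_reassoc[OF *(14)] comp_reassoc[OF *(15)] comp_reassoc[OF *(16)]
      comp_reassoc[OF *(17)] arr_simps)
qed

lemma dsum_mor_eq:
  assumes "A \<in> Ob \<C>" "A' \<in> Ob \<C>" "B \<in> Ob \<C>" "B' \<in> Ob \<C>"
    "biproduct \<C> A A' S" "biproduct \<C> B B' T" "arr f A B" "arr f' A' B'"
  shows "dsum_mor \<C> S T f f' = In1 T \<cdot> (f \<cdot> Pr1 S) \<oplus> In2 T \<cdot> (f' \<cdot> Pr2 S)"
    "arr (dsum_mor \<C> S T f f') (Sum S) (Sum T)"
proof -
  note t = biproductD[OF assms(1,2,5)] biproductD[OF assms(3,4,6)] arrD[OF assms(7)] arrD[OF assms(8)]
  show e: "dsum_mor \<C> S T f f' = In1 T \<cdot> (f \<cdot> Pr1 S) \<oplus> In2 T \<cdot> (f' \<cdot> Pr2 S)"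
    unfolding dsum_mor_def using t by (subst plus_eq) (simp_all add: arr_simps)
  show "arr (dsum_mor \<C> S T f f') (Sum S) (Sum T)"
    unfolding e arr_iff using t by (simp add: arr_simps)
qed

lemma dsum_mor_comp:
  assumes "A \<in> Ob \<C>" "A' \<in> Ob \<C>" "B \<in> Ob \<C>" "B' \<in> Ob \<C>" "C \<in> Ob \<C>" "C' \<in> Ob \<C>"
    "biproduct \<C> A A' S" "biproduct \<C> B B' T" "biproduct \<C> C C' U"
    "arr f A B" "arr f' A' B'" "arr g B C" "arr g' B' C'"
  shows "dsum_mor \<C> T U g g' \<cdot> dsum_mor \<C> S T f f' = dsum_mor \<C> S U (g \<cdot> f) (g' \<cdot> f')"
proof -
  note t = biproductD[OF assms(1,2,7)] biproductD[OF assms(3,4,8)] biproductD[OF assms(5,6,9)]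
    arrD[OF assms(10)] arrD[OF assms(11)] arrD[OF assms(12)] arrD[OF assms(13)]
  have gf: "arr (g \<cdot> f) A C" "arr (g' \<cdot> f') A' C'" using t by (simp_all add: arr_iff arr_simps)
  show ?thesis
    unfolding dsum_mor_eq(1)[OF assms(3-6,8,9,12,13)] dsum_mor_eq(1)[OF assms(1-4,7,8,10,11)]
      dsum_mor_eq(1)[OF assms(1,2,5,6,7,9) gf]
    using t by (simp add: arr_simps)
qed

lemma dsum_mor_Ident:
  assumes "A \<in> Ob \<C>" "B \<in> Ob \<C>" "biproduct \<C> A B S"
  shows "dsum_mor \<C> S S (Ident \<C> A) (Ident \<C> B) = Ident \<C> (Sum S)"
  using assms biproductD[OF assms]
  by (subst dsum_mor_eq) (simp_all add: arr_iff arr_simps)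

text \<open>With identities for all four morphisms this is the comparison isomorphism between two
  biproducts of the same pair of objects, its main use below.\<close>

lemma dsum_mor_inverses:
  assumes "A \<in> Ob \<C>" "A' \<in> Ob \<C>" "B \<in> Ob \<C>" "B' \<in> Ob \<C>"
    "biproduct \<C> A A' S" "biproduct \<C> B B' T" "inverses A B f g" "inverses A' B' f' g'"
  shows "inverses (Sum S) (Sum T) (dsum_mor \<C> S T f f') (dsum_mor \<C> T S g g')"
proof -
  have a: "arr f A B" "arr f' A' B'" "arr g B A" "arr g' B' A'"
    "g \<cdot> f = Ident \<C> A" "g' \<cdot> f' = Ident \<C> A'" "f \<cdot> g = Ident \<C> B" "f' \<cdot> g' = Ident \<C> B'"
    using assms(7,8) by (auto simp: inverses_def)
  show ?thesis
    unfolding inverses_def dsum_mor_comp[OF assms(1-4,1,2,5,6,5) a(1-4)]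
      dsum_mor_comp[OF assms(3,4,1-4) assms(6,5,6) a(3,4,1,2)] a(5-8)
      dsum_mor_Ident[OF assms(1,2,5)] dsum_mor_Ident[OF assms(3,4,6)]
    using dsum_mor_eq(2) assms a by blast
qed

text \<open>These choices turn the split triangles into \<open>A = A \<rightarrow> Z\<close> and
  \<open>Z \<rightarrow> A = A\<close>. Comparing an arbitrary triangle with them yields all
  exactness statements below.\<close>

lemma biproduct_zero:
  assumes "A \<in> Ob \<C>" "zero_object \<C> Z"
  shows "biproduct \<C> A Z \<lparr>Sum = A, In1 = Ident \<C> A, In2 = zr Z A, Pr1 = Ident \<C> A, Pr2 = zr A Z\<rparr>"
    "biproduct \<C> Z A \<lparr>Sum = A, In1 = zr Z A, In2 = Ident \<C> A, Pr1 = zr A Z, Pr2 = Ident \<C> A\<rparr>"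
proof -
  have Z: "Z \<in> Ob \<C>" and "\<exists>!f. f \<in> mor \<C> Z Z" using assms(2) by (auto simp: zero_object_def)
  \<comment> \<open>This is the one biproduct equation that is not formal: the summand
    \<open>Z\<close> must have zero identity.\<close>
  then have "Ident \<C> Z = zr Z Z" using is_arrD(3)[of "zr Z Z"] Ident_closed by (auto simp: is_arr_zr)
  then show "biproduct \<C> A Z \<lparr>Sum = A, In1 = Ident \<C> A, In2 = zr Z A, Pr1 = Ident \<C> A, Pr2 = zr A Z\<rparr>"
    "biproduct \<C> Z A \<lparr>Sum = A, In1 = zr Z A, In2 = Ident \<C> A, Pr1 = zr A Z, Pr2 = Ident \<C> A\<rparr>"
    using assms(1) Z by (simp_all add: biproduct_iff) (simp_all add: arr_iff arr_simps)
qed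

lemma neg_unique:
  assumes "is_arr f" "is_arr g" "dm g = dm f" "cd g = cd f" "g \<oplus> f = zr (dm f) (cd f)"
  shows "neg f = g"
proof -
  interpret comm_group "Hom \<C> (dm f) (cd f)" using Hom_group assms is_arrD by blast
  show ?thesis
    using assms is_arrD[of f] is_arrD[of g] inv_equality[of g f] by (simp add: neg_def plus_def)
qed

lemma neg_comp:
  assumes "is_arr f" "is_arr g" "dm g = cd f"
  shows "neg (g \<cdot> f) = neg g \<cdot> f"
proof (rule neg_unique)
  have "neg g \<cdot> f \<oplus> g \<cdot> f = (neg g \<oplus> g) \<cdot> f"
    using assms by (intro comp_plus_left[symmetric]) (auto simp: is_arr_neg)
  then show "neg g \<cdot> f \<oplus> g \<cdot> f = zr (dm (g \<cdot> f)) (cd (g \<cdot> f))"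
    using assms by (simp add: plus_neg arr_simps)
qed (use assms in \<open>simp_all add: arr_simps\<close>)

text \<open>Uniqueness of biproducts: the sum of the two identities is an isomorphism respecting
  inclusions and projections. It is applied in the quotient, where a biproduct need not be the image
  of one in \<open>\<C>\<close>.\<close>

lemma biproduct_seq_rel:
  assumes "A \<in> Ob \<C>" "C \<in> Ob \<C>" "biproduct \<C> A C R" "biproduct \<C> A C S"
  shows "((In1 R, Sum R, Pr2 R), (In1 S, Sum S, Pr2 S)) \<in> seq_rel \<C> A C"
proof -
  note t = biproductD[OF assms(1,2,3)] biproductD[OF assms(1,2,4)]
  note i = inverses_Ident[OF assms(1)] inverses_Ident[OF assms(2)]
  have e: "dsum_mor \<C> R S (Ident \<C> A) (Ident \<C> C) = In1 S \<cdot> Pr1 R \<oplus> In2 S \<cdot> Pr2 R"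
    using assms t by (subst dsum_mor_eq(1)[of A C A C]) (simp_all add: arr_iff arr_simps)
  have "inverses (Sum R) (Sum S) (dsum_mor \<C> R S (Ident \<C> A) (Ident \<C> C)) (dsum_mor \<C> S R (Ident \<C> A) (Ident \<C> C))"
    using dsum_mor_inverses[OF assms(1,2,1,2,3,4) i] .
  moreover have "dsum_mor \<C> R S (Ident \<C> A) (Ident \<C> C) \<cdot> In1 R = In1 S"
    "Pr2 S \<cdot> dsum_mor \<C> R S (Ident \<C> A) (Ident \<C> C) = Pr2 R"
    unfolding e using t assms by (simp_all add: arr_simps)
  ultimately show ?thesis 
    unfolding seq_rel_iff[OF assms(1,2)] using assms(3,4) unfolding biproduct_iff[OF assms(1,2)] by blast
qed

lemma dsum_mor_In_Pr:
  assumes "A \<in> Ob \<C>" "A' \<in> Ob \<C>" "B \<in> Ob \<C>" "B' \<in> Ob \<C>"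
    "biproduct \<C> A A' S" "biproduct \<C> B B' T" "arr f A B" "arr f' A' B'"
  shows "dsum_mor \<C> S T f f' \<cdot> In1 S = In1 T \<cdot> f" "dsum_mor \<C> S T f f' \<cdot> In2 S = In2 T \<cdot> f'"
    "Pr1 T \<cdot> dsum_mor \<C> S T f f' = f \<cdot> Pr1 S" "Pr2 T \<cdot> dsum_mor \<C> S T f f' = f' \<cdot> Pr2 S"
  unfolding dsum_mor_eq(1)[OF assms]
  using biproductD[OF assms(1,2,5)] biproductD[OF assms(3,4,6)] arrD[OF assms(7)] arrD[OF assms(8)]
  by (simp_all add: arr_simps)

lemma restricted_preadditive:
  assumes "\<I> \<subseteq> Ob \<C>"
  shows "preadditive_category (\<C>\<lparr>Ob := \<I>\<rparr>)"
proof (rule preadditive_category.intro)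
  fix A B A' B' f
  assume "A \<in> Ob (\<C>\<lparr>Ob := \<I>\<rparr>)" "B \<in> Ob (\<C>\<lparr>Ob := \<I>\<rparr>)" "A' \<in> Ob (\<C>\<lparr>Ob := \<I>\<rparr>)" "B' \<in> Ob (\<C>\<lparr>Ob := \<I>\<rparr>)"
    "f \<in> mor (\<C>\<lparr>Ob := \<I>\<rparr>) A B" "f \<in> mor (\<C>\<lparr>Ob := \<I>\<rparr>) A' B'"
  then show "A = A' \<and> B = B'" using assms Hom_disjoint[of A B A' B' f] by auto
next
  fix A B C f g
  assume "A \<in> Ob (\<C>\<lparr>Ob := \<I>\<rparr>)" "B \<in> Ob (\<C>\<lparr>Ob := \<I>\<rparr>)" "C \<in> Ob (\<C>\<lparr>Ob := \<I>\<rparr>)"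
    "f \<in> mor (\<C>\<lparr>Ob := \<I>\<rparr>) A B" "g \<in> mor (\<C>\<lparr>Ob := \<I>\<rparr>) B C"
  then show "g \<cdot>\<^bsub>\<C>\<lparr>Ob := \<I>\<rparr>\<^esub> f \<in> mor (\<C>\<lparr>Ob := \<I>\<rparr>) A C"
    using assms Comp_closed[of A B C f g] by auto
next
  fix A B f
  assume "A \<in> Ob (\<C>\<lparr>Ob := \<I>\<rparr>)" "B \<in> Ob (\<C>\<lparr>Ob := \<I>\<rparr>)" "f \<in> mor (\<C>\<lparr>Ob := \<I>\<rparr>) A B"
  then show "Ident (\<C>\<lparr>Ob := \<I>\<rparr>) B \<cdot>\<^bsub>\<C>\<lparr>Ob := \<I>\<rparr>\<^esub> f = f"
    "f \<cdot>\<^bsub>\<C>\<lparr>Ob := \<I>\<rparr>\<^esub> Ident (\<C>\<lparr>Ob := \<I>\<rparr>) A = f"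
    using assms Ident_left[of A B f] Ident_right[of A B f] by auto
next
  fix A B C D f g h
  assume "A \<in> Ob (\<C>\<lparr>Ob := \<I>\<rparr>)" "B \<in> Ob (\<C>\<lparr>Ob := \<I>\<rparr>)" "C \<in> Ob (\<C>\<lparr>Ob := \<I>\<rparr>)" "D \<in> Ob (\<C>\<lparr>Ob := \<I>\<rparr>)"
    "f \<in> mor (\<C>\<lparr>Ob := \<I>\<rparr>) A B" "g \<in> mor (\<C>\<lparr>Ob := \<I>\<rparr>) B C" "h \<in> mor (\<C>\<lparr>Ob := \<I>\<rparr>) C D"
  then show "h \<cdot>\<^bsub>\<C>\<lparr>Ob := \<I>\<rparr>\<^esub> g \<cdot>\<^bsub>\<C>\<lparr>Ob := \<I>\<rparr>\<^esub> f = h \<cdot>\<^bsub>\<C>\<lparr>Ob := \<I>\<rparr>\<^esub> (g \<cdot>\<^bsub>\<C>\<lparr>Ob := \<I>\<rparr>\<^esub> f)"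
    using assms Comp_assoc[of A B C D f g h] by auto
qed (use assms in \<open>simp_all add: subset_eq Hom_group Ident_closed Comp_add_right Comp_add_left\<close>)

end

lemma (in additive_category) additive_subcategoryI:
  assumes "\<I> \<subseteq> Ob \<C>" "\<And>Z. zero_object \<C> Z \<Longrightarrow> Z \<in> \<I>"
    "\<And>A B S. \<lbrakk>A \<in> \<I>; B \<in> \<I>; biproduct \<C> A B S\<rbrakk> \<Longrightarrow> Sum S \<in> \<I>"
  shows "additive_subcategory \<C> \<I>"
proof -
  have "\<exists>Z. zero_object (\<C>\<lparr>Ob := \<I>\<rparr>) Z"
  proof -
    obtain Z where "zero_object \<C> Z" using zero_object_exists by blast
    then have "Z \<in> \<I>" "\<forall>A\<in>\<I>. (\<exists>!f. f \<in> mor \<C> A Z) \<and> (\<exists>!f. f \<in> mor \<C> Z A)"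
      using assms(1,2) unfolding zero_object_def by blast+
    then have "zero_object (\<C>\<lparr>Ob := \<I>\<rparr>) Z" by (simp add: zero_object_def)
    then show ?thesis by blast
  qed
  moreover have "\<exists>S. biproduct (\<C>\<lparr>Ob := \<I>\<rparr>) A B S" if AB: "A \<in> \<I>" "B \<in> \<I>" for A B
  proof -
    obtain S where S: "biproduct \<C> A B S" using biproduct_exists[of A B] AB assms(1) by auto
    then have "biproduct (\<C>\<lparr>Ob := \<I>\<rparr>) A B S" using assms(3)[OF AB] by (simp add: biproduct_def)
    then show ?thesis by blast
  qed
  ultimately show ?thesis
    unfolding additive_subcategory_def
    by (intro conjI assms(1) additive_category.intro restricted_preadditive additive_category_axioms.intro)
      simp_all
qed

section \<open>Extensions and triangles\<close>

context biadditive_bifunctor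
begin

section \<open>The action of morphisms on extensions\<close>

lemma Act_closed:
  assumes "is_arr c" "is_arr a" "\<delta> \<in> carrier (Ext \<E> (cd c) (dm a))" "dm c = C'" "cd a = A'"
  shows "Act \<E> c a \<delta> \<in> carrier (Ext \<E> C' A')"
  using Act_hom[of "cd c" "dm c" "dm a" "cd a" c a] assms is_arrD[of c] is_arrD[of a]
  by (auto simp: hom_def)

lemma Act_Act:
  assumes "is_arr c" "is_arr a" "is_arr c'" "is_arr a'" "cd c' = dm c" "dm a' = cd a"
    "\<delta> \<in> carrier (Ext \<E> (cd c) (dm a))"
  shows "Act \<E> c' a' (Act \<E> c a \<delta>) = Act \<E> (c \<cdot> c') (a' \<cdot> a) \<delta>"
  using Act_Comp[of "cd c" "dm c" "dm c'" "dm a" "cd a" "cd a'" c c' a a' \<delta>] assms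
    is_arrD[of c] is_arrD[of a] is_arrD[of c'] is_arrD[of a'] by simp

lemma Act_plus_left:
  assumes "is_arr c" "is_arr d" "is_arr a" "dm d = dm c" "cd d = cd c"
    "\<delta> \<in> carrier (Ext \<E> (cd c) (dm a))"
  shows "Act \<E> (c \<oplus> d) a \<delta> = Act \<E> c a \<delta> \<otimes>\<^bsub>Ext \<E> (dm c) (cd a)\<^esub> Act \<E> d a \<delta>"
  using Act_add_left[of "cd c" "dm c" "dm a" "cd a" c d a \<delta>] assms
    is_arrD[of c] is_arrD[of a] is_arrD[of d] by (simp add: plus_def)

lemma Act_plus_right:
  assumes "is_arr c" "is_arr a" "is_arr b" "dm b = dm a" "cd b = cd a"
    "\<delta> \<in> carrier (Ext \<E> (cd c) (dm a))"
  shows "Act \<E> c (a \<oplus> b) \<delta> = Act \<E> c a \<delta> \<otimes>\<^bsub>Ext \<E> (dm c) (cd a)\<^esub> Act \<E> c b \<delta>"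
  using Act_add_right[of "cd c" "dm c" "dm a" "cd a" c a b \<delta>] assms
    is_arrD[of c] is_arrD[of a] is_arrD[of b] by (simp add: plus_def)

lemma Act_one:
  assumes "is_arr c" "is_arr a" "cd c = C" "dm a = A"
  shows "Act \<E> c a \<one>\<^bsub>Ext \<E> C A\<^esub> = \<one>\<^bsub>Ext \<E> (dm c) (cd a)\<^esub>"
proof -
  interpret G: comm_group "Ext \<E> C A" using assms Ext_group is_arrD by blast
  interpret H: comm_group "Ext \<E> (dm c) (cd a)" using assms Ext_group is_arrD by blast
  show ?thesis
    using Act_hom[of "cd c" "dm c" "dm a" "cd a" c a] assms is_arrD[of c] is_arrD[of a]
    by (intro hom_one G.is_group H.is_group) auto
qed

text \<open>Since the zero morphism is its own double, biadditivity makes the value idempotent in a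
  group.\<close>

lemma Act_zr_left:
  assumes "C' \<in> Ob \<C>" "C \<in> Ob \<C>" "is_arr a" "\<delta> \<in> carrier (Ext \<E> C (dm a))"
  shows "Act \<E> (zr C' C) a \<delta> = \<one>\<^bsub>Ext \<E> C' (cd a)\<^esub>"
proof -
  interpret H: comm_group "Ext \<E> C' (cd a)" using assms Ext_group is_arrD by blast
  have "Act \<E> (zr C' C) a \<delta> \<in> carrier (Ext \<E> C' (cd a))"
    using assms by (intro Act_closed) (auto simp: arr_simps)
  then show ?thesis
    using Act_plus_left[of "zr C' C" "zr C' C" a \<delta>] assms by (simp add: arr_simps)
qed

lemma Act_zr_right:
  assumes "A' \<in> Ob \<C>" "A \<in> Ob \<C>" "is_arr c" "\<delta> \<in> carrier (Ext \<E> (cd c) A)"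
  shows "Act \<E> c (zr A A') \<delta> = \<one>\<^bsub>Ext \<E> (dm c) A'\<^esub>"
proof -
  interpret H: comm_group "Ext \<E> (dm c) A'" using assms Ext_group is_arrD by blast
  have "Act \<E> c (zr A A') \<delta> \<in> carrier (Ext \<E> (dm c) A')"
    using assms by (intro Act_closed) (auto simp: arr_simps)
  then show ?thesis
    using Act_plus_right[of c "zr A A'" "zr A A'" \<delta>] assms by (simp add: arr_simps)
qed

lemmas act_simps = arr_simps Act_closed Act_Act Act_one Act_zr_left Act_zr_right

end

text \<open>
  The axioms that suffice for the five lemma: octahedra and direct sums of triangles are not
  required.
\<close>

locale pre_extriangulated = biadditive_bifunctor \<C> \<E>
  for \<C> :: "('o, 'm, 'z) cat_scheme" (structure)
    and \<E> :: "('o, 'm, 'e) bifun" +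
  fixes s :: "('o, 'm, 'e) realz"
  assumes realization: "realization \<C> \<E> s"
    and split_realization: "\<lbrakk>A \<in> Ob \<C>; C \<in> Ob \<C>; biproduct \<C> A C S\<rbrakk>
        \<Longrightarrow> s C A \<one>\<^bsub>Ext \<E> C A\<^esub> = seq_class \<C> A C (In1 S) (Sum S) (Pr2 S)"
    and complete_right: "\<lbrakk>E_triangle \<C> \<E> s A x B y C \<delta>; E_triangle \<C> \<E> s A' x' B' y' C' \<delta>';
        a \<in> mor \<C> A A'; b \<in> mor \<C> B B'; b \<cdot> x = x' \<cdot> a\<rbrakk>
        \<Longrightarrow> \<exists>c. ext_morphism \<C> \<E> C A \<delta> C' A' \<delta>' a c \<and> y' \<cdot> b = c \<cdot> y"
    and complete_left: "\<lbrakk>E_triangle \<C> \<E> s A x B y C \<delta>; E_triangle \<C> \<E> s A' x' B' y' C' \<delta>';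
        b \<in> mor \<C> B B'; c \<in> mor \<C> C C'; y' \<cdot> b = c \<cdot> y\<rbrakk>
        \<Longrightarrow> \<exists>a. ext_morphism \<C> \<E> C A \<delta> C' A' \<delta>' a c \<and> b \<cdot> x = x' \<cdot> a"
begin

section \<open>Triangles, exactness and the five lemma\<close>

abbreviation tri :: "'o \<Rightarrow> 'm \<Rightarrow> 'o \<Rightarrow> 'm \<Rightarrow> 'o \<Rightarrow> 'e \<Rightarrow> bool" where
  "tri \<equiv> E_triangle \<C> \<E> s"

lemma realized_quotient:
  assumes "A \<in> Ob \<C>" "C \<in> Ob \<C>" "\<delta> \<in> carrier (Ext \<E> C A)"
  shows "s C A \<delta> \<in> seqs \<C> A C // seq_rel \<C> A C"
  using realization assms by (auto simp: realization_def)

lemma tri_arr: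
  assumes "tri A x B y C \<delta>"
  shows "arr x A B" "arr y B C"
proof -
  have t: "A \<in> Ob \<C>" "C \<in> Ob \<C>" "\<delta> \<in> carrier (Ext \<E> C A)" "(x, B, y) \<in> s C A \<delta>"
    using assms by (auto simp: E_triangle_def)
  have "s C A \<delta> \<subseteq> seqs \<C> A C"
    using realized_quotient[OF t(1-3)] equiv_seq_rel[OF t(1,2)] by (rule in_quotient_imp_subset[rotated])
  then show "arr x A B" "arr y B C" using t seqs_iff by blast+
qed

lemma triD:
  assumes "tri A x B y C \<delta>"
  shows "is_arr x" "dm x = A" "cd x = B" "is_arr y" "dm y = B" "cd y = C"
    "\<delta> \<in> carrier (Ext \<E> C A)" "A \<in> Ob \<C>" "B \<in> Ob \<C>" "C \<in> Ob \<C>"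
  using arrD[OF tri_arr(1)[OF assms]] arrD[OF tri_arr(2)[OF assms]] assms
  by (auto simp: E_triangle_def)

lemma tri_class:
  assumes "tri A x B y C \<delta>"
  shows "s C A \<delta> = seq_class \<C> A C x B y"
proof -
  have t: "A \<in> Ob \<C>" "C \<in> Ob \<C>" "\<delta> \<in> carrier (Ext \<E> C A)" "(x, B, y) \<in> s C A \<delta>"
    using assms by (auto simp: E_triangle_def)
  obtain z where z: "s C A \<delta> = seq_rel \<C> A C `` {z}"
    using realized_quotient[OF t(1-3)] by (rule quotientE)
  then show ?thesis
    using equiv_class_eq[OF equiv_seq_rel[OF t(1,2)], of z "(x, B, y)"] t(4)
    by (simp add: seq_class_def)
qed

lemma tri_iff:
  assumes "tri A x B y C \<delta>"
  shows "tri A x' B' y' C \<delta> \<longleftrightarrow> ((x, B, y), (x', B', y')) \<in> seq_rel \<C> A C"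
  using tri_class[OF assms] triD[OF assms] by (auto simp: E_triangle_def seq_class_def)

lemma tri_exists:
  assumes "A \<in> Ob \<C>" "C \<in> Ob \<C>" "\<delta> \<in> carrier (Ext \<E> C A)"
  obtains x B y where "tri A x B y C \<delta>"
proof -
  have "s C A \<delta> \<noteq> {}"
    using realized_quotient[OF assms] equiv_seq_rel[OF assms(1,2)] in_quotient_imp_non_empty by blast
  then show ?thesis using that assms by (auto simp: E_triangle_def)
qed

lemma tri_split:
  assumes "A \<in> Ob \<C>" "C \<in> Ob \<C>" "biproduct \<C> A C S"
  shows "tri A (In1 S) (Sum S) (Pr2 S) C \<one>\<^bsub>Ext \<E> C A\<^esub>"
proof -
  interpret comm_group "Ext \<E> C A" using Ext_group assms by blast
  have "(In1 S, Sum S, Pr2 S) \<in> seqs \<C> A C"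
    using seqs_iff assms biproduct_iff by simp
  then show ?thesis
    using assms split_realization[OF assms] equiv_class_self[OF equiv_seq_rel[OF assms(1,2)]]
    by (auto simp: E_triangle_def seq_class_def)
qed

lemma realize_morphism:
  assumes "tri A x B y C \<delta>" "tri A' x' B' y' C' \<delta>'" "arr a A A'" "arr c C C'"
    "Act \<E> (Ident \<C> C) a \<delta> = Act \<E> c (Ident \<C> A') \<delta>'"
  obtains b where "arr b B B'" "b \<cdot> x = x' \<cdot> a" "y' \<cdot> b = c \<cdot> y"
proof -
  have "ext_morphism \<C> \<E> C A \<delta> C' A' \<delta>' a c"
    using assms(3-5) by (auto simp: ext_morphism_def push_def pull_def arr_def)
  then have "\<exists>b\<in>mor \<C> B B'. b \<cdot> x = x' \<cdot> a \<and> y' \<cdot> b = c \<cdot> y"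
    using assms(1,2) realization unfolding realization_def by blast
  then show ?thesis using that triD[OF assms(1)] triD[OF assms(2)] by (auto simp: arr_def)
qed

lemma complete_right_arr:
  assumes "tri A x B y C \<delta>" "tri A' x' B' y' C' \<delta>'" "arr a A A'" "arr b B B'" "b \<cdot> x = x' \<cdot> a"
  obtains c where "arr c C C'" "Act \<E> (Ident \<C> C) a \<delta> = Act \<E> c (Ident \<C> A') \<delta>'" "y' \<cdot> b = c \<cdot> y"
proof -
  have "\<exists>c. ext_morphism \<C> \<E> C A \<delta> C' A' \<delta>' a c \<and> y' \<cdot> b = c \<cdot> y"
    using complete_right[OF assms(1,2)] assms(3-5) by (auto simp: arr_def)
  then show ?thesis using that triD[OF assms(1)] triD[OF assms(2)]
    by (auto simp: ext_morphism_def push_def pull_def arr_def)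
qed

lemma complete_left_arr:
  assumes "tri A x B y C \<delta>" "tri A' x' B' y' C' \<delta>'" "arr b B B'" "arr c C C'" "y' \<cdot> b = c \<cdot> y"
  obtains a where "arr a A A'" "Act \<E> (Ident \<C> C) a \<delta> = Act \<E> c (Ident \<C> A') \<delta>'" "b \<cdot> x = x' \<cdot> a"
proof -
  have "\<exists>a. ext_morphism \<C> \<E> C A \<delta> C' A' \<delta>' a c \<and> b \<cdot> x = x' \<cdot> a"
    using complete_left[OF assms(1,2)] assms(3-5) by (auto simp: arr_def)
  then show ?thesis using that triD[OF assms(1)] triD[OF assms(2)]
    by (auto simp: ext_morphism_def push_def pull_def arr_def)
qed

text \<open>Compare the split triangle \<open>A \<rightarrow> A \<oplus> B \<rightarrow> B\<close> with the given one along \<open>(x, 1)\<close>.\<close>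

lemma pull_deflation:
  assumes "tri A x B y C \<delta>"
  shows "Act \<E> y (Ident \<C> A) \<delta> = \<one>\<^bsub>Ext \<E> B A\<^esub>"
proof -
  note t = triD[OF assms]
  obtain S where S: "biproduct \<C> A B S" using biproduct_exists t by blast
  note S' = biproductD[OF t(8,9) S]
  let ?b = "x \<cdot> Pr1 S \<oplus> Pr2 S"
  have "arr ?b (Sum S) B" "arr (Ident \<C> A) A A" "?b \<cdot> In1 S = x \<cdot> Ident \<C> A"
    using t S' by (simp_all add: arr_iff arr_simps)
  then obtain c where c: "arr c B C"
    "Act \<E> (Ident \<C> B) (Ident \<C> A) \<one>\<^bsub>Ext \<E> B A\<^esub> = Act \<E> c (Ident \<C> A) \<delta>" "y \<cdot> ?b = c \<cdot> Pr2 S"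
    using complete_right_arr[OF tri_split[OF t(8,9) S] assms] by blast
  note c' = arrD[OF c(1)]
  \<comment> \<open>The axiom only provides some \<open>c\<close>. Restricting the right-hand square
    to the second summand identifies it with \<open>y\<close>, so the equation of extensions for
    \<open>c\<close> becomes the claim.\<close>
  have "c = (c \<cdot> Pr2 S) \<cdot> In2 S" using c' S' by (simp add: arr_simps)
  also have "\<dots> = y" unfolding c(3)[symmetric] using t S' by (simp add: arr_simps)
  finally show ?thesis using c t by (simp add: act_simps)
qed

text \<open>Dual comparison: the given triangle is mapped to the split triangle
  \<open>B \<rightarrow> B \<oplus> C \<rightarrow> C\<close> by the column with entries
  \<open>1\<close> and \<open>y\<close>. The completing morphism on the left is then forced to be
  \<open>x\<close>.\<close>

lemma push_inflation:
  assumes "tri A x B y C \<delta>"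
  shows "Act \<E> (Ident \<C> C) x \<delta> = \<one>\<^bsub>Ext \<E> C B\<^esub>"
proof -
  note t = triD[OF assms]
  obtain S where S: "biproduct \<C> B C S" using biproduct_exists t by blast
  note S' = biproductD[OF t(9,10) S]
  let ?b = "In1 S \<oplus> In2 S \<cdot> y"
  have "arr ?b B (Sum S)" "arr (Ident \<C> C) C C" "Pr2 S \<cdot> ?b = Ident \<C> C \<cdot> y"
    using t S' by (simp_all add: arr_iff arr_simps)
  then obtain a where a: "arr a A B"
    "Act \<E> (Ident \<C> C) a \<delta> = Act \<E> (Ident \<C> C) (Ident \<C> B) \<one>\<^bsub>Ext \<E> C B\<^esub>" "?b \<cdot> x = In1 S \<cdot> a"
    using complete_left_arr[OF assms tri_split[OF t(9,10) S]] by blast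
  note a' = arrD[OF a(1)]
  have "a = Pr1 S \<cdot> (In1 S \<cdot> a)" using a' S' by (simp add: arr_simps)
  also have "\<dots> = x" unfolding a(3)[symmetric] using t S' by (simp add: arr_simps)
  finally show ?thesis using a t by (simp add: act_simps)
qed

text \<open>The morphism \<open>f\<close> and the zero morphism from \<open>Z\<close> to
  \<open>C\<close> form the right-hand square of a morphism from the split triangle
  \<open>W = W \<rightarrow> Z\<close> to the given one. The dual of (ET3) supplies its left end,
  which is \<open>g\<close>. There is no uniqueness: \<open>x\<close> is only a weak kernel of
  \<open>y\<close>.\<close>

lemma factor_inflation:
  assumes "tri A x B y C \<delta>" "arr f W B" "y \<cdot> f = zr W C"
  obtains g where "arr g W A" "f = x \<cdot> g"
proof -
  note t = triD[OF assms(1)] arrD[OF assms(2)]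
  obtain Z where Z: "zero_object \<C> Z" using zero_object_exists by blast
  then have ZO: "Z \<in> Ob \<C>" by (simp add: zero_object_def)
  have "arr (zr Z C) Z C" "y \<cdot> f = zr Z C \<cdot> zr W Z"
    using t ZO assms(3) by (simp_all add: arr_iff arr_simps)
  then obtain g where g: "arr g W A" "f \<cdot> Ident \<C> W = x \<cdot> g"
    using complete_left_arr[OF tri_split[OF t(14) ZO biproduct_zero(1)[OF t(14) Z]] assms(1) , of f "zr Z C"]
      assms(2) by auto
  then show ?thesis using that t by (simp add: arr_simps)
qed

text \<open>Dual argument with the split triangle \<open>Z \<rightarrow> W = W\<close> as target;
  \<open>g\<close> is the right end supplied by (ET3).\<close>

lemma factor_deflation:
  assumes "tri A x B y C \<delta>" "arr f B W" "f \<cdot> x = zr A W"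
  obtains g where "arr g C W" "f = g \<cdot> y"
proof -
  note t = triD[OF assms(1)] arrD[OF assms(2)]
  obtain Z where Z: "zero_object \<C> Z" using zero_object_exists by blast
  then have ZO: "Z \<in> Ob \<C>" by (simp add: zero_object_def)
  have "arr (zr A Z) A Z" "f \<cdot> x = zr Z W \<cdot> zr A Z"
    using t ZO assms(3) by (simp_all add: arr_iff arr_simps)
  then obtain g where g: "arr g C W" "Ident \<C> W \<cdot> f = g \<cdot> y"
    using complete_right_arr[OF assms(1) tri_split[OF ZO t(15) biproduct_zero(2)[OF t(15) Z]], of "zr A Z" f]
      assms(2) by auto
  then show ?thesis using that t by (simp add: arr_simps)
qed

text \<open>The morphisms \<open>1\<close> and \<open>x\<close> start a morphism from the split
  triangle \<open>A = A \<rightarrow> Z\<close> to the given one, so the composite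
  \<open>y x\<close> passes through the zero object \<open>Z\<close>.\<close>

lemma tri_comp_zr:
  assumes "tri A x B y C \<delta>"
  shows "y \<cdot> x = zr A C"
proof -
  note t = triD[OF assms]
  obtain Z where Z: "zero_object \<C> Z" using zero_object_exists by blast
  then have ZO: "Z \<in> Ob \<C>" by (simp add: zero_object_def)
  have "arr (Ident \<C> A) A A" "x \<cdot> Ident \<C> A = x \<cdot> Ident \<C> A"
    using t by (simp_all add: arr_iff arr_simps)
  then obtain c where c: "arr c Z C" "y \<cdot> x = c \<cdot> zr A Z"
    using complete_right_arr[OF tri_split[OF t(8) ZO biproduct_zero(1)[OF t(8) Z]] assms, of "Ident \<C> A" x]
      tri_arr[OF assms] by auto
  then show ?thesis using arrD[OF c(1)] t by (simp add: arr_simps)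
qed

text \<open>
  If \<open>b x = x\<close> and \<open>y b = y\<close>, then \<open>\<beta> = b - 1\<close> is both of the form \<open>x \<gamma>\<close> and of the form
  \<open>\<kappa> y\<close>, so \<open>\<beta>\<^sup>2 = \<kappa> y x \<gamma> = 0\<close> and \<open>1 - \<beta>\<close> is inverse to \<open>b\<close>.
\<close>

lemma unipotent_inverse:
  assumes "tri A x B y C \<delta>" "arr b B B" "b \<cdot> x = x" "y \<cdot> b = y"
  obtains b' where "inverses B B b b'"
proof -
  note t = triD[OF assms(1)] arrD[OF assms(2)]
  let ?i = "Ident \<C> B"
  let ?\<beta> = "b \<oplus> neg ?i"
  have \<beta>: "arr ?\<beta> B B" using t by (simp add: arr_iff arr_simps)
  note \<beta>' = arrD[OF \<beta>]
  have b: "b = ?i \<oplus> ?\<beta>" using t plus_neg_cancel[of ?i b] by (simp add: arr_simps)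
  have "y \<cdot> ?\<beta> = (y \<cdot> ?i) \<oplus> (y \<cdot> neg ?i)"
    using t assms(4) by (simp add: arr_simps)
  also have "\<dots> = y \<cdot> (?i \<oplus> neg ?i)" using t by (intro comp_plus_right[symmetric]) (auto simp: is_arr_neg is_arr_Ident)
  also have "\<dots> = zr B C" using t by (simp add: plus_neg is_arr_Ident comp_zr_right)
  finally obtain \<gamma> where \<gamma>: "arr \<gamma> B A" "?\<beta> = x \<cdot> \<gamma>" using factor_inflation[OF assms(1) \<beta>] by blast
  have "?\<beta> \<cdot> x = (?i \<cdot> x) \<oplus> (neg ?i \<cdot> x)"
    using t assms(3) by (simp add: arr_simps)
  also have "\<dots> = (?i \<oplus> neg ?i) \<cdot> x" using t by (intro comp_plus_left[symmetric]) (auto simp: is_arr_neg is_arr_Ident)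
  also have "\<dots> = zr A B" using t by (simp add: plus_neg is_arr_Ident comp_zr_left)
  finally obtain \<kappa> where \<kappa>: "arr \<kappa> C B" "?\<beta> = \<kappa> \<cdot> y" using factor_deflation[OF assms(1) \<beta>] by blast
  note a = arrD[OF \<gamma>(1)] arrD[OF \<kappa>(1)]
  have sq: "?\<beta> \<cdot> ?\<beta> = zr B B"
  proof -
    have "?\<beta> \<cdot> ?\<beta> = (\<kappa> \<cdot> y) \<cdot> (x \<cdot> \<gamma>)" using \<gamma>(2) \<kappa>(2) by simp
    also have "\<dots> = zr B B" using t a
      by (simp add: comp_reassoc[OF tri_comp_zr[OF assms(1)]] is_arr_comp comp_assoc comp_zr_right comp_zr_left)
    finally show ?thesis .
  qed
  \<comment> \<open>The claim is made for a variable \<open>\<beta>\<close>, since the sum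
    \<open>b \<oplus> neg 1\<close> would be expanded by distributivity and the relation on its
    square could no longer be applied.\<close>
  have gen: "\<exists>b'. inverses B B b b'"
    if "arr \<beta> B B" "\<beta> \<cdot> \<beta> = zr B B" "b = ?i \<oplus> \<beta>" for \<beta>
  proof -
    note s = arrD[OF that(1)]
    have n: "\<beta> \<cdot> neg \<beta> = zr B B" "neg \<beta> \<cdot> \<beta> = zr B B"
    proof -
      have "\<beta> \<cdot> neg \<beta> = \<beta> \<cdot> (\<beta> \<oplus> neg \<beta>)"
        using s that(2) by (simp add: comp_plus_right is_arr_neg plus_zr is_arr_comp)
      then show "\<beta> \<cdot> neg \<beta> = zr B B" using s by (simp add: plus_neg comp_zr_right)
      have "neg \<beta> \<cdot> \<beta> = (\<beta> \<oplus> neg \<beta>) \<cdot> \<beta>"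
        using s that(2) by (simp add: comp_plus_left is_arr_neg plus_zr is_arr_comp)
      then show "neg \<beta> \<cdot> \<beta> = zr B B" using s by (simp add: plus_neg comp_zr_left)
    qed
    have "(?i \<oplus> \<beta>) \<cdot> (?i \<oplus> neg \<beta>) = ?i \<oplus> (\<beta> \<oplus> neg \<beta>)" "(?i \<oplus> neg \<beta>) \<cdot> (?i \<oplus> \<beta>) = ?i \<oplus> (neg \<beta> \<oplus> \<beta>)"
      using s n by (simp_all add: arr_simps plus_assoc plus_comm plus_left_comm)
    then have "inverses B B b (?i \<oplus> neg \<beta>)"
      using s unfolding that(3) inverses_def arr_iff by (simp add: arr_simps plus_neg)
    then show ?thesis by blast
  qed
  show ?thesis using gen[OF \<beta> sq b] that by blast
qed

text \<open>The inverses \<open>a'\<close> and \<open>c'\<close> form a morphism of extensions in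
  the opposite direction. A realization \<open>d\<close> of it need not be inverse to
  \<open>b\<close>, but \<open>d b\<close> and \<open>b d\<close> are compatible with identities on
  the ends, hence invertible by \<open>unipotent_inverse\<close>. So \<open>b\<close> has a left
  inverse and a right inverse.\<close>

lemma five_lemma:
  assumes "tri A x B y C \<delta>" "tri A' x' B' y' C' \<delta>'" "inverses A A' a a'" "inverses C C' c c'"
    "Act \<E> (Ident \<C> C) a \<delta> = Act \<E> c (Ident \<C> A') \<delta>'"
    "arr b B B'" "b \<cdot> x = x' \<cdot> a" "y' \<cdot> b = c \<cdot> y"
  obtains b' where "inverses B B' b b'"
proof -
  note t = triD[OF assms(1)] and t' = triD[OF assms(2)]
    and ab = arrD[OF assms(6)] inversesD[OF assms(3)] inversesD[OF assms(4)]
  \<comment> \<open>Applying \<open>Act \<E> c' a'\<close> to both sides of the compatibility of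
    \<open>a\<close> and \<open>c\<close> gives the compatibility of \<open>a'\<close> and
    \<open>c'\<close>.\<close>
  have "Act \<E> c' a' (Act \<E> (Ident \<C> C) a \<delta>) = Act \<E> c' (Ident \<C> A) \<delta>"
    using t ab by (simp add: act_simps)
  moreover have "Act \<E> c' a' (Act \<E> c (Ident \<C> A') \<delta>') = Act \<E> (Ident \<C> C') a' \<delta>'"
    using t' ab by (simp add: act_simps)
  ultimately have "Act \<E> (Ident \<C> C') a' \<delta>' = Act \<E> c' (Ident \<C> A) \<delta>"
    using assms(5) by simp
  then obtain d where d: "arr d B' B" "d \<cdot> x' = x \<cdot> a'" "y \<cdot> d = c' \<cdot> y'"
    using realize_morphism[OF assms(2,1)] assms(3,4) by (auto simp: inverses_def)
  note d' = arrD[OF d(1)]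
  have "arr (d \<cdot> b) B B" "(d \<cdot> b) \<cdot> x = x" "y \<cdot> (d \<cdot> b) = y"
    using t t' ab d' assms(7,8) comp_reassoc[OF d(2)] comp_reassoc[OF d(3)]
    by (simp_all add: arr_iff arr_simps)
  then obtain l where l: "inverses B B (d \<cdot> b) l" using unipotent_inverse[OF assms(1)] by blast
  have "arr (b \<cdot> d) B' B'" "(b \<cdot> d) \<cdot> x' = x'" "y' \<cdot> (b \<cdot> d) = y'"
    using t t' ab d' d(2,3) comp_reassoc[OF assms(7)] comp_reassoc[OF assms(8)]
    by (simp_all add: arr_iff arr_simps)
  then obtain r where r: "inverses B' B' (b \<cdot> d) r" using unipotent_inverse[OF assms(2)] by blast
  note lr = inversesD[OF l] inversesD[OF r]
  have "inverses B B' b (l \<cdot> d)"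
  proof (rule inverses_left_right)
    show "arr (l \<cdot> d) B' B" "arr (d \<cdot> r) B' B"
      using lr(1-6) lr(13-18) ab d' by (simp_all add: arr_iff is_arr_comp)
    show "(l \<cdot> d) \<cdot> b = Ident \<C> B" "b \<cdot> (d \<cdot> r) = Ident \<C> B'"
      using lr ab d' by (auto simp: comp_assoc)
  qed (rule assms(6))
  then show ?thesis using that by blast
qed

text \<open>Take any sequence realizing the moved extension. The pair \<open>(a, c)\<close> is a
  morphism to this extension, and the five lemma makes a realization of it invertible in the middle.
  This isomorphism shows that the given sequence, with its ends changed, is equivalent to the chosen
  one.\<close>

lemma tri_iso_ends:
  assumes "tri A x B y C \<delta>" "inverses A A' a a'" "inverses C C' c c'"
  shows "tri A' (x \<cdot> a') B (c \<cdot> y) C' (Act \<E> c' a \<delta>)"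
proof -
  note t = triD[OF assms(1)] inversesD[OF assms(2)] inversesD[OF assms(3)]
  let ?\<delta> = "Act \<E> c' a \<delta>"
  have \<delta>: "?\<delta> \<in> carrier (Ext \<E> C' A')" using t by (simp add: act_simps)
  then obtain x' B' y' where T: "tri A' x' B' y' C' ?\<delta>" using tri_exists t by blast
  have e: "Act \<E> (Ident \<C> C) a \<delta> = Act \<E> c (Ident \<C> A') ?\<delta>" using t by (simp add: act_simps)
  obtain b where b: "arr b B B'" "b \<cdot> x = x' \<cdot> a" "y' \<cdot> b = c \<cdot> y"
    using realize_morphism[OF assms(1) T _ _ e] assms(2,3) by (auto simp: inverses_def)
  then obtain b' where b': "inverses B B' b b'" using five_lemma[OF assms(1) T assms(2,3) e] by blast
  note u = inversesD[OF b'] triD[OF T]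
  have "((x \<cdot> a', B, c \<cdot> y), (x', B', y')) \<in> seq_rel \<C> A' C'"
    unfolding seq_rel_iff[OF t(18) t(30)]
  proof (intro conjI exI)
    show "inverses B B' b b'" by fact
    show "b \<cdot> (x \<cdot> a') = x'" using t u comp_reassoc[OF b(2)] by (simp add: arr_simps)
    show "y' \<cdot> b = c \<cdot> y" by fact
  qed (use t u in \<open>simp_all add: arr_iff arr_simps\<close>)
  then have "((x', B', y'), (x \<cdot> a', B, c \<cdot> y)) \<in> seq_rel \<C> A' C'"
    using equiv_seq_rel[OF t(18) t(30)] by (meson equiv_def symD)
  then show ?thesis using tri_iff[OF T] by simp
qed

lemma tri_iso_middle:
  assumes "tri A x B y C \<delta>" "inverses B B' b b'"
  shows "tri A (b \<cdot> x) B' (y \<cdot> b') C \<delta>"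
proof -
  note t = triD[OF assms(1)] inversesD[OF assms(2)]
  have "arr (b \<cdot> x) A B'" "arr (y \<cdot> b') B' C" "(y \<cdot> b') \<cdot> b = y"
    using t by (simp_all add: arr_iff arr_simps)
  then have "((x, B, y), (b \<cdot> x, B', y \<cdot> b')) \<in> seq_rel \<C> A C"
    unfolding seq_rel_iff[OF t(8,10)] using assms(2) tri_arr[OF assms(1)] by blast
  then show ?thesis using tri_iff[OF assms(1)] by simp
qed

section \<open>The projective-injective objects form an additive subcategory\<close>

lemma zero_object_Proj_Inj:
  assumes "zero_object \<C> Z"
  shows "Z \<in> Proj \<C> \<E> s \<inter> Inj \<C> \<E> s"
proof -
  have Z: "Z \<in> Ob \<C>" using assms by (simp add: zero_object_def)
  have u: "f = g" if "arr f Z A \<and> arr g Z A \<or> arr f A Z \<and> arr g A Z" for f g A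
    using that assms by (auto simp: zero_object_def arr_def)
  have "\<exists>b\<in>mor \<C> Z B. y \<cdot> b = c" if "deflation \<C> \<E> s B C y" "c \<in> mor \<C> Z C" for B C y c
  proof -
    obtain A x \<delta> where T: "tri A x B y C \<delta>" using \<open>deflation \<C> \<E> s B C y\<close> by (auto simp: deflation_def)
    note t = triD[OF T]
    have "arr (zr Z B) Z B" "arr (y \<cdot> zr Z B) Z C" using t Z by (simp_all add: arr_iff is_arr_comp is_arr_zr)
    moreover have "arr c Z C" using that(2) t Z by (simp add: arr_def)
    ultimately show ?thesis using u[of "y \<cdot> zr Z B" C c] arrD(6)[of "zr Z B" Z B] by blast
  qed
  moreover have "\<exists>b\<in>mor \<C> B Z. b \<cdot> x = a" if "inflation \<C> \<E> s A B x" "a \<in> mor \<C> A Z" for A B x a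
  proof -
    obtain C y \<delta> where T: "tri A x B y C \<delta>" using \<open>inflation \<C> \<E> s A B x\<close> by (auto simp: inflation_def)
    note t = triD[OF T]
    have "arr (zr B Z) B Z" "arr (zr B Z \<cdot> x) A Z" using t Z by (simp_all add: arr_iff is_arr_comp is_arr_zr)
    moreover have "arr a A Z" using that(2) t Z by (simp add: arr_def)
    ultimately show ?thesis using u[of "zr B Z \<cdot> x" A a] arrD(6)[of "zr B Z" B Z] by blast
  qed
  ultimately show ?thesis using Z by (simp add: Proj_def Inj_def)
qed

lemma biproduct_Proj:
  assumes "P \<in> Proj \<C> \<E> s" "P' \<in> Proj \<C> \<E> s" "biproduct \<C> P P' S"
  shows "Sum S \<in> Proj \<C> \<E> s"
proof -
  have P: "P \<in> Ob \<C>" "P' \<in> Ob \<C>" using assms by (auto simp: Proj_def)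
  note t = biproductD[OF P assms(3)]
  have "\<exists>b\<in>mor \<C> (Sum S) B. y \<cdot> b = c" if d: "deflation \<C> \<E> s B C y" and c: "c \<in> mor \<C> (Sum S) C" for B C y c
  proof -
    obtain A x \<delta> where T: "tri A x B y C \<delta>" using d by (auto simp: deflation_def)
    have "arr c (Sum S) C" using c t triD[OF T] by (simp add: arr_def)
    note t = t triD[OF T] arrD[OF this]
    have "arr (c \<cdot> In1 S) P C" "arr (c \<cdot> In2 S) P' C" using t by (simp_all add: arr_iff is_arr_comp)
    then have "c \<cdot> In1 S \<in> mor \<C> P C" "c \<cdot> In2 S \<in> mor \<C> P' C" by (auto dest: arrD)
    then obtain b b' where "b \<in> mor \<C> P B" "y \<cdot> b = c \<cdot> In1 S" "b' \<in> mor \<C> P' B" "y \<cdot> b' = c \<cdot> In2 S"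
      using assms(1,2) d unfolding Proj_def by blast
    then have b: "arr b P B" "arr b' P' B" "y \<cdot> b = c \<cdot> In1 S" "y \<cdot> b' = c \<cdot> In2 S"
      using P t by (simp_all add: arr_def)
    note u = arrD[OF b(1)] arrD[OF b(2)]
    have "y \<cdot> (b \<cdot> Pr1 S \<oplus> b' \<cdot> Pr2 S) = c \<cdot> (In1 S \<cdot> Pr1 S) \<oplus> c \<cdot> (In2 S \<cdot> Pr2 S)"
      using t u by (simp add: arr_simps comp_reassoc[OF b(3)] comp_reassoc[OF b(4)])
    also have "\<dots> = c \<cdot> (In1 S \<cdot> Pr1 S \<oplus> In2 S \<cdot> Pr2 S)"
      using t by (intro comp_plus_right[symmetric]) (simp_all add: is_arr_comp)
    also have "\<dots> = c" using t by (simp add: comp_Ident_right)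
    finally have "y \<cdot> (b \<cdot> Pr1 S \<oplus> b' \<cdot> Pr2 S) = c" .
    moreover have "arr (b \<cdot> Pr1 S \<oplus> b' \<cdot> Pr2 S) (Sum S) B" using t u by (simp add: arr_iff arr_simps)
    ultimately show ?thesis using arrD(6) by blast
  qed
  then show ?thesis using t by (simp add: Proj_def)
qed

lemma biproduct_Inj:
  assumes "I \<in> Inj \<C> \<E> s" "I' \<in> Inj \<C> \<E> s" "biproduct \<C> I I' S"
  shows "Sum S \<in> Inj \<C> \<E> s"
proof -
  have I: "I \<in> Ob \<C>" "I' \<in> Ob \<C>" using assms by (auto simp: Inj_def)
  note t = biproductD[OF I assms(3)]
  have "\<exists>b\<in>mor \<C> B (Sum S). b \<cdot> x = a" if d: "inflation \<C> \<E> s A B x" and a: "a \<in> mor \<C> A (Sum S)" for A B x a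
  proof -
    obtain C y \<delta> where T: "tri A x B y C \<delta>" using d by (auto simp: inflation_def)
    have "arr a A (Sum S)" using a t triD[OF T] by (simp add: arr_def)
    note t = t triD[OF T] arrD[OF this]
    have "arr (Pr1 S \<cdot> a) A I" "arr (Pr2 S \<cdot> a) A I'" using t by (simp_all add: arr_iff is_arr_comp)
    then have "Pr1 S \<cdot> a \<in> mor \<C> A I" "Pr2 S \<cdot> a \<in> mor \<C> A I'" by (auto dest: arrD)
    then obtain b b' where "b \<in> mor \<C> B I" "b \<cdot> x = Pr1 S \<cdot> a" "b' \<in> mor \<C> B I'" "b' \<cdot> x = Pr2 S \<cdot> a"
      using assms(1,2) d unfolding Inj_def by blast
    then have b: "arr b B I" "arr b' B I'" "b \<cdot> x = Pr1 S \<cdot> a" "b' \<cdot> x = Pr2 S \<cdot> a"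
      using I t by (simp_all add: arr_def)
    note u = arrD[OF b(1)] arrD[OF b(2)]
    have "(In1 S \<cdot> b \<oplus> In2 S \<cdot> b') \<cdot> x = (In1 S \<cdot> Pr1 S) \<cdot> a \<oplus> (In2 S \<cdot> Pr2 S) \<cdot> a"
      using t u by (simp add: arr_simps b(3,4))
    also have "\<dots> = (In1 S \<cdot> Pr1 S \<oplus> In2 S \<cdot> Pr2 S) \<cdot> a"
      using t by (intro comp_plus_left[symmetric]) (simp_all add: is_arr_comp)
    also have "\<dots> = a" using t by (simp add: comp_Ident_left)
    finally have "(In1 S \<cdot> b \<oplus> In2 S \<cdot> b') \<cdot> x = a" .
    moreover have "arr (In1 S \<cdot> b \<oplus> In2 S \<cdot> b') B (Sum S)" using t u by (simp add: arr_iff arr_simps)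
    ultimately show ?thesis using arrD(6) by blast
  qed
  then show ?thesis using t by (simp add: Inj_def)
qed

lemma additive_subcategory_Proj_Inj: "additive_subcategory \<C> (Proj \<C> \<E> s \<inter> Inj \<C> \<E> s)"
proof (rule additive_subcategoryI)
  show "Proj \<C> \<E> s \<inter> Inj \<C> \<E> s \<subseteq> Ob \<C>" by (auto simp: Proj_def)
qed (use zero_object_Proj_Inj biproduct_Proj biproduct_Inj in blast)+

end

sublocale extriangulated_category \<subseteq> pre_extriangulated \<C> \<E> s
proof -
  interpret biadditive_bifunctor \<C> \<E> by (rule ET1)
  show "pre_extriangulated \<C> \<E> s"
  proof
    show "realization \<C> \<E> s" using ET2 by (simp add: additive_realization_def)
    show "s C A \<one>\<^bsub>Ext \<E> C A\<^esub> = seq_class \<C> A C (In1 S) (Sum S) (Pr2 S)"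
      if "A \<in> Ob \<C>" "C \<in> Ob \<C>" "biproduct \<C> A C S" for A C S
      using ET2 that by (simp add: additive_realization_def)
  qed (fact ET3 ET3_op)+
qed

section \<open>Ideal quotients\<close>

text \<open>The image of a biproduct under a functor that fixes objects, as the passage to an ideal
  quotient does.\<close>

definition map_biprod :: "('m \<Rightarrow> 'n) \<Rightarrow> ('o, 'm) biprod \<Rightarrow> ('o, 'n) biprod" where
  "map_biprod q S = \<lparr>Sum = Sum S, In1 = q (In1 S), In2 = q (In2 S), Pr1 = q (Pr1 S), Pr2 = q (Pr2 S)\<rparr>"

lemma map_biprod_simps [simp]:
  "Sum (map_biprod q S) = Sum S" "In1 (map_biprod q S) = q (In1 S)" "In2 (map_biprod q S) = q (In2 S)"
  "Pr1 (map_biprod q S) = q (Pr1 S)" "Pr2 (map_biprod q S) = q (Pr2 S)"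
  by (simp_all add: map_biprod_def)

locale ideal_quotient = additive_category \<C>
  for \<C> :: "('o, 'm, 'z) cat_scheme" (structure) +
  fixes \<I> :: "'o set"
  assumes subcategory: "additive_subcategory \<C> \<I>"
begin

section \<open>The ideal of morphisms factoring through the subcategory\<close>

lemma ideal_Ob: "N \<in> \<I> \<Longrightarrow> N \<in> Ob \<C>"
  using subcategory by (auto simp: additive_subcategory_def)

lemma ideal_nonempty: obtains N where "N \<in> \<I>"
proof -
  interpret S: additive_category "\<C>\<lparr>Ob := \<I>\<rparr>"
    using subcategory by (simp add: additive_subcategory_def)
  show ?thesis using S.zero_object_exists that by (auto simp: zero_object_def)
qed

lemma ideal_biproduct:
  assumes "N \<in> \<I>" "N' \<in> \<I>"
  obtains S where "biproduct \<C> N N' S" "Sum S \<in> \<I>"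
proof -
  interpret S: additive_category "\<C>\<lparr>Ob := \<I>\<rparr>"
    using subcategory by (simp add: additive_subcategory_def)
  obtain S where "biproduct (\<C>\<lparr>Ob := \<I>\<rparr>) N N' S" using S.biproduct_exists assms by auto
  then have "biproduct \<C> N N' S" "Sum S \<in> \<I>" using ideal_Ob by (auto simp: biproduct_def)
  then show ?thesis using that by blast
qed

lemma factoring_iff:
  assumes "A \<in> Ob \<C>" "B \<in> Ob \<C>"
  shows "f \<in> factoring \<C> \<I> A B \<longleftrightarrow> (\<exists>N g h. N \<in> \<I> \<and> arr g A N \<and> arr h N B \<and> f = h \<cdot> g)"
  using assms ideal_Ob by (auto simp: factoring_def arr_def)

text \<open>Closure under sums is where direct sums inside \<open>\<I>\<close> enter:
  \<open>h g + h' g'\<close> is the row \<open>(h, h')\<close> after the column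
  \<open>(g, g')\<close> and factors through \<open>N \<oplus> N'\<close>. A sign is absorbed by the
  second factor \<open>h\<close>, and zero passes through any object of \<open>\<I>\<close>.\<close>

lemma subgroup_factoring:
  assumes "A \<in> Ob \<C>" "B \<in> Ob \<C>"
  shows "subgroup (factoring \<C> \<I> A B) (Hom \<C> A B)"
proof -
  interpret comm_group "Hom \<C> A B" using Hom_group assms by blast
  note F = factoring_iff[OF assms]
  show ?thesis
  proof
    show "factoring \<C> \<I> A B \<subseteq> mor \<C> A B"
    proof
      fix f assume "f \<in> factoring \<C> \<I> A B"
      then obtain N g h where f: "N \<in> \<I>" "arr g A N" "arr h N B" "f = h \<cdot> g" unfolding F by blast
      have "arr f A B" using arrD[OF f(2)] arrD[OF f(3)] by (simp add: f(4) arr_iff arr_simps)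
      then show "f \<in> mor \<C> A B" using arrD by blast
    qed
    obtain N where N: "N \<in> \<I>" by (rule ideal_nonempty)
    then have "arr (zr A N) A N" "arr (zr N B) N B" "zr A B = zr N B \<cdot> zr A N"
      using assms ideal_Ob[OF N] by (simp_all add: arr_iff arr_simps)
    then show "zr A B \<in> factoring \<C> \<I> A B" unfolding F using N by blast
  next
    fix f f' assume "f \<in> factoring \<C> \<I> A B" "f' \<in> factoring \<C> \<I> A B"
    then obtain N g h N' g' h' where f: "N \<in> \<I>" "arr g A N" "arr h N B" "f = h \<cdot> g"
      "N' \<in> \<I>" "arr g' A N'" "arr h' N' B" "f' = h' \<cdot> g'" unfolding F by blast
    obtain S where S: "biproduct \<C> N N' S" "Sum S \<in> \<I>" using ideal_biproduct f by blast
    note t = arrD[OF f(2)] arrD[OF f(3)] arrD[OF f(6)] arrD[OF f(7)]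
      biproductD[OF ideal_Ob[OF f(1)] ideal_Ob[OF f(5)] S(1)]
    have "arr (In1 S \<cdot> g \<oplus> In2 S \<cdot> g') A (Sum S)" "arr (h \<cdot> Pr1 S \<oplus> h' \<cdot> Pr2 S) (Sum S) B"
      "f \<oplus> f' = (h \<cdot> Pr1 S \<oplus> h' \<cdot> Pr2 S) \<cdot> (In1 S \<cdot> g \<oplus> In2 S \<cdot> g')"
      using t by (simp_all add: f(4,8) arr_iff arr_simps)
    moreover have "f \<otimes>\<^bsub>Hom \<C> A B\<^esub> f' = f \<oplus> f'"
      using t by (intro plus_eq) (simp_all add: f(4,8) arr_simps)
    ultimately show "f \<otimes>\<^bsub>Hom \<C> A B\<^esub> f' \<in> factoring \<C> \<I> A B" unfolding F using S by auto
  next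
    fix f assume "f \<in> factoring \<C> \<I> A B"
    then obtain N g h where f: "N \<in> \<I>" "arr g A N" "arr h N B" "f = h \<cdot> g" unfolding F by blast
    note t = arrD[OF f(2)] arrD[OF f(3)]
    have "arr (neg h) N B" "inv\<^bsub>Hom \<C> A B\<^esub> f = neg h \<cdot> g"
      using t neg_comp[of g h] by (simp_all add: f(4) arr_iff arr_simps neg_def[of "h \<cdot> g"])
    then show "inv\<^bsub>Hom \<C> A B\<^esub> f \<in> factoring \<C> \<I> A B" unfolding F using f by blast
  qed
qed

section \<open>The quotient category and its additive structure\<close>

abbreviation \<D> :: "('o, 'm set) cat" where
  "\<D> \<equiv> quotient_category \<C> \<I>"

abbreviation q :: "'m \<Rightarrow> 'm set" where
  "q \<equiv> mor_class \<C> \<I>"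

lemma quotient_simps [simp]:
  "Ob \<D> = Ob \<C>" "Hom \<D> A B = Hom \<C> A B Mod factoring \<C> \<I> A B" "Ident \<D> A = q (Ident \<C> A)"
  by (simp_all add: quotient_category_def)

lemma mor_class_eq:
  assumes "arr f A B"
  shows "q f = factoring \<C> \<I> A B #>\<^bsub>Hom \<C> A B\<^esub> f"
proof -
  have *: "A' = A \<and> B' = B" if "A' \<in> Ob \<C>" "B' \<in> Ob \<C>" "f \<in> mor \<C> A' B'" for A' B'
    using that assms Hom_disjoint by (auto simp: arr_def)
  show ?thesis unfolding mor_class_def using assms * by (auto simp: arr_def)
qed

lemma mor_quotient_iff:
  assumes "A \<in> Ob \<C>" "B \<in> Ob \<C>"
  shows "X \<in> mor \<D> A B \<longleftrightarrow> (\<exists>f. arr f A B \<and> X = q f)"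
  using assms mor_class_eq by (auto simp: carrier_FactGroup arr_def)

text \<open>The working form of the congruence: it exposes the two factors of the error term. Later
  arguments lift \<open>h\<close> along a deflation or extend \<open>g\<close> along an inflation
  and so remove the error.\<close>

lemma q_eq_iff:
  assumes "arr f A B" "arr f' A B"
  shows "q f = q f' \<longleftrightarrow> (\<exists>N g h. N \<in> \<I> \<and> arr g A N \<and> arr h N B \<and> f = f' \<oplus> h \<cdot> g)"
proof -
  note t = arrD[OF assms(1)] arrD[OF assms(2)]
  interpret comm_group "Hom \<C> A B" using Hom_group t by blast
  let ?H = "factoring \<C> \<I> A B"
  note H = subgroup_factoring[OF t(4,5)]
  have "?H #>\<^bsub>Hom \<C> A B\<^esub> f = ?H #>\<^bsub>Hom \<C> A B\<^esub> f' \<longleftrightarrow> f \<in> ?H #>\<^bsub>Hom \<C> A B\<^esub> f'"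
    using rcos_self[OF t(6) H] repr_independence[OF _ t(12) H, of f] by auto
  also have "\<dots> \<longleftrightarrow> (\<exists>k\<in>?H. f = f' \<oplus> k)"
  proof -
    have "k \<otimes>\<^bsub>Hom \<C> A B\<^esub> f' = f' \<oplus> k" if "k \<in> ?H" for k
      using t that subgroup.subset[OF H] m_comm[of k f'] plus_eq[of f' A B k] by auto
    then show ?thesis by (auto simp: r_coset_def)
  qed
  finally show ?thesis
    unfolding mor_class_eq[OF assms(1)] mor_class_eq[OF assms(2)] unfolding factoring_iff[OF t(4,5)] Bex_def by auto
qed

lemma mem_mor_class_iff:
  assumes "arr f A B"
  shows "f' \<in> q f \<longleftrightarrow> arr f' A B \<and> q f' = q f"
proof -
  note t = arrD[OF assms(1)]
  interpret comm_group "Hom \<C> A B" using Hom_group t by blast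
  note H = subgroup_factoring[OF t(4,5)]
  have *: "q f' = factoring \<C> \<I> A B #>\<^bsub>Hom \<C> A B\<^esub> f'" if "arr f' A B"
    using that by (rule mor_class_eq)
  show ?thesis
  proof
    assume f': "f' \<in> q f"
    then have "f' \<in> factoring \<C> \<I> A B #>\<^bsub>Hom \<C> A B\<^esub> f" by (simp add: mor_class_eq[OF assms])
    moreover from this have "arr f' A B"
      using r_coset_subset_G[OF subgroup.subset[OF H] t(6)] t by (auto simp: arr_def)
    ultimately show "arr f' A B \<and> q f' = q f"
      using repr_independence[OF _ t(6) H, of f'] by (simp add: mor_class_eq[OF assms] *)
  next
    assume f': "arr f' A B \<and> q f' = q f"
    then show "f' \<in> q f" using rcos_self[OF _ H, of f'] * by (auto simp: arr_def)
  qed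
qed

lemma q_plus_Hom:
  assumes "arr f A B" "arr g A B"
  shows "q f \<otimes>\<^bsub>Hom \<D> A B\<^esub> q g = q (f \<oplus> g)"
proof -
  note t = arrD[OF assms(1)] arrD[OF assms(2)]
  interpret comm_group "Hom \<C> A B" using Hom_group t by blast
  interpret normal "factoring \<C> \<I> A B" "Hom \<C> A B"
    using subgroup_factoring[OF t(4,5)] subgroup_imp_normal by blast
  have *: "arr (f \<oplus> g) A B" using t by (simp add: arr_iff arr_simps)
  show ?thesis
    using t rcos_sum[of f g] plus_eq[of f A B g]
    by (simp add: mor_class_eq[OF assms(1)] mor_class_eq[OF assms(2)] mor_class_eq[OF *])
qed

lemma q_zr:
  assumes "A \<in> Ob \<C>" "B \<in> Ob \<C>"
  shows "\<one>\<^bsub>Hom \<D> A B\<^esub> = q (zr A B)"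
proof -
  interpret comm_group "Hom \<C> A B" using Hom_group assms by blast
  have *: "arr (zr A B) A B" using assms by (simp add: arr_iff arr_simps)
  show ?thesis
    using coset_mult_one[OF subgroup.subset[OF subgroup_factoring[OF assms]]]
    by (simp add: mor_class_eq[OF *])
qed

text \<open>The ideal is two-sided. One factor is replaced at a time, and the errors
  \<open>(g v) u\<close> and \<open>z (w f')\<close> again pass through \<open>N\<close> and
  \<open>M\<close>.\<close>

lemma q_comp_cong:
  assumes "arr f A B" "arr f' A B" "arr g B C" "arr g' B C" "q f = q f'" "q g = q g'"
  shows "q (g \<cdot> f) = q (g' \<cdot> f')"
proof -
  note t = arrD[OF assms(1)] arrD[OF assms(2)] arrD[OF assms(3)] arrD[OF assms(4)]
  obtain N u v where f: "N \<in> \<I>" "arr u A N" "arr v N B" "f = f' \<oplus> v \<cdot> u"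
    using assms(5) q_eq_iff[OF assms(1,2)] by blast
  obtain M w z where g: "M \<in> \<I>" "arr w B M" "arr z M C" "g = g' \<oplus> z \<cdot> w"
    using assms(6) q_eq_iff[OF assms(3,4)] by blast
  note u = arrD[OF f(2)] arrD[OF f(3)] arrD[OF g(2)] arrD[OF g(3)]
  have v: "arr (g \<cdot> f) A C" "arr (g \<cdot> f') A C" "arr (g' \<cdot> f') A C" "arr (g \<cdot> v) N C" "arr (w \<cdot> f') A M"
    using t u by (simp_all add: arr_iff arr_simps)
  have "g \<cdot> f = g \<cdot> f' \<oplus> (g \<cdot> v) \<cdot> u" using t u by (simp add: f(4) arr_simps)
  then have "q (g \<cdot> f) = q (g \<cdot> f')" unfolding q_eq_iff[OF v(1,2)] using f(1,2) v(4) by blast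
  also have "g \<cdot> f' = g' \<cdot> f' \<oplus> z \<cdot> (w \<cdot> f')" using t u by (simp add: g(4) arr_simps)
  then have "q (g \<cdot> f') = q (g' \<cdot> f')" unfolding q_eq_iff[OF v(2,3)] using g(1,3) v(5) by blast
  finally show ?thesis .
qed

lemma q_comp_Comp:
  assumes "arr f A B" "arr g B C"
  shows "q g \<cdot>\<^bsub>\<D>\<^esub> q f = q (g \<cdot> f)"
proof -
  have "q (g' \<cdot> f') = q (g \<cdot> f)" if "g' \<in> q g" "f' \<in> q f" for g' f'
  proof (rule q_comp_cong)
    show "arr f' A B" "q f' = q f" using that mem_mor_class_iff[OF assms(1)] by auto
    show "arr g' B C" "q g' = q g" using that mem_mor_class_iff[OF assms(2)] by auto
  qed (use assms in auto)
  then have "(\<Union>g'\<in>q g. \<Union>f'\<in>q f. q (g' \<cdot> f')) = (\<Union>g'\<in>q g. \<Union>f'\<in>q f. q (g \<cdot> f))"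
    by (intro SUP_cong refl)
  moreover have "f \<in> q f" "g \<in> q g"
    using mem_mor_class_iff[OF assms(1)] mem_mor_class_iff[OF assms(2)] assms by auto
  then have "(\<Union>g'\<in>q g. \<Union>f'\<in>q f. q (g \<cdot> f)) = q (g \<cdot> f)" by blast
  ultimately show ?thesis by (simp add: quotient_category_def)
qed

lemma preadditive_quotient: "preadditive_category \<D>"
proof (rule preadditive_category.intro)
  fix A B assume AB: "A \<in> Ob \<D>" "B \<in> Ob \<D>"
  then interpret comm_group "Hom \<C> A B" using Hom_group by simp
  show "comm_group (Hom \<D> A B)"
    using AB abelian_FactGroup subgroup_factoring by simp
next
  fix A B A' B' X assume "A \<in> Ob \<D>" "B \<in> Ob \<D>" "A' \<in> Ob \<D>" "B' \<in> Ob \<D>" "X \<in> mor \<D> A B" "X \<in> mor \<D> A' B'"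
  then obtain f f' where f: "arr f A B" "arr f' A' B'" "q f = q f'" using mor_quotient_iff by auto
  then have "arr f A' B'" using mem_mor_class_iff[OF f(1), of f] mem_mor_class_iff[OF f(2), of f] by auto
  then show "A = A' \<and> B = B'" using f by (auto simp: arr_iff)
next
  fix A assume "A \<in> Ob \<D>"
  then show "Ident \<D> A \<in> mor \<D> A A" using arr_IdentI mor_quotient_iff by auto
next
  fix A B C X Y assume o: "A \<in> Ob \<D>" "B \<in> Ob \<D>" "C \<in> Ob \<D>" and "X \<in> mor \<D> A B" "Y \<in> mor \<D> B C"
  then obtain f g where f: "arr f A B" "X = q f" "arr g B C" "Y = q g" using mor_quotient_iff by auto
  then show "Y \<cdot>\<^bsub>\<D>\<^esub> X \<in> mor \<D> A C"
    using o mor_quotient_iff[of A C] q_comp_Comp arr_compI[of f A B g C] by auto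
next
  fix A B X assume "A \<in> Ob \<D>" "B \<in> Ob \<D>" "X \<in> mor \<D> A B"
  then obtain f where f: "arr f A B" "X = q f" using mor_quotient_iff by auto
  note t = arrD[OF f(1)]
  show "Ident \<D> B \<cdot>\<^bsub>\<D>\<^esub> X = X" "X \<cdot>\<^bsub>\<D>\<^esub> Ident \<D> A = X"
    using t f q_comp_Comp[OF f(1) arr_IdentI[OF t(5)]] q_comp_Comp[OF arr_IdentI[OF t(4)] f(1)]
    by (simp_all add: arr_simps)
next
  fix A B C D X Y Z
  assume "A \<in> Ob \<D>" "B \<in> Ob \<D>" "C \<in> Ob \<D>" "D \<in> Ob \<D>"
    "X \<in> mor \<D> A B" "Y \<in> mor \<D> B C" "Z \<in> mor \<D> C D"
  then obtain f g h where f: "arr f A B" "X = q f" "arr g B C" "Y = q g" "arr h C D" "Z = q h"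
    using mor_quotient_iff by auto
  note t = arrD[OF f(1)] arrD[OF f(3)] arrD[OF f(5)]
  show "(Z \<cdot>\<^bsub>\<D>\<^esub> Y) \<cdot>\<^bsub>\<D>\<^esub> X = Z \<cdot>\<^bsub>\<D>\<^esub> (Y \<cdot>\<^bsub>\<D>\<^esub> X)"
    unfolding f(2,4,6) q_comp_Comp[OF f(3,5)] q_comp_Comp[OF f(1,3)]
      q_comp_Comp[OF f(1) arr_compI[OF f(3,5)]] q_comp_Comp[OF arr_compI[OF f(1,3)] f(5)]
    using t by (simp add: arr_simps)
next
  fix A B C X X' Y
  assume "A \<in> Ob \<D>" "B \<in> Ob \<D>" "C \<in> Ob \<D>" "X \<in> mor \<D> A B" "X' \<in> mor \<D> A B" "Y \<in> mor \<D> B C"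
  then obtain f f' g where f: "arr f A B" "X = q f" "arr f' A B" "X' = q f'" "arr g B C" "Y = q g"
    using mor_quotient_iff by auto
  note t = arrD[OF f(1)] arrD[OF f(3)] arrD[OF f(5)]
  show "Y \<cdot>\<^bsub>\<D>\<^esub> (X \<otimes>\<^bsub>Hom \<D> A B\<^esub> X') = (Y \<cdot>\<^bsub>\<D>\<^esub> X) \<otimes>\<^bsub>Hom \<D> A C\<^esub> (Y \<cdot>\<^bsub>\<D>\<^esub> X')"
    unfolding f(2,4,6) q_plus_Hom[OF f(1,3)] q_comp_Comp[OF f(1,5)] q_comp_Comp[OF f(3,5)]
      q_comp_Comp[OF arr_plusI[OF f(1,3)] f(5)] q_plus_Hom[OF arr_compI[OF f(1,5)] arr_compI[OF f(3,5)]]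
    using t by (simp add: arr_simps)
next
  fix A B C X Y Y'
  assume "A \<in> Ob \<D>" "B \<in> Ob \<D>" "C \<in> Ob \<D>" "X \<in> mor \<D> A B" "Y \<in> mor \<D> B C" "Y' \<in> mor \<D> B C"
  then obtain f g g' where f: "arr f A B" "X = q f" "arr g B C" "Y = q g" "arr g' B C" "Y' = q g'"
    using mor_quotient_iff by auto
  note t = arrD[OF f(1)] arrD[OF f(3)] arrD[OF f(5)]
  show "(Y \<otimes>\<^bsub>Hom \<D> B C\<^esub> Y') \<cdot>\<^bsub>\<D>\<^esub> X = (Y \<cdot>\<^bsub>\<D>\<^esub> X) \<otimes>\<^bsub>Hom \<D> A C\<^esub> (Y' \<cdot>\<^bsub>\<D>\<^esub> X)"
    unfolding f(2,4,6) q_plus_Hom[OF f(3,5)] q_comp_Comp[OF f(1,3)] q_comp_Comp[OF f(1,5)]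
      q_comp_Comp[OF f(1) arr_plusI[OF f(3,5)]] q_plus_Hom[OF arr_compI[OF f(1,3)] arr_compI[OF f(1,5)]]
    using t by (simp add: arr_simps)
qed

sublocale D: preadditive_category \<D>
  by (rule preadditive_quotient)

lemma q_arr: "arr f A B \<Longrightarrow> D.arr (q f) A B"
  using mor_quotient_iff by (auto simp: D.arr_def arrD)

lemma quotient_arrE:
  assumes "D.arr X A B"
  obtains f where "arr f A B" "X = q f"
  using assms mor_quotient_iff by (auto simp: D.arr_def)

lemma is_arr_q:
  assumes "is_arr f"
  shows "D.is_arr (q f)" "D.dm (q f) = dm f" "D.cd (q f) = cd f"
  using q_arr[of f "dm f" "cd f"] assms by (auto simp: arr_iff D.arr_iff)

lemma q_comp: "\<lbrakk>is_arr f; is_arr g; dm g = cd f\<rbrakk> \<Longrightarrow> q (g \<cdot> f) = q g \<cdot>\<^bsub>\<D>\<^esub> q f"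
  using q_comp_Comp[of f "dm f" "cd f" g "cd g"] by (simp add: arr_iff)

lemma q_plus: "\<lbrakk>is_arr f; is_arr g; dm g = dm f; cd g = cd f\<rbrakk> \<Longrightarrow> q (f \<oplus> g) = D.plus (q f) (q g)"
  using q_plus_Hom[of f "dm f" "cd f" g] by (simp add: arr_iff D.plus_def is_arr_q)

lemma zero_object_quotient:
  assumes "zero_object \<C> Z"
  shows "zero_object \<D> Z"
proof -
  have Z: "Z \<in> Ob \<C>" using assms by (simp add: zero_object_def)
  have "(\<exists>!X. X \<in> mor \<D> A Z) \<and> (\<exists>!X. X \<in> mor \<D> Z A)" if "A \<in> Ob \<C>" for A
    using assms that Z unfolding mor_quotient_iff[OF that Z] mor_quotient_iff[OF Z that]
    by (auto simp: zero_object_def arr_def) metis+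
  then show ?thesis using Z by (simp add: zero_object_def)
qed

lemma biproduct_quotient:
  assumes "A \<in> Ob \<C>" "B \<in> Ob \<C>" "biproduct \<C> A B S"
  shows "biproduct \<D> A B (map_biprod q S)"
proof -
  note t = biproductD[OF assms]
  have AB: "A \<in> Ob \<D>" "B \<in> Ob \<D>" using assms by auto
  have "q (In1 S) \<cdot>\<^bsub>\<D>\<^esub> q (Pr1 S) = q (In1 S \<cdot> Pr1 S)" "q (In2 S) \<cdot>\<^bsub>\<D>\<^esub> q (Pr2 S) = q (In2 S \<cdot> Pr2 S)"
    using t by (simp_all add: q_comp)
  moreover have "D.plus (q (In1 S \<cdot> Pr1 S)) (q (In2 S \<cdot> Pr2 S)) = q (Ident \<C> (Sum S))"
    using t q_plus[of "In1 S \<cdot> Pr1 S" "In2 S \<cdot> Pr2 S"] by (simp add: is_arr_comp)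
  ultimately show ?thesis
    unfolding D.biproduct_iff[OF AB] using t assms q_zr[of A B] q_zr[of B A]
    by (simp add: D.arr_iff is_arr_q q_comp[symmetric])
qed

sublocale D: additive_category \<D>
proof
  show "\<exists>Z. zero_object \<D> Z" using zero_object_exists zero_object_quotient by blast
  show "\<exists>S. biproduct \<D> A B S" if "A \<in> Ob \<D>" "B \<in> Ob \<D>" for A B
    using that biproduct_exists[of A B] biproduct_quotient[of A B] unfolding quotient_simps by blast
qed

text \<open>From here on the quotient is handled through the calculus of the interpretation
  \<open>D\<close>, whose rules mention \<open>Hom \<D>\<close> and \<open>Ident \<D>\<close> and
  would not match their unfolded forms.\<close>

declare quotient_simps(2,3) [simp del]

lemma q_Ident: "q (Ident \<C> A) = Ident \<D> A"
  by (simp add: quotient_simps)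

lemmas q_simps = is_arr_q q_comp q_plus q_Ident

lemma dsum_mor_quotient:
  assumes "A \<in> Ob \<C>" "A' \<in> Ob \<C>" "B \<in> Ob \<C>" "B' \<in> Ob \<C>"
    "biproduct \<C> A A' S" "biproduct \<C> B B' T" "arr f A B" "arr f' A' B'"
  shows "q (dsum_mor \<C> S T f f') = dsum_mor \<D> (map_biprod q S) (map_biprod q T) (q f) (q f')"
proof -
  note t = biproductD[OF assms(1,2,5)] biproductD[OF assms(3,4,6)] arrD[OF assms(7)] arrD[OF assms(8)]
  have "D.arr (q f) A B" "D.arr (q f') A' B'" using assms q_arr by auto
  then show ?thesis
    unfolding dsum_mor_eq(1)[OF assms] using assms t
    by (subst D.dsum_mor_eq(1)[of A A' B B']) (simp_all add: biproduct_quotient q_simps is_arr_comp)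
qed

end

section \<open>The induced structure\<close>

locale extriangulated_quotient =
  extriangulated_category \<C> \<E> s + ideal_quotient \<C> \<I>
  for \<C> :: "('o, 'm, 'z) cat_scheme" (structure)
    and \<E> :: "('o, 'm, 'e) bifun"
    and s :: "('o, 'm, 'e) realz"
    and \<I> :: "'o set" +
  assumes ideal_Proj_Inj: "\<I> \<subseteq> Proj \<C> \<E> s \<inter> Inj \<C> \<E> s"
begin

section \<open>Vanishing of extensions and independence of representatives\<close>

lemma lift_projective:
  assumes "N \<in> \<I>" "tri A x B y C \<delta>" "arr h N C"
  obtains k where "arr k N B" "y \<cdot> k = h"
proof -
  have "deflation \<C> \<E> s B C y" using assms(2) by (auto simp: deflation_def)
  moreover have "N \<in> Proj \<C> \<E> s" using assms ideal_Proj_Inj by blast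
  ultimately have "\<exists>k\<in>mor \<C> N B. y \<cdot> k = h" using arrD(6)[OF assms(3)] by (auto simp: Proj_def)
  then show ?thesis using that assms(1) ideal_Ob triD[OF assms(2)] by (auto simp: arr_def)
qed

lemma extend_injective:
  assumes "N \<in> \<I>" "tri A x B y C \<delta>" "arr g A N"
  obtains k where "arr k B N" "k \<cdot> x = g"
proof -
  have "inflation \<C> \<E> s A B x" using assms(2) by (auto simp: inflation_def)
  moreover have "N \<in> Inj \<C> \<E> s" using assms ideal_Proj_Inj by blast
  ultimately have "\<exists>k\<in>mor \<C> B N. k \<cdot> x = g" using arrD(6)[OF assms(3)] by (auto simp: Inj_def)
  then show ?thesis using that assms(1) ideal_Ob triD[OF assms(2)] by (auto simp: arr_def)
qed

text \<open>As \<open>N\<close> is projective, the deflation \<open>y\<close> of a realization has a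
  section \<open>k\<close>. Hence \<open>\<delta>\<close> is the pullback along \<open>k\<close> of
  the pullback of \<open>\<delta>\<close> along \<open>y\<close>, and the latter is zero by
  \<open>pull_deflation\<close>.\<close>

lemma Ext_ideal_left:
  assumes "N \<in> \<I>" "A \<in> Ob \<C>" "\<delta> \<in> carrier (Ext \<E> N A)"
  shows "\<delta> = \<one>\<^bsub>Ext \<E> N A\<^esub>"
proof -
  have N: "N \<in> Ob \<C>" using assms ideal_Ob by blast
  obtain x B y where T: "tri A x B y N \<delta>" using tri_exists assms N by blast
  note t = triD[OF T]
  obtain k where k: "arr k N B" "y \<cdot> k = Ident \<C> N"
    using lift_projective[OF assms(1) T arr_IdentI[OF N]] by blast
  note k' = arrD[OF k(1)]
  have "Act \<E> k (Ident \<C> A) (Act \<E> y (Ident \<C> A) \<delta>) = Act \<E> (Ident \<C> N) (Ident \<C> A) \<delta>"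
    using t k' k(2) by (simp add: act_simps)
  then show ?thesis
    using t k' N assms by (simp add: pull_deflation[OF T] Act_one arr_simps Act_Ident)
qed

text \<open>Dually, injectivity of \<open>N\<close> gives a retraction of the inflation, and pushing
  \<open>\<delta>\<close> along the inflation already yields zero.\<close>

lemma Ext_ideal_right:
  assumes "N \<in> \<I>" "C \<in> Ob \<C>" "\<delta> \<in> carrier (Ext \<E> C N)"
  shows "\<delta> = \<one>\<^bsub>Ext \<E> C N\<^esub>"
proof -
  have N: "N \<in> Ob \<C>" using assms ideal_Ob by blast
  obtain x B y where T: "tri N x B y C \<delta>" using tri_exists assms N by blast
  note t = triD[OF T]
  obtain k where k: "arr k B N" "k \<cdot> x = Ident \<C> N"
    using extend_injective[OF assms(1) T arr_IdentI[OF N]] by blast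
  note k' = arrD[OF k(1)]
  have "Act \<E> (Ident \<C> C) k (Act \<E> (Ident \<C> C) x \<delta>) = Act \<E> (Ident \<C> C) (Ident \<C> N) \<delta>"
    using t k' k(2) by (simp add: act_simps)
  then show ?thesis
    using t k' N assms by (simp add: push_inflation[OF T] Act_one arr_simps Act_Ident)
qed

text \<open>By biadditivity, replacing one representative changes the value by the action of a
  morphism through an object \<open>N\<close> of \<open>\<I>\<close>. That action passes through an
  extension group with \<open>N\<close> as one of its arguments, and this group is trivial. The two
  variables are treated in turn.\<close>

lemma Act_cong:
  assumes "arr c C' C" "arr c' C' C" "arr a A A'" "arr a' A A'" "q c = q c'" "q a = q a'"
    "\<delta> \<in> carrier (Ext \<E> C A)"
  shows "Act \<E> c a \<delta> = Act \<E> c' a' \<delta>"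
proof -
  note t = arrD[OF assms(1)] arrD[OF assms(2)] arrD[OF assms(3)] arrD[OF assms(4)]
  interpret comm_group "Ext \<E> C' A'" using Ext_group t by blast
  obtain N g h where f: "N \<in> \<I>" "arr g C' N" "arr h N C" "c = c' \<oplus> h \<cdot> g"
    using assms(5) q_eq_iff[OF assms(1,2)] by blast
  note f' = arrD[OF f(2)] arrD[OF f(3)]
  have N: "Act \<E> h a \<delta> = \<one>\<^bsub>Ext \<E> N A'\<^esub>"
    by (rule Ext_ideal_left[OF f(1) t(17) Act_closed]) (use t f' assms(7) in auto)
  have "Act \<E> (h \<cdot> g) a \<delta> = Act \<E> g (Ident \<C> A') (Act \<E> h a \<delta>)"
    using t f' assms(7) by (simp add: act_simps)
  then have "Act \<E> (h \<cdot> g) a \<delta> = \<one>\<^bsub>Ext \<E> C' A'\<^esub>" using t f' by (simp add: N Act_one arr_simps)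
  then have 1: "Act \<E> c a \<delta> = Act \<E> c' a \<delta>"
    using t f' assms(7) Act_plus_left[of c' "h \<cdot> g" a \<delta>]
    by (simp add: f(4) is_arr_comp Act_closed)
  obtain M u v where g: "M \<in> \<I>" "arr u A M" "arr v M A'" "a = a' \<oplus> v \<cdot> u"
    using assms(6) q_eq_iff[OF assms(3,4)] by blast
  note g' = arrD[OF g(2)] arrD[OF g(3)]
  have M: "Act \<E> c' u \<delta> = \<one>\<^bsub>Ext \<E> C' M\<^esub>"
    by (rule Ext_ideal_right[OF g(1) t(4) Act_closed]) (use t g' assms(7) in auto)
  have "Act \<E> c' (v \<cdot> u) \<delta> = Act \<E> (Ident \<C> C') v (Act \<E> c' u \<delta>)"
    using t g' assms(7) by (simp add: act_simps)
  then have "Act \<E> c' (v \<cdot> u) \<delta> = \<one>\<^bsub>Ext \<E> C' A'\<^esub>" using t g' by (simp add: M Act_one arr_simps)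
  then have "Act \<E> c' a \<delta> = Act \<E> c' a' \<delta>"
    using t g' assms(7) Act_plus_right[of c' a' "v \<cdot> u" \<delta>]
    by (simp add: g(4) is_arr_comp Act_closed)
  with 1 show ?thesis by simp
qed

text \<open>The action is given on chosen representatives; \<open>Act_cong\<close> makes the choice
  immaterial on nonempty classes.\<close>

definition \<E>' :: "('o, 'm set, 'e) bifun" where
  "\<E>' = \<lparr>Ext = Ext \<E>, Act = (\<lambda>X Y. Act \<E> (SOME c. c \<in> X) (SOME a. a \<in> Y))\<rparr>"

text \<open>All sets in this union coincide, as \<open>s'_class\<close> shows; the union spares the
  choice of a realizing sequence.\<close>

definition s' :: "('o, 'm set, 'e) realz" where
  "s' C A \<delta> = (\<Union>(x, B, y)\<in>s C A \<delta>. seq_class \<D> A C (q x) B (q y))"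

lemma Ext_quotient [simp]: "Ext \<E>' = Ext \<E>"
  by (simp add: \<E>'_def)

lemma Act_quotient:
  assumes "is_arr c" "is_arr a" "\<delta> \<in> carrier (Ext \<E> (cd c) (dm a))"
  shows "Act \<E>' (q c) (q a) \<delta> = Act \<E> c a \<delta>"
proof -
  have c: "arr c (dm c) (cd c)" and a: "arr a (dm a) (cd a)" using assms arr_iff by auto
  define c' where "c' = (SOME c'. c' \<in> q c)"
  define a' where "a' = (SOME a'. a' \<in> q a)"
  have "c \<in> q c" "a \<in> q a" using mem_mor_class_iff[OF c] mem_mor_class_iff[OF a] c a by auto
  then have "c' \<in> q c" "a' \<in> q a" unfolding c'_def a'_def by (auto intro: someI)
  then have "arr c' (dm c) (cd c)" "q c' = q c" "arr a' (dm a) (cd a)" "q a' = q a"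
    using mem_mor_class_iff[OF c] mem_mor_class_iff[OF a] by auto
  then have "Act \<E> c' a' \<delta> = Act \<E> c a \<delta>" using Act_cong c a assms by blast
  then show ?thesis by (simp add: \<E>'_def c'_def a'_def)
qed

lemma biadditive_quotient: "biadditive_bifunctor \<D> \<E>'"
proof (intro biadditive_bifunctor.intro Ab_bifunctor.intro D.additive_category_axioms
    Ab_bifunctor_axioms.intro biadditive_bifunctor_axioms.intro)
  fix C A assume "C \<in> Ob \<D>" "A \<in> Ob \<D>"
  then show "comm_group (Ext \<E>' C A)" using Ext_group by simp
next
  fix C C' A A' X Y assume o: "C \<in> Ob \<D>" "C' \<in> Ob \<D>" "A \<in> Ob \<D>" "A' \<in> Ob \<D>"
    "X \<in> mor \<D> C' C" "Y \<in> mor \<D> A A'"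
  then obtain c a where c: "arr c C' C" "X = q c" "arr a A A'" "Y = q a" using mor_quotient_iff by auto
  note t = arrD[OF c(1)] arrD[OF c(3)]
  have "Act \<E> c a \<in> hom (Ext \<E> C A) (Ext \<E> C' A')" using t Act_hom by blast
  \<comment> \<open>\<open>Act_quotient\<close> is about to be applied to this product and has its
    membership as a side condition.\<close>
  moreover have "x \<otimes>\<^bsub>Ext \<E> C A\<^esub> y \<in> carrier (Ext \<E> C A)"
    if "x \<in> carrier (Ext \<E> C A)" "y \<in> carrier (Ext \<E> C A)" for x y
    using Ext_group[OF t(5,10)] that by (simp add: comm_group_def comm_monoid_def monoid.m_closed)
  ultimately show "Act \<E>' X Y \<in> hom (Ext \<E>' C A) (Ext \<E>' C' A')"
    using t by (simp add: hom_def Pi_def c(2,4) Act_quotient)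
next
  fix C A \<delta> assume "C \<in> Ob \<D>" "A \<in> Ob \<D>" "\<delta> \<in> carrier (Ext \<E>' C A)"
  then show "Act \<E>' (Ident \<D> C) (Ident \<D> A) \<delta> = \<delta>"
    by (simp add: quotient_simps(3) Act_quotient arr_simps Act_Ident)
next
  fix C C' C'' A A' A'' X X' Y Y' \<delta>
  assume o: "C \<in> Ob \<D>" "C' \<in> Ob \<D>" "C'' \<in> Ob \<D>" "A \<in> Ob \<D>" "A' \<in> Ob \<D>" "A'' \<in> Ob \<D>"
    "X \<in> mor \<D> C' C" "X' \<in> mor \<D> C'' C'" "Y \<in> mor \<D> A A'" "Y' \<in> mor \<D> A' A''"
    and d: "\<delta> \<in> carrier (Ext \<E>' C A)"
  then obtain c c' a a' where c: "arr c C' C" "X = q c" "arr c' C'' C'" "X' = q c'"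
    "arr a A A'" "Y = q a" "arr a' A' A''" "Y' = q a'" using mor_quotient_iff by auto
  note t = arrD[OF c(1)] arrD[OF c(3)] arrD[OF c(5)] arrD[OF c(7)]
  show "Act \<E>' (X \<cdot>\<^bsub>\<D>\<^esub> X') (Y' \<cdot>\<^bsub>\<D>\<^esub> Y) \<delta> = Act \<E>' X' Y' (Act \<E>' X Y \<delta>)"
    using t d by (simp add: c(2,4,6,8) q_comp[symmetric] Act_quotient act_simps)
next
  fix C C' A A' X X' Y \<delta>
  assume o: "C \<in> Ob \<D>" "C' \<in> Ob \<D>" "A \<in> Ob \<D>" "A' \<in> Ob \<D>"
    "X \<in> mor \<D> C' C" "X' \<in> mor \<D> C' C" "Y \<in> mor \<D> A A'"
    and d: "\<delta> \<in> carrier (Ext \<E>' C A)"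
  then obtain c c' a where c: "arr c C' C" "X = q c" "arr c' C' C" "X' = q c'"
    "arr a A A'" "Y = q a" using mor_quotient_iff by auto
  note t = arrD[OF c(1)] arrD[OF c(3)] arrD[OF c(5)]
  show "Act \<E>' (X \<otimes>\<^bsub>Hom \<D> C' C\<^esub> X') Y \<delta> = Act \<E>' X Y \<delta> \<otimes>\<^bsub>Ext \<E>' C' A'\<^esub> Act \<E>' X' Y \<delta>"
    unfolding c(2,4,6) q_plus_Hom[OF c(1,3)]
    using t d by (simp add: Act_quotient Act_plus_left is_arr_plus)
next
  fix C C' A A' X Y Y' \<delta>
  assume o: "C \<in> Ob \<D>" "C' \<in> Ob \<D>" "A \<in> Ob \<D>" "A' \<in> Ob \<D>"
    "X \<in> mor \<D> C' C" "Y \<in> mor \<D> A A'" "Y' \<in> mor \<D> A A'"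
    and d: "\<delta> \<in> carrier (Ext \<E>' C A)"
  then obtain c a a' where c: "arr c C' C" "X = q c" "arr a A A'" "Y = q a" "arr a' A A'" "Y' = q a'"
    using mor_quotient_iff by auto
  note t = arrD[OF c(1)] arrD[OF c(3)] arrD[OF c(5)]
  show "Act \<E>' X (Y \<otimes>\<^bsub>Hom \<D> A A'\<^esub> Y') \<delta> = Act \<E>' X Y \<delta> \<otimes>\<^bsub>Ext \<E>' C' A'\<^esub> Act \<E>' X Y' \<delta>"
    unfolding c(2,4,6) q_plus_Hom[OF c(3,5)]
    using t d by (simp add: Act_quotient Act_plus_right is_arr_plus)
qed

sublocale D: biadditive_bifunctor \<D> \<E>'
  by (rule biadditive_quotient)

lemma inverses_quotient: "inverses A B f g \<Longrightarrow> D.inverses A B (q f) (q g)"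
  using inversesD[of A B f g] by (simp add: D.inverses_def D.arr_iff is_arr_q q_comp[symmetric] q_Ident)

text \<open>Passing to classes turns an equivalence of sequences in \<open>\<C>\<close> into one in
  the quotient, so every realizing sequence of \<open>\<delta>\<close> gives the same class
  there.\<close>

lemma s'_class:
  assumes "tri A x B y C \<delta>"
  shows "s' C A \<delta> = seq_class \<D> A C (q x) B (q y)"
proof -
  note t = triD[OF assms]
  have oD: "A \<in> Ob \<D>" "C \<in> Ob \<D>" using t by simp_all
  have "seq_class \<D> A C (q x') B' (q y') = seq_class \<D> A C (q x) B (q y)"
    if m: "(x', B', y') \<in> s C A \<delta>" for x' B' y'
  proof -
    have "((x, B, y), (x', B', y')) \<in> seq_rel \<C> A C"
      using m assms tri_class[OF assms] by (auto simp: seq_class_def)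
    then obtain b b' where b: "arr x' A B'" "arr y' B' C" "inverses B B' b b'" "b \<cdot> x = x'" "y' \<cdot> b = y"
      unfolding seq_rel_iff[OF t(8,10)] by blast
    have "q b \<cdot>\<^bsub>\<D>\<^esub> q x = q x'" "q y' \<cdot>\<^bsub>\<D>\<^esub> q b = q y"
      using t inversesD[OF b(3)] arrD[OF b(2)] b(4,5) by (simp_all add: q_comp[symmetric])
    then have "((q x, B, q y), (q x', B', q y')) \<in> seq_rel \<D> A C"
      unfolding D.seq_rel_iff[OF oD] using b q_arr tri_arr[OF assms] inverses_quotient by blast
    then show ?thesis
      unfolding seq_class_def using equiv_class_eq[OF D.equiv_seq_rel[OF oD]] by blast
  qed
  moreover have "(x, B, y) \<in> s C A \<delta>" using assms by (simp add: E_triangle_def)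
  ultimately show ?thesis unfolding s'_def by blast
qed

lemma tri_quotient_iff:
  assumes "tri A x B y C \<delta>"
  shows "E_triangle \<D> \<E>' s' A X B' Y C \<delta> \<longleftrightarrow> D.arr X A B' \<and> D.arr Y B' C \<and>
    (\<exists>\<beta> \<beta>'. D.inverses B B' \<beta> \<beta>' \<and> \<beta> \<cdot>\<^bsub>\<D>\<^esub> q x = X \<and> Y \<cdot>\<^bsub>\<D>\<^esub> \<beta> = q y)"
proof -
  note t = triD[OF assms]
  have oD: "A \<in> Ob \<D>" "C \<in> Ob \<D>" using t by simp_all
  have "E_triangle \<D> \<E>' s' A X B' Y C \<delta> \<longleftrightarrow> ((q x, B, q y), (X, B', Y)) \<in> seq_rel \<D> A C"
    using t by (simp add: E_triangle_def s'_class[OF assms] seq_class_def)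
  then show ?thesis unfolding D.seq_rel_iff[OF oD] using q_arr tri_arr[OF assms] by blast
qed

lemma tri_quotientI:
  assumes "tri A x B y C \<delta>"
  shows "E_triangle \<D> \<E>' s' A (q x) B (q y) C \<delta>"
  using triD[OF assms] tri_arr[OF assms] q_arr D.inverses_Ident[of B] D.comp_Ident_left D.comp_Ident_right
  unfolding tri_quotient_iff[OF assms] by (metis is_arr_q quotient_simps(1))

text \<open>Normal form of a triangle of the quotient: its extension already lives in
  \<open>\<C>\<close> and is realized there between the same end terms, so only the middle term is
  adjusted, by an isomorphism \<open>\<beta>\<close> of the quotient. The equations pass between the
  two sequences in both directions.\<close>

lemma tri_quotientE:
  assumes "E_triangle \<D> \<E>' s' A X B Y C \<delta>"
  obtains x B0 y \<beta> \<beta>' where "tri A x B0 y C \<delta>" "D.inverses B0 B \<beta> \<beta>'"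
    "\<beta> \<cdot>\<^bsub>\<D>\<^esub> q x = X" "Y \<cdot>\<^bsub>\<D>\<^esub> \<beta> = q y" "\<beta>' \<cdot>\<^bsub>\<D>\<^esub> X = q x" "q y \<cdot>\<^bsub>\<D>\<^esub> \<beta>' = Y"
    "D.arr X A B" "D.arr Y B C"
proof -
  have "A \<in> Ob \<C>" "C \<in> Ob \<C>" "\<delta> \<in> carrier (Ext \<E> C A)" using assms by (auto simp: E_triangle_def)
  then obtain x B0 y where T: "tri A x B0 y C \<delta>" using tri_exists by blast
  note t = triD[OF T]
  obtain \<beta> \<beta>' where b: "D.inverses B0 B \<beta> \<beta>'" "\<beta> \<cdot>\<^bsub>\<D>\<^esub> q x = X" "Y \<cdot>\<^bsub>\<D>\<^esub> \<beta> = q y" "D.arr X A B" "D.arr Y B C"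
    using assms unfolding tri_quotient_iff[OF T] by blast
  note u = D.inversesD[OF b(1)] D.arrD[OF b(4)] D.arrD[OF b(5)]
  have "\<beta>' \<cdot>\<^bsub>\<D>\<^esub> X = q x" "q y \<cdot>\<^bsub>\<D>\<^esub> \<beta>' = Y"
    using t u unfolding b(2,3)[symmetric] by (simp_all add: q_simps D.arr_simps)
  then show ?thesis using that T b by blast
qed

section \<open>Realization of morphisms, (ET3) and its dual in the quotient\<close>

lemma Act_quotient_iff:
  assumes "arr a A A'" "arr c C C'" "\<delta> \<in> carrier (Ext \<E> C A)" "\<delta>' \<in> carrier (Ext \<E> C' A')"
  shows "Act \<E>' (Ident \<D> C) (q a) \<delta> = Act \<E>' (q c) (Ident \<D> A') \<delta>' \<longleftrightarrow>
    Act \<E> (Ident \<C> C) a \<delta> = Act \<E> c (Ident \<C> A') \<delta>'"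
  using arrD[OF assms(1)] arrD[OF assms(2)] assms(3,4)
  by (simp add: q_Ident[symmetric] Act_quotient arr_simps)

lemma ext_morphism_quotient_iff:
  assumes "arr a A A'" "arr c C C'" "\<delta> \<in> carrier (Ext \<E> C A)" "\<delta>' \<in> carrier (Ext \<E> C' A')"
  shows "ext_morphism \<D> \<E>' C A \<delta> C' A' \<delta>' (q a) (q c) \<longleftrightarrow>
    Act \<E> (Ident \<C> C) a \<delta> = Act \<E> c (Ident \<C> A') \<delta>'"
  using D.arrD(6)[OF q_arr[OF assms(1)]] D.arrD(6)[OF q_arr[OF assms(2)]] Act_quotient_iff[OF assms]
  by (auto simp: ext_morphism_def push_def pull_def)

text \<open>Representatives of \<open>a\<close> and \<open>c\<close> form a morphism of extensions
  in \<open>\<C>\<close> without any correction, because both categories have the same extensions.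
  Its realization in \<open>\<C>\<close> is then conjugated by the isomorphisms of the middle
  terms.\<close>

lemma realization_quotient: "realization \<D> \<E>' s'"
  unfolding realization_def
proof (intro conjI ballI allI impI)
  fix A C \<delta> assume "A \<in> Ob \<D>" "C \<in> Ob \<D>" "\<delta> \<in> carrier (Ext \<E>' C A)"
  then have o: "A \<in> Ob \<C>" "C \<in> Ob \<C>" "\<delta> \<in> carrier (Ext \<E> C A)" by simp_all
  then obtain x B y where T: "tri A x B y C \<delta>" using tri_exists by blast
  have "(q x, B, q y) \<in> seqs \<D> A C"
    using D.seqs_iff[of A C "q x" B "q y"] o q_arr tri_arr[OF T] by simp
  then show "s' C A \<delta> \<in> seqs \<D> A C // seq_rel \<D> A C"
    by (simp add: s'_class[OF T] seq_class_def quotientI)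
next
  fix A X B Y C \<delta> A' X' B' Y' C' \<delta>' a c
  assume T: "E_triangle \<D> \<E>' s' A X B Y C \<delta>" and T': "E_triangle \<D> \<E>' s' A' X' B' Y' C' \<delta>'"
    and m: "ext_morphism \<D> \<E>' C A \<delta> C' A' \<delta>' a c"
  obtain x B0 y \<beta> \<beta>' where b: "tri A x B0 y C \<delta>" "D.inverses B0 B \<beta> \<beta>'"
    "\<beta> \<cdot>\<^bsub>\<D>\<^esub> q x = X" "Y \<cdot>\<^bsub>\<D>\<^esub> \<beta> = q y" "\<beta>' \<cdot>\<^bsub>\<D>\<^esub> X = q x" "q y \<cdot>\<^bsub>\<D>\<^esub> \<beta>' = Y"
    "D.arr X A B" "D.arr Y B C" using tri_quotientE[OF T] .
  obtain x' B0' y' \<gamma> \<gamma>' where g: "tri A' x' B0' y' C' \<delta>'" "D.inverses B0' B' \<gamma> \<gamma>'"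
    "\<gamma> \<cdot>\<^bsub>\<D>\<^esub> q x' = X'" "Y' \<cdot>\<^bsub>\<D>\<^esub> \<gamma> = q y'" "\<gamma>' \<cdot>\<^bsub>\<D>\<^esub> X' = q x'" "q y' \<cdot>\<^bsub>\<D>\<^esub> \<gamma>' = Y'"
    "D.arr X' A' B'" "D.arr Y' B' C'" using tri_quotientE[OF T'] .
  note t = triD[OF b(1)] triD[OF g(1)]
  have "a \<in> mor \<D> A A'" "c \<in> mor \<D> C C'" using m by (auto simp: ext_morphism_def)
  then obtain a0 c0 where a: "arr a0 A A'" "a = q a0" and c: "arr c0 C C'" "c = q c0"
    using mor_quotient_iff[OF t(8,18)] mor_quotient_iff[OF t(10,20)] by auto
  have "Act \<E> (Ident \<C> C) a0 \<delta> = Act \<E> c0 (Ident \<C> A') \<delta>'"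
    using m ext_morphism_quotient_iff[OF a(1) c(1) t(7,17)] by (simp add: a(2) c(2))
  then obtain b0 where b0: "arr b0 B0 B0'" "b0 \<cdot> x = x' \<cdot> a0" "y' \<cdot> b0 = c0 \<cdot> y"
    using realize_morphism[OF b(1) g(1) a(1) c(1)] by blast
  note u = D.inversesD[OF b(2)] D.inversesD[OF g(2)] arrD[OF a(1)] arrD[OF c(1)] arrD[OF b0(1)]
    D.arrD[OF b(7)] D.arrD[OF b(8)] D.arrD[OF g(7)] D.arrD[OF g(8)]
  have e: "q b0 \<cdot>\<^bsub>\<D>\<^esub> q x = q x' \<cdot>\<^bsub>\<D>\<^esub> q a0" "q y' \<cdot>\<^bsub>\<D>\<^esub> q b0 = q c0 \<cdot>\<^bsub>\<D>\<^esub> q y"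
    using t u b0(2,3) by (simp_all add: q_comp[symmetric])
  let ?b = "\<gamma> \<cdot>\<^bsub>\<D>\<^esub> (q b0 \<cdot>\<^bsub>\<D>\<^esub> \<beta>')"
  have "D.arr ?b B B'" using u t by (simp add: D.arr_iff is_arr_q D.arr_simps)
  moreover have "?b \<cdot>\<^bsub>\<D>\<^esub> X = X' \<cdot>\<^bsub>\<D>\<^esub> a"
    using u t by (simp add: b(5) a(2) is_arr_q D.arr_simps e(1) D.comp_reassoc[OF g(3)])
  moreover have "Y' \<cdot>\<^bsub>\<D>\<^esub> ?b = c \<cdot>\<^bsub>\<D>\<^esub> Y"
    using u t by (simp add: b(6) c(2) is_arr_q D.arr_simps D.comp_reassoc[OF e(2)] D.comp_reassoc[OF g(4)])
  ultimately show "\<exists>b\<in>mor \<D> B B'. b \<cdot>\<^bsub>\<D>\<^esub> X = X' \<cdot>\<^bsub>\<D>\<^esub> a \<and> Y' \<cdot>\<^bsub>\<D>\<^esub> b = c \<cdot>\<^bsub>\<D>\<^esub> Y"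
    using D.arrD(6) by blast
qed

text \<open>The given biproduct belongs to the quotient, so it is first compared with the image of a
  biproduct of \<open>\<C>\<close>.\<close>

lemma split_quotient:
  assumes "A \<in> Ob \<C>" "C \<in> Ob \<C>" "biproduct \<D> A C S"
  shows "s' C A \<one>\<^bsub>Ext \<E> C A\<^esub> = seq_class \<D> A C (In1 S) (Sum S) (Pr2 S)"
proof -
  obtain R where R: "biproduct \<C> A C R" using biproduct_exists assms by blast
  have oD: "A \<in> Ob \<D>" "C \<in> Ob \<D>" using assms by simp_all
  have "((q (In1 R), Sum R, q (Pr2 R)), (In1 S, Sum S, Pr2 S)) \<in> seq_rel \<D> A C"
    using D.biproduct_seq_rel[OF oD biproduct_quotient[OF assms(1,2) R] assms(3)] by simp
  then show ?thesis
    unfolding s'_class[OF tri_split[OF assms(1,2) R]] seq_class_def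
    using equiv_class_eq[OF D.equiv_seq_rel[OF oD]] by blast
qed

text \<open>
  A square commuting in the quotient commutes in \<open>\<C>\<close> up to a morphism through an injective
  object, which is absorbed by changing \<open>b\<close> within its class.
\<close>

lemma complete_right_quotient:
  assumes T: "E_triangle \<D> \<E>' s' A X B Y C \<delta>" and T': "E_triangle \<D> \<E>' s' A' X' B' Y' C' \<delta>'"
    and m: "a \<in> mor \<D> A A'" "b \<in> mor \<D> B B'" "b \<cdot>\<^bsub>\<D>\<^esub> X = X' \<cdot>\<^bsub>\<D>\<^esub> a"
  shows "\<exists>c. ext_morphism \<D> \<E>' C A \<delta> C' A' \<delta>' a c \<and> Y' \<cdot>\<^bsub>\<D>\<^esub> b = c \<cdot>\<^bsub>\<D>\<^esub> Y"
proof -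
  obtain x B0 y \<beta> \<beta>' where b: "tri A x B0 y C \<delta>" "D.inverses B0 B \<beta> \<beta>'"
    "\<beta> \<cdot>\<^bsub>\<D>\<^esub> q x = X" "Y \<cdot>\<^bsub>\<D>\<^esub> \<beta> = q y" "\<beta>' \<cdot>\<^bsub>\<D>\<^esub> X = q x" "q y \<cdot>\<^bsub>\<D>\<^esub> \<beta>' = Y"
    "D.arr X A B" "D.arr Y B C" using tri_quotientE[OF T] .
  obtain x' B0' y' \<gamma> \<gamma>' where g: "tri A' x' B0' y' C' \<delta>'" "D.inverses B0' B' \<gamma> \<gamma>'"
    "\<gamma> \<cdot>\<^bsub>\<D>\<^esub> q x' = X'" "Y' \<cdot>\<^bsub>\<D>\<^esub> \<gamma> = q y'" "\<gamma>' \<cdot>\<^bsub>\<D>\<^esub> X' = q x'" "q y' \<cdot>\<^bsub>\<D>\<^esub> \<gamma>' = Y'"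
    "D.arr X' A' B'" "D.arr Y' B' C'" using tri_quotientE[OF T'] .
  note t = triD[OF b(1)] triD[OF g(1)]
  obtain a0 where a: "arr a0 A A'" "a = q a0" using m(1) mor_quotient_iff[OF t(8,18)] by auto
  note u = D.inversesD[OF b(2)] D.inversesD[OF g(2)] arrD[OF a(1)]
    D.arrD[OF b(7)] D.arrD[OF b(8)] D.arrD[OF g(7)] D.arrD[OF g(8)]
  have bD: "D.arr b B B'" using m(2) u by (simp add: D.arr_def)
  note bD' = D.arrD[OF bD]
  \<comment> \<open>This is \<open>b\<close> carried over to the middle terms of the lifted
    triangles.\<close>
  have "D.arr (\<gamma>' \<cdot>\<^bsub>\<D>\<^esub> (b \<cdot>\<^bsub>\<D>\<^esub> \<beta>)) B0 B0'" using u t bD' by (simp add: D.arr_iff D.arr_simps)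
  then obtain b0 where b0: "arr b0 B0 B0'" "\<gamma>' \<cdot>\<^bsub>\<D>\<^esub> (b \<cdot>\<^bsub>\<D>\<^esub> \<beta>) = q b0" by (rule quotient_arrE)
  note v = arrD[OF b0(1)]
  have sq: "arr (x' \<cdot> a0) A B0'" "arr (b0 \<cdot> x) A B0'" using t u v by (simp_all add: arr_iff arr_simps)
  have "q (b0 \<cdot> x) = q (x' \<cdot> a0)"
    using t u v bD' m(3) D.comp_reassoc[OF g(5)]
    by (simp add: q_comp is_arr_q b0(2)[symmetric] b(3) a(2) D.arr_simps)
  then obtain N f h where n: "N \<in> \<I>" "arr f A N" "arr h N B0'" "x' \<cdot> a0 = b0 \<cdot> x \<oplus> h \<cdot> f"
    using q_eq_iff[OF sq] by auto
  obtain k where k: "arr k B0 N" "k \<cdot> x = f" using extend_injective[OF n(1) b(1) n(2)] .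
  note w = arrD[OF n(2)] arrD[OF n(3)] arrD[OF k(1)]
  let ?b = "b0 \<oplus> h \<cdot> k"
  have b1: "arr ?b B0 B0'" "?b \<cdot> x = x' \<cdot> a0"
    using t v w k(2) n(4) by (simp_all add: arr_iff arr_simps)
  have qb: "q ?b = q b0" unfolding q_eq_iff[OF b1(1) b0(1)] using n k by blast
  obtain c where c: "arr c C C'" "Act \<E> (Ident \<C> C) a0 \<delta> = Act \<E> c (Ident \<C> A') \<delta>'" "y' \<cdot> ?b = c \<cdot> y"
    using complete_right_arr[OF b(1) g(1) a(1) b1] by blast
  note c' = arrD[OF c(1)] arrD[OF b1(1)]
  \<comment> \<open>The corrected morphism and \<open>b0\<close> have the same class, so the square
    found for the former in \<open>\<C>\<close> descends to a square for the latter.\<close>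
  have "q y' \<cdot>\<^bsub>\<D>\<^esub> q b0 = q c \<cdot>\<^bsub>\<D>\<^esub> q y"
    using c(3) c' t v by (simp only: qb[symmetric]) (simp add: q_comp[symmetric])
  then have e: "q y' \<cdot>\<^bsub>\<D>\<^esub> (\<gamma>' \<cdot>\<^bsub>\<D>\<^esub> (b \<cdot>\<^bsub>\<D>\<^esub> \<beta>)) = q c \<cdot>\<^bsub>\<D>\<^esub> q y" by (simp add: b0(2))
  have "Y' \<cdot>\<^bsub>\<D>\<^esub> b = (q y' \<cdot>\<^bsub>\<D>\<^esub> (\<gamma>' \<cdot>\<^bsub>\<D>\<^esub> (b \<cdot>\<^bsub>\<D>\<^esub> \<beta>))) \<cdot>\<^bsub>\<D>\<^esub> \<beta>'"
    using u bD' t D.comp_reassoc[OF g(6)] by (simp add: is_arr_q D.arr_simps)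
  also have "\<dots> = q c \<cdot>\<^bsub>\<D>\<^esub> Y"
    unfolding e using u t c' by (simp add: is_arr_q D.arr_simps b(6))
  finally have "Y' \<cdot>\<^bsub>\<D>\<^esub> b = q c \<cdot>\<^bsub>\<D>\<^esub> Y" .
  moreover have "ext_morphism \<D> \<E>' C A \<delta> C' A' \<delta>' a (q c)"
    unfolding a(2) ext_morphism_quotient_iff[OF a(1) c(1) t(7,17)] by (rule c(2))
  ultimately show ?thesis by blast
qed

text \<open>Here the error \<open>h f\<close> occurs in the right-hand square and ends at
  \<open>C'\<close>. As \<open>N\<close> is projective, \<open>h\<close> lifts along
  \<open>y'\<close> to some \<open>k\<close>, and adding \<open>k f\<close> to \<open>b0\<close>
  makes the square commute in \<open>\<C>\<close> without changing the class.\<close>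

lemma complete_left_quotient:
  assumes T: "E_triangle \<D> \<E>' s' A X B Y C \<delta>" and T': "E_triangle \<D> \<E>' s' A' X' B' Y' C' \<delta>'"
    and m: "b \<in> mor \<D> B B'" "c \<in> mor \<D> C C'" "Y' \<cdot>\<^bsub>\<D>\<^esub> b = c \<cdot>\<^bsub>\<D>\<^esub> Y"
  shows "\<exists>a. ext_morphism \<D> \<E>' C A \<delta> C' A' \<delta>' a c \<and> b \<cdot>\<^bsub>\<D>\<^esub> X = X' \<cdot>\<^bsub>\<D>\<^esub> a"
proof -
  obtain x B0 y \<beta> \<beta>' where b: "tri A x B0 y C \<delta>" "D.inverses B0 B \<beta> \<beta>'"
    "\<beta> \<cdot>\<^bsub>\<D>\<^esub> q x = X" "Y \<cdot>\<^bsub>\<D>\<^esub> \<beta> = q y" "\<beta>' \<cdot>\<^bsub>\<D>\<^esub> X = q x" "q y \<cdot>\<^bsub>\<D>\<^esub> \<beta>' = Y"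
    "D.arr X A B" "D.arr Y B C" using tri_quotientE[OF T] .
  obtain x' B0' y' \<gamma> \<gamma>' where g: "tri A' x' B0' y' C' \<delta>'" "D.inverses B0' B' \<gamma> \<gamma>'"
    "\<gamma> \<cdot>\<^bsub>\<D>\<^esub> q x' = X'" "Y' \<cdot>\<^bsub>\<D>\<^esub> \<gamma> = q y'" "\<gamma>' \<cdot>\<^bsub>\<D>\<^esub> X' = q x'" "q y' \<cdot>\<^bsub>\<D>\<^esub> \<gamma>' = Y'"
    "D.arr X' A' B'" "D.arr Y' B' C'" using tri_quotientE[OF T'] .
  note t = triD[OF b(1)] triD[OF g(1)]
  obtain c0 where c: "arr c0 C C'" "c = q c0" using m(2) mor_quotient_iff[OF t(10,20)] by auto
  note u = D.inversesD[OF b(2)] D.inversesD[OF g(2)] arrD[OF c(1)]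
    D.arrD[OF b(7)] D.arrD[OF b(8)] D.arrD[OF g(7)] D.arrD[OF g(8)]
  have bD: "D.arr b B B'" using m(1) u by (simp add: D.arr_def)
  note bD' = D.arrD[OF bD]
  have "D.arr (\<gamma>' \<cdot>\<^bsub>\<D>\<^esub> (b \<cdot>\<^bsub>\<D>\<^esub> \<beta>)) B0 B0'" using u t bD' by (simp add: D.arr_iff D.arr_simps)
  then obtain b0 where b0: "arr b0 B0 B0'" "\<gamma>' \<cdot>\<^bsub>\<D>\<^esub> (b \<cdot>\<^bsub>\<D>\<^esub> \<beta>) = q b0" by (rule quotient_arrE)
  note v = arrD[OF b0(1)]
  have sq: "arr (c0 \<cdot> y) B0 C'" "arr (y' \<cdot> b0) B0 C'" using t u v by (simp_all add: arr_iff arr_simps)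
  have "q (y' \<cdot> b0) = q (c0 \<cdot> y)"
    using t u v bD' D.comp_reassoc[OF g(6)] D.comp_reassoc[OF m(3)]
    by (simp add: q_comp is_arr_q b0(2)[symmetric] b(4) c(2) D.arr_simps)
  then obtain N f h where n: "N \<in> \<I>" "arr f B0 N" "arr h N C'" "c0 \<cdot> y = y' \<cdot> b0 \<oplus> h \<cdot> f"
    using q_eq_iff[OF sq] by auto
  obtain k where k: "arr k N B0'" "y' \<cdot> k = h" using lift_projective[OF n(1) g(1) n(3)] .
  note w = arrD[OF n(2)] arrD[OF n(3)] arrD[OF k(1)]
  let ?b = "b0 \<oplus> k \<cdot> f"
  have b1: "arr ?b B0 B0'" "y' \<cdot> ?b = c0 \<cdot> y"
    using t v w n(4) comp_reassoc[OF k(2)] by (simp_all add: arr_iff arr_simps)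
  have qb: "q ?b = q b0" unfolding q_eq_iff[OF b1(1) b0(1)] using n k by blast
  obtain a where a: "arr a A A'" "Act \<E> (Ident \<C> C) a \<delta> = Act \<E> c0 (Ident \<C> A') \<delta>'" "?b \<cdot> x = x' \<cdot> a"
    using complete_left_arr[OF b(1) g(1) b1(1) c(1) b1(2)] by blast
  note a' = arrD[OF a(1)] arrD[OF b1(1)]
  have "q b0 \<cdot>\<^bsub>\<D>\<^esub> q x = q x' \<cdot>\<^bsub>\<D>\<^esub> q a"
    using a(3) a' t v by (simp only: qb[symmetric]) (simp add: q_comp[symmetric])
  then have e: "(\<gamma>' \<cdot>\<^bsub>\<D>\<^esub> (b \<cdot>\<^bsub>\<D>\<^esub> \<beta>)) \<cdot>\<^bsub>\<D>\<^esub> q x = q x' \<cdot>\<^bsub>\<D>\<^esub> q a" by (simp add: b0(2))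
  have "b \<cdot>\<^bsub>\<D>\<^esub> X = \<gamma> \<cdot>\<^bsub>\<D>\<^esub> ((\<gamma>' \<cdot>\<^bsub>\<D>\<^esub> (b \<cdot>\<^bsub>\<D>\<^esub> \<beta>)) \<cdot>\<^bsub>\<D>\<^esub> q x)"
    using u bD' t by (simp add: is_arr_q D.arr_simps b(3))
  also have "\<dots> = X' \<cdot>\<^bsub>\<D>\<^esub> q a"
    unfolding e using u t a' D.comp_reassoc[OF g(3)] by (simp add: is_arr_q D.arr_simps)
  finally have "b \<cdot>\<^bsub>\<D>\<^esub> X = X' \<cdot>\<^bsub>\<D>\<^esub> q a" .
  moreover have "ext_morphism \<D> \<E>' C A \<delta> C' A' \<delta>' (q a) c"
    unfolding c(2) ext_morphism_quotient_iff[OF a(1) c(1) t(7,17)] by (rule a(2))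
  ultimately show ?thesis by blast
qed

sublocale D: pre_extriangulated \<D> \<E>' s'
proof
  show "realization \<D> \<E>' s'" by (rule realization_quotient)
  show "s' C A \<one>\<^bsub>Ext \<E>' C A\<^esub> = seq_class \<D> A C (In1 S) (Sum S) (Pr2 S)"
    if "A \<in> Ob \<D>" "C \<in> Ob \<D>" "biproduct \<D> A C S" for A C S
    using split_quotient that by simp
qed (fact complete_right_quotient complete_left_quotient)+

section \<open>Direct sums and octahedra in the quotient\<close>

lemma is_ext_sum_D:
  assumes "is_ext_sum \<E>' C A \<delta> C' A' \<delta>' U S \<epsilon>"
  shows "\<epsilon> \<in> carrier (Ext \<E> (Sum U) (Sum S))"
    "Act \<E>' (In1 U) (Pr1 S) \<epsilon> = \<delta>" "Act \<E>' (In1 U) (Pr2 S) \<epsilon> = \<one>\<^bsub>Ext \<E> C A'\<^esub>"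
    "Act \<E>' (In2 U) (Pr1 S) \<epsilon> = \<one>\<^bsub>Ext \<E> C' A\<^esub>" "Act \<E>' (In2 U) (Pr2 S) \<epsilon> = \<delta>'"
  using assms by (auto simp: is_ext_sum_def)

text \<open>
  Direct sums of triangles are taken in \<open>\<C>\<close> and transported along isomorphisms of the quotient,
  which need not come from isomorphisms of \<open>\<C>\<close>.
\<close>

lemma sum_quotient:
  assumes T: "E_triangle \<D> \<E>' s' A X B Y C \<delta>" and T': "E_triangle \<D> \<E>' s' A' X' B' Y' C' \<delta>'"
    and S: "biproduct \<D> A A' S" and R: "biproduct \<D> B B' R" and U: "biproduct \<D> C C' U"
    and \<epsilon>: "is_ext_sum \<E>' C A \<delta> C' A' \<delta>' U S \<epsilon>"
  shows "s' (Sum U) (Sum S) \<epsilon> =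
    seq_class \<D> (Sum S) (Sum U) (dsum_mor \<D> S R X X') (Sum R) (dsum_mor \<D> R U Y Y')"
proof -
  obtain x B0 y \<beta> \<beta>' where b: "tri A x B0 y C \<delta>" "D.inverses B0 B \<beta> \<beta>'"
    "\<beta> \<cdot>\<^bsub>\<D>\<^esub> q x = X" "Y \<cdot>\<^bsub>\<D>\<^esub> \<beta> = q y" "\<beta>' \<cdot>\<^bsub>\<D>\<^esub> X = q x" "q y \<cdot>\<^bsub>\<D>\<^esub> \<beta>' = Y"
    "D.arr X A B" "D.arr Y B C" using tri_quotientE[OF T] .
  obtain x' B0' y' \<gamma> \<gamma>' where g: "tri A' x' B0' y' C' \<delta>'" "D.inverses B0' B' \<gamma> \<gamma>'"
    "\<gamma> \<cdot>\<^bsub>\<D>\<^esub> q x' = X'" "Y' \<cdot>\<^bsub>\<D>\<^esub> \<gamma> = q y'" "\<gamma>' \<cdot>\<^bsub>\<D>\<^esub> X' = q x'" "q y' \<cdot>\<^bsub>\<D>\<^esub> \<gamma>' = Y'"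
    "D.arr X' A' B'" "D.arr Y' B' C'" using tri_quotientE[OF T'] .
  note t = triD[OF b(1)] triD[OF g(1)]
  have o: "A \<in> Ob \<C>" "A' \<in> Ob \<C>" "B0 \<in> Ob \<C>" "B0' \<in> Ob \<C>" "C \<in> Ob \<C>" "C' \<in> Ob \<C>" using t by auto
  have oD: "A \<in> Ob \<D>" "A' \<in> Ob \<D>" "B0 \<in> Ob \<D>" "B0' \<in> Ob \<D>" "C \<in> Ob \<D>" "C' \<in> Ob \<D>" "B \<in> Ob \<D>" "B' \<in> Ob \<D>"
    using t D.arrD(4)[OF b(8)] D.arrD(4)[OF g(8)] by auto
  obtain S0 R0 U0 where S0: "biproduct \<C> A A' S0" and R0: "biproduct \<C> B0 B0' R0" and U0: "biproduct \<C> C C' U0"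
    using biproduct_exists o by meson
  let ?S = "map_biprod q S0" and ?R = "map_biprod q R0" and ?U = "map_biprod q U0"
  note qS = biproduct_quotient[OF o(1,2) S0] and qR = biproduct_quotient[OF o(3,4) R0]
    and qU = biproduct_quotient[OF o(5,6) U0]
  let ?id = "Ident \<D>"
  \<comment> \<open>\<open>\<sigma>\<close> and \<open>\<upsilon>\<close> compare the images of
    biproducts of \<open>\<C>\<close> with the given biproducts of the quotient.\<close>
  define \<sigma> where "\<sigma> = dsum_mor \<D> ?S S (?id A) (?id A')"
  define \<sigma>' where "\<sigma>' = dsum_mor \<D> S ?S (?id A) (?id A')"
  define \<upsilon> where "\<upsilon> = dsum_mor \<D> ?U U (?id C) (?id C')"
  define \<upsilon>' where "\<upsilon>' = dsum_mor \<D> U ?U (?id C) (?id C')"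
  note idA = D.inverses_Ident[OF oD(1)] D.inverses_Ident[OF oD(2)]
    and idC = D.inverses_Ident[OF oD(5)] D.inverses_Ident[OF oD(6)]
  have ida: "D.arr (?id A) A A" "D.arr (?id A') A' A'" "D.arr (?id C) C C" "D.arr (?id C') C' C'"
    using idA idC by (auto simp: D.inverses_def)
  have \<sigma>: "D.inverses (Sum S0) (Sum S) \<sigma> \<sigma>'"
    using D.dsum_mor_inverses[OF oD(1,2,1,2) qS S idA] by (simp add: \<sigma>_def \<sigma>'_def)
  have \<upsilon>: "D.inverses (Sum U0) (Sum U) \<upsilon> \<upsilon>'"
    using D.dsum_mor_inverses[OF oD(5,6,5,6) qU U idC] by (simp add: \<upsilon>_def \<upsilon>'_def)
  note iso = D.inversesD[OF \<sigma>] D.inversesD[OF \<upsilon>]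
  note bS = biproductD[OF o(1,2) S0] and bU = biproductD[OF o(5,6) U0]
    and dS = D.biproductD[OF oD(1,2) S] and dU = D.biproductD[OF oD(5,6) U]
  have In: "\<upsilon> \<cdot>\<^bsub>\<D>\<^esub> q (In1 U0) = In1 U" "\<upsilon> \<cdot>\<^bsub>\<D>\<^esub> q (In2 U0) = In2 U"
    using D.dsum_mor_In_Pr(1,2)[OF oD(5,6,5,6) qU U ida(3,4)] dU
    by (simp_all add: \<upsilon>_def D.comp_Ident_right)
  have Pr: "q (Pr1 S0) \<cdot>\<^bsub>\<D>\<^esub> \<sigma>' = Pr1 S" "q (Pr2 S0) \<cdot>\<^bsub>\<D>\<^esub> \<sigma>' = Pr2 S"
    using D.dsum_mor_In_Pr(3,4)[OF oD(1,2,1,2) S qS ida(1,2)] dS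
    by (simp_all add: \<sigma>'_def D.comp_Ident_left)
  \<comment> \<open>The extension \<open>\<epsilon>\<close> moved to the biproducts chosen in
    \<open>\<C>\<close>. By \<open>In\<close> and \<open>Pr\<close> its four components are those of
    \<open>\<epsilon>\<close>, so additivity of \<open>s\<close> applies to it.\<close>
  define \<epsilon>0 where "\<epsilon>0 = Act \<E>' \<upsilon> \<sigma>' \<epsilon>"
  note e = is_ext_sum_D[OF \<epsilon>]
  have \<epsilon>0: "\<epsilon>0 \<in> carrier (Ext \<E> (Sum U0) (Sum S0))"
    using D.Act_closed[of \<upsilon> \<sigma>' \<epsilon> "Sum U0" "Sum S0"] iso e(1) by (simp add: \<epsilon>0_def)
  have act: "Act \<E> i p \<epsilon>0 = Act \<E>' (\<upsilon> \<cdot>\<^bsub>\<D>\<^esub> q i) (q p \<cdot>\<^bsub>\<D>\<^esub> \<sigma>') \<epsilon>"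
    if "is_arr i" "cd i = Sum U0" "is_arr p" "dm p = Sum S0" for i p
  proof -
    have "Act \<E> i p \<epsilon>0 = Act \<E>' (q i) (q p) \<epsilon>0" using that \<epsilon>0 by (simp add: Act_quotient)
    also have "\<dots> = Act \<E>' (\<upsilon> \<cdot>\<^bsub>\<D>\<^esub> q i) (q p \<cdot>\<^bsub>\<D>\<^esub> \<sigma>') \<epsilon>"
      unfolding \<epsilon>0_def using that iso e(1) by (intro D.Act_Act) (simp_all add: is_arr_q)
    finally show ?thesis .
  qed
  have "is_ext_sum \<E> C A \<delta> C' A' \<delta>' U0 S0 \<epsilon>0"
    unfolding is_ext_sum_def using \<epsilon>0 bS bU by (simp add: act In Pr e)
  then have cl: "s (Sum U0) (Sum S0) \<epsilon>0 =
      seq_class \<C> (Sum S0) (Sum U0) (dsum_mor \<C> S0 R0 x x') (Sum R0) (dsum_mor \<C> R0 U0 y y')"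
    by (rule ET2[unfolded additive_realization_def, THEN conjunct2, THEN conjunct2, rule_format,
      OF b(1) g(1) S0 R0 U0])
  note dx = dsum_mor_eq(2)[OF o(1-4) S0 R0 tri_arr(1)[OF b(1)] tri_arr(1)[OF g(1)]]
    and dy = dsum_mor_eq(2)[OF o(3-6) R0 U0 tri_arr(2)[OF b(1)] tri_arr(2)[OF g(1)]]
  have "tri (Sum S0) (dsum_mor \<C> S0 R0 x x') (Sum R0) (dsum_mor \<C> R0 U0 y y') (Sum U0) \<epsilon>0"
    unfolding E_triangle_def cl seq_class_def
    using \<epsilon>0 bS bU equiv_class_self[OF equiv_seq_rel] seqs_iff dx dy by simp
  note T0 = tri_quotientI[OF this]
  let ?dx = "dsum_mor \<D> ?S ?R (q x) (q x')" and ?dy = "dsum_mor \<D> ?R ?U (q y) (q y')"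
  have T1: "D.tri (Sum S0) ?dx (Sum R0) ?dy (Sum U0) \<epsilon>0"
    using T0 dsum_mor_quotient[OF o(1-4) S0 R0 tri_arr(1)[OF b(1)] tri_arr(1)[OF g(1)]]
      dsum_mor_quotient[OF o(3-6) R0 U0 tri_arr(2)[OF b(1)] tri_arr(2)[OF g(1)]] by simp
  have "Act \<E>' \<upsilon>' \<sigma> \<epsilon>0 = Act \<E>' (\<upsilon> \<cdot>\<^bsub>\<D>\<^esub> \<upsilon>') (\<sigma> \<cdot>\<^bsub>\<D>\<^esub> \<sigma>') \<epsilon>"
    unfolding \<epsilon>0_def using iso e(1) by (intro D.Act_Act) simp_all
  \<comment> \<open>Moving back recovers \<open>\<epsilon>\<close>, and the triangle found in
    \<open>\<C>\<close> goes back with it.\<close>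
  then have "Act \<E>' \<upsilon>' \<sigma> \<epsilon>0 = \<epsilon>" using iso e(1) D.Act_Ident by simp
  then have T2: "D.tri (Sum S) (?dx \<cdot>\<^bsub>\<D>\<^esub> \<sigma>') (Sum R0) (\<upsilon> \<cdot>\<^bsub>\<D>\<^esub> ?dy) (Sum U) \<epsilon>"
    using D.tri_iso_ends[OF T1 \<sigma> \<upsilon>] by simp
  \<comment> \<open>A single middle isomorphism absorbs two discrepancies: that between the lifted
    and the given triangles, through \<open>\<beta>\<close> and \<open>\<gamma>\<close>, and that
    between the biproducts \<open>?R\<close> and \<open>R\<close>.\<close>
  let ?\<theta> = "dsum_mor \<D> ?R R \<beta> \<gamma>" and ?\<theta>' = "dsum_mor \<D> R ?R \<beta>' \<gamma>'"
  have "D.inverses (Sum R0) (Sum R) ?\<theta> ?\<theta>'"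
    using D.dsum_mor_inverses[OF oD(3,4,7,8) qR R b(2) g(2)] by simp
  note T3 = D.tri_iso_middle[OF T2 this]
  note qa = q_arr[OF tri_arr(1)[OF b(1)]] q_arr[OF tri_arr(1)[OF g(1)]]
    q_arr[OF tri_arr(2)[OF b(1)]] q_arr[OF tri_arr(2)[OF g(1)]]
  have ba: "D.arr \<beta> B0 B" "D.arr \<gamma> B0' B'" "D.arr \<beta>' B B0" "D.arr \<gamma>' B' B0'"
    using b(2) g(2) by (auto simp: D.inverses_def)
  have id_comp: "q x \<cdot>\<^bsub>\<D>\<^esub> ?id A = q x" "q x' \<cdot>\<^bsub>\<D>\<^esub> ?id A' = q x'"
    "?id C \<cdot>\<^bsub>\<D>\<^esub> Y = Y" "?id C' \<cdot>\<^bsub>\<D>\<^esub> Y' = Y'"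
    using t D.arrD[OF b(8)] D.arrD[OF g(8)] by (simp_all add: is_arr_q D.comp_Ident_left D.comp_Ident_right)
  have "?dx \<cdot>\<^bsub>\<D>\<^esub> \<sigma>' = dsum_mor \<D> S ?R (q x) (q x')"
    unfolding \<sigma>'_def D.dsum_mor_comp[OF oD(1,2,1,2,3,4) S qS qR ida(1,2) qa(1,2)] id_comp ..
  then have ex: "?\<theta> \<cdot>\<^bsub>\<D>\<^esub> (?dx \<cdot>\<^bsub>\<D>\<^esub> \<sigma>') = dsum_mor \<D> S R X X'"
    using D.dsum_mor_comp[OF oD(1,2,3,4,7,8) S qR R qa(1,2) ba(1,2)] by (simp add: b(3) g(3))
  have arrs: "D.arr \<upsilon> (Sum U0) (Sum U)" "D.arr ?dy (Sum R0) (Sum U0)" "D.arr ?\<theta>' (Sum R) (Sum R0)"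
    using D.dsum_mor_eq(2)[OF oD(5,6,5,6) qU U ida(3,4)] D.dsum_mor_eq(2)[OF oD(3-6) qR qU qa(3,4)]
      D.dsum_mor_eq(2)[OF oD(7,8,3,4) R qR ba(3,4)] by (simp_all add: \<upsilon>_def)
  note ad = D.arrD[OF arrs(1)] D.arrD[OF arrs(2)] D.arrD[OF arrs(3)]
  have "?dy \<cdot>\<^bsub>\<D>\<^esub> ?\<theta>' = dsum_mor \<D> R ?U Y Y'"
    unfolding D.dsum_mor_comp[OF oD(7,8,3-6) R qR qU ba(3,4) qa(3,4)] b(6) g(6) ..
  then have ey: "(\<upsilon> \<cdot>\<^bsub>\<D>\<^esub> ?dy) \<cdot>\<^bsub>\<D>\<^esub> ?\<theta>' = dsum_mor \<D> R U Y Y'"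
    using ad D.dsum_mor_comp[OF oD(7,8,5,6,5,6) R qU U b(8) g(8) ida(3,4)]
    by (simp add: D.comp_assoc \<upsilon>_def id_comp)
  show ?thesis using D.tri_class[OF T3] unfolding ex ey .
qed

text \<open>The lift of the first triangle ends its inflation at \<open>B0\<close>, whereas the
  second triangle starts at \<open>B\<close>. So the second one is made to start at
  \<open>B0\<close> before it is lifted. The two lifts are then composable in \<open>\<C>\<close>,
  and the octahedron obtained there is transported back by \<open>\<beta>\<close> and
  \<open>\<gamma>\<close>.\<close>

lemma octahedron_quotient:
  assumes T: "D.tri A F B F' D \<delta>" and T': "D.tri B G C G' K \<delta>'"
  shows "\<exists>E H H' \<delta>'' d e. D.tri A H C H' E \<delta>'' \<and> H = G \<cdot>\<^bsub>\<D>\<^esub> F \<and>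
    d \<in> mor \<D> D E \<and> e \<in> mor \<D> E K \<and> d \<cdot>\<^bsub>\<D>\<^esub> F' = H' \<cdot>\<^bsub>\<D>\<^esub> G \<and> e \<cdot>\<^bsub>\<D>\<^esub> H' = G' \<and>
    D.tri D d E e K (push \<D> \<E>' K F' \<delta>') \<and> pull \<D> \<E>' A d \<delta>'' = \<delta> \<and>
    push \<D> \<E>' E F \<delta>'' = pull \<D> \<E>' B e \<delta>'"
proof -
  obtain f B0 f' \<beta> \<beta>' where b: "tri A f B0 f' D \<delta>" "D.inverses B0 B \<beta> \<beta>'"
    "\<beta> \<cdot>\<^bsub>\<D>\<^esub> q f = F" "F' \<cdot>\<^bsub>\<D>\<^esub> \<beta> = q f'" "\<beta>' \<cdot>\<^bsub>\<D>\<^esub> F = q f" "q f' \<cdot>\<^bsub>\<D>\<^esub> \<beta>' = F'"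
    "D.arr F A B" "D.arr F' B D" using tri_quotientE[OF T] .
  note T'D = D.triD[OF T']
  \<comment> \<open>The extension of the second triangle pushed from \<open>B\<close> to
    \<open>B0\<close>. That \<open>G \<beta>\<close> followed by \<open>G'\<close> realizes it is
    \<open>tri_iso_ends\<close> in the quotient.\<close>
  let ?\<delta>' = "Act \<E>' (Ident \<D> K) \<beta>' \<delta>'"
  have T1: "D.tri B0 (G \<cdot>\<^bsub>\<D>\<^esub> \<beta>) C (Ident \<D> K \<cdot>\<^bsub>\<D>\<^esub> G') K ?\<delta>'"
    using D.tri_iso_ends[OF T' D.inverses_sym[OF b(2)] D.inverses_Ident[OF T'D(10)]] .
  have "Ident \<D> K \<cdot>\<^bsub>\<D>\<^esub> G' = G'" using T'D by (simp add: D.comp_Ident_left)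
  note T1 = T1[unfolded this]
  obtain g C0 g' \<gamma> \<gamma>' where g: "tri B0 g C0 g' K ?\<delta>'" "D.inverses C0 C \<gamma> \<gamma>'"
    "\<gamma> \<cdot>\<^bsub>\<D>\<^esub> q g = G \<cdot>\<^bsub>\<D>\<^esub> \<beta>" "G' \<cdot>\<^bsub>\<D>\<^esub> \<gamma> = q g'" "\<gamma>' \<cdot>\<^bsub>\<D>\<^esub> (G \<cdot>\<^bsub>\<D>\<^esub> \<beta>) = q g" "q g' \<cdot>\<^bsub>\<D>\<^esub> \<gamma>' = G'"
    using tri_quotientE[OF T1] .
  obtain E h h' \<delta>'' d e where o: "tri A h C0 h' E \<delta>''" "h = g \<cdot> f" "d \<in> mor \<C> D E" "e \<in> mor \<C> E K"
    "d \<cdot> f' = h' \<cdot> g" "e \<cdot> h' = g'" "tri D d E e K (push \<C> \<E> K f' ?\<delta>')"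
    "pull \<C> \<E> A d \<delta>'' = \<delta>" "push \<C> \<E> E f \<delta>'' = pull \<C> \<E> B0 e ?\<delta>'"
    using ET4[OF b(1) g(1)] by blast
  note t = triD[OF b(1)] triD[OF g(1)] triD[OF o(1)] triD[OF o(7)]
    D.inversesD[OF b(2)] D.inversesD[OF g(2)] T'D D.arrD[OF b(7)] D.arrD[OF b(8)]
  have qe: "q d \<cdot>\<^bsub>\<D>\<^esub> q f' = q h' \<cdot>\<^bsub>\<D>\<^esub> q g" "q e \<cdot>\<^bsub>\<D>\<^esub> q h' = q g'"
    using t o(5,6) by (simp_all add: q_comp[symmetric])
  have gg: "q g \<cdot>\<^bsub>\<D>\<^esub> \<beta>' = \<gamma>' \<cdot>\<^bsub>\<D>\<^esub> G" unfolding g(5)[symmetric] using t by (simp add: D.arr_simps)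
  have 1: "D.tri A (\<gamma> \<cdot>\<^bsub>\<D>\<^esub> q h) C (q h' \<cdot>\<^bsub>\<D>\<^esub> \<gamma>') E \<delta>''"
    using D.tri_iso_middle[OF tri_quotientI[OF o(1)] g(2)] .
  have 2: "\<gamma> \<cdot>\<^bsub>\<D>\<^esub> q h = G \<cdot>\<^bsub>\<D>\<^esub> F"
  proof -
    have "\<gamma> \<cdot>\<^bsub>\<D>\<^esub> q h = (\<gamma> \<cdot>\<^bsub>\<D>\<^esub> q g) \<cdot>\<^bsub>\<D>\<^esub> q f" using t by (simp add: o(2) q_comp is_arr_q D.comp_assoc)
    also have "\<dots> = G \<cdot>\<^bsub>\<D>\<^esub> F" unfolding g(3) using t by (simp add: b(3) is_arr_q D.comp_assoc)
    finally show ?thesis .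
  qed
  have 3: "q d \<cdot>\<^bsub>\<D>\<^esub> F' = (q h' \<cdot>\<^bsub>\<D>\<^esub> \<gamma>') \<cdot>\<^bsub>\<D>\<^esub> G"
  proof -
    have "q d \<cdot>\<^bsub>\<D>\<^esub> F' = (q d \<cdot>\<^bsub>\<D>\<^esub> q f') \<cdot>\<^bsub>\<D>\<^esub> \<beta>'" using t by (simp add: b(6) is_arr_q D.comp_assoc)
    also have "\<dots> = (q h' \<cdot>\<^bsub>\<D>\<^esub> \<gamma>') \<cdot>\<^bsub>\<D>\<^esub> G" unfolding qe using t by (simp add: gg is_arr_q D.comp_assoc)
    finally show ?thesis .
  qed
  have 4: "q e \<cdot>\<^bsub>\<D>\<^esub> (q h' \<cdot>\<^bsub>\<D>\<^esub> \<gamma>') = G'"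
    using t by (simp add: D.comp_reassoc[OF qe(2)] is_arr_q g(6))
  have c1: "Act \<E>' (Ident \<D> K) (q f') ?\<delta>' = Act \<E>' (Ident \<D> K) F' \<delta>'"
    using t by (simp add: is_arr_q D.Act_Act D.is_arr_Ident D.comp_Ident_left b(6))
  have "push \<C> \<E> K f' ?\<delta>' = Act \<E>' (Ident \<D> K) (q f') ?\<delta>'"
    using t by (simp add: push_def q_Ident[symmetric] Act_quotient is_arr_Ident)
  then have 5: "D.tri D (q d) E (q e) K (push \<D> \<E>' K F' \<delta>')"
    using tri_quotientI[OF o(7)] c1 by (simp add: push_def)
  have 6: "pull \<D> \<E>' A (q d) \<delta>'' = \<delta>"
    using t o(8) by (simp add: pull_def q_Ident[symmetric] Act_quotient is_arr_Ident)
  \<comment> \<open>Since \<open>F\<close> is \<open>\<beta>\<close> after the class of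
    \<open>f\<close>, the relation known over \<open>B0\<close> can be pushed along
    \<open>\<beta>\<close>, which undoes the earlier push along \<open>\<beta>'\<close>.\<close>
  have "Act \<E>' (Ident \<D> E) F \<delta>'' = Act \<E>' (Ident \<D> E) \<beta> (Act \<E>' (Ident \<D> E) (q f) \<delta>'')"
    using t by (simp add: is_arr_q D.Act_Act D.is_arr_Ident D.comp_Ident_left b(3))
  also have "Act \<E>' (Ident \<D> E) (q f) \<delta>'' = Act \<E>' (q e) (Ident \<D> B0) ?\<delta>'"
    using t o(9) by (simp add: push_def pull_def q_Ident[symmetric] Act_quotient is_arr_Ident)
  also have "Act \<E>' (Ident \<D> E) \<beta> \<dots> = Act \<E>' (q e) (Ident \<D> B) \<delta>'"
    using t by (simp add: is_arr_q D.Act_Act D.Act_closed D.is_arr_Ident D.is_arr_comp D.comp_Ident_left D.comp_Ident_right)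
  finally have 7: "push \<D> \<E>' E F \<delta>'' = pull \<D> \<E>' B (q e) \<delta>'" by (simp add: push_def pull_def)
  have "q d \<in> mor \<D> D E" "q e \<in> mor \<D> E K"
    using D.arrD(6) q_arr tri_arr[OF o(7)] by blast+
  then show ?thesis using 1 2 3 4 5 6 7 by blast
qed

text \<open>Here the second triangle is lifted first, and the first one, whose deflation ends at
  \<open>B\<close>, is made to end at \<open>B0\<close> by pulling its extension back along
  \<open>\<beta>\<close>.\<close>

lemma octahedron_op_quotient:
  assumes T: "D.tri D F' A F B \<delta>" and T': "D.tri K G' B G C \<delta>'"
  shows "\<exists>E H H' \<delta>'' d e. D.tri E H' A H C \<delta>'' \<and> H = G \<cdot>\<^bsub>\<D>\<^esub> F \<and>
    d \<in> mor \<D> D E \<and> e \<in> mor \<D> E K \<and> H' \<cdot>\<^bsub>\<D>\<^esub> d = F' \<and> F \<cdot>\<^bsub>\<D>\<^esub> H' = G' \<cdot>\<^bsub>\<D>\<^esub> e \<and>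
    D.tri D d E e K (pull \<D> \<E>' D G' \<delta>) \<and> \<delta>' = push \<D> \<E>' C e \<delta>'' \<and>
    push \<D> \<E>' B d \<delta> = pull \<D> \<E>' E G \<delta>''"
proof -
  obtain g' B0 g \<beta> \<beta>' where b: "tri K g' B0 g C \<delta>'" "D.inverses B0 B \<beta> \<beta>'"
    "\<beta> \<cdot>\<^bsub>\<D>\<^esub> q g' = G'" "G \<cdot>\<^bsub>\<D>\<^esub> \<beta> = q g" "\<beta>' \<cdot>\<^bsub>\<D>\<^esub> G' = q g'" "q g \<cdot>\<^bsub>\<D>\<^esub> \<beta>' = G"
    "D.arr G' K B" "D.arr G B C" using tri_quotientE[OF T'] .
  note TD = D.triD[OF T]
  let ?\<delta> = "Act \<E>' \<beta> (Ident \<D> D) \<delta>"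
  have T1: "D.tri D (F' \<cdot>\<^bsub>\<D>\<^esub> Ident \<D> D) A (\<beta>' \<cdot>\<^bsub>\<D>\<^esub> F) B0 ?\<delta>"
    using D.tri_iso_ends[OF T D.inverses_Ident[OF TD(8)] D.inverses_sym[OF b(2)]] .
  have "F' \<cdot>\<^bsub>\<D>\<^esub> Ident \<D> D = F'" using TD by (simp add: D.comp_Ident_right)
  note T1 = T1[unfolded this]
  obtain f' A0 f \<gamma> \<gamma>' where g: "tri D f' A0 f B0 ?\<delta>" "D.inverses A0 A \<gamma> \<gamma>'"
    "\<gamma> \<cdot>\<^bsub>\<D>\<^esub> q f' = F'" "(\<beta>' \<cdot>\<^bsub>\<D>\<^esub> F) \<cdot>\<^bsub>\<D>\<^esub> \<gamma> = q f" "\<gamma>' \<cdot>\<^bsub>\<D>\<^esub> F' = q f'" "q f \<cdot>\<^bsub>\<D>\<^esub> \<gamma>' = \<beta>' \<cdot>\<^bsub>\<D>\<^esub> F"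
    using tri_quotientE[OF T1] .
  obtain E h h' \<delta>'' d e where o: "tri E h' A0 h C \<delta>''" "h = g \<cdot> f" "d \<in> mor \<C> D E" "e \<in> mor \<C> E K"
    "h' \<cdot> d = f'" "f \<cdot> h' = g' \<cdot> e" "tri D d E e K (pull \<C> \<E> D g' ?\<delta>)"
    "\<delta>' = push \<C> \<E> C e \<delta>''" "push \<C> \<E> B0 d ?\<delta> = pull \<C> \<E> E g \<delta>''"
    using ET4_op[OF g(1) b(1)] by blast
  note t = triD[OF b(1)] triD[OF g(1)] triD[OF o(1)] triD[OF o(7)]
    D.inversesD[OF b(2)] D.inversesD[OF g(2)] TD D.arrD[OF b(7)] D.arrD[OF b(8)]
  have qe: "q h' \<cdot>\<^bsub>\<D>\<^esub> q d = q f'" "q f \<cdot>\<^bsub>\<D>\<^esub> q h' = q g' \<cdot>\<^bsub>\<D>\<^esub> q e"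
    using t o(5,6) by (simp_all add: q_comp[symmetric])
  have ff: "\<beta> \<cdot>\<^bsub>\<D>\<^esub> q f = F \<cdot>\<^bsub>\<D>\<^esub> \<gamma>" unfolding g(4)[symmetric] using t by (simp add: D.arr_simps)
  have 1: "D.tri E (\<gamma> \<cdot>\<^bsub>\<D>\<^esub> q h') A (q h \<cdot>\<^bsub>\<D>\<^esub> \<gamma>') C \<delta>''"
    using D.tri_iso_middle[OF tri_quotientI[OF o(1)] g(2)] .
  have 2: "q h \<cdot>\<^bsub>\<D>\<^esub> \<gamma>' = G \<cdot>\<^bsub>\<D>\<^esub> F"
  proof -
    have "q h \<cdot>\<^bsub>\<D>\<^esub> \<gamma>' = q g \<cdot>\<^bsub>\<D>\<^esub> (\<beta>' \<cdot>\<^bsub>\<D>\<^esub> F)" using t by (simp add: o(2) q_comp is_arr_q D.comp_assoc g(6))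
    also have "\<dots> = G \<cdot>\<^bsub>\<D>\<^esub> F" using t by (simp add: D.comp_reassoc[OF b(6)] is_arr_q)
    finally show ?thesis .
  qed
  have 3: "F \<cdot>\<^bsub>\<D>\<^esub> (\<gamma> \<cdot>\<^bsub>\<D>\<^esub> q h') = G' \<cdot>\<^bsub>\<D>\<^esub> q e"
  proof -
    have "F \<cdot>\<^bsub>\<D>\<^esub> (\<gamma> \<cdot>\<^bsub>\<D>\<^esub> q h') = (F \<cdot>\<^bsub>\<D>\<^esub> \<gamma>) \<cdot>\<^bsub>\<D>\<^esub> q h'" using t by (simp add: is_arr_q D.comp_assoc)
    also have "\<dots> = G' \<cdot>\<^bsub>\<D>\<^esub> q e"
      unfolding ff[symmetric] using t by (simp add: qe(2) is_arr_q D.comp_assoc D.comp_reassoc[OF b(3)])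
    finally show ?thesis .
  qed
  have 4: "(\<gamma> \<cdot>\<^bsub>\<D>\<^esub> q h') \<cdot>\<^bsub>\<D>\<^esub> q d = F'"
    using t by (simp add: D.comp_assoc qe(1) is_arr_q g(3))
  have c1: "Act \<E>' (q g') (Ident \<D> D) ?\<delta> = Act \<E>' G' (Ident \<D> D) \<delta>"
    using t by (simp add: is_arr_q D.Act_Act D.is_arr_Ident D.comp_Ident_left b(3))
  have "pull \<C> \<E> D g' ?\<delta> = Act \<E>' (q g') (Ident \<D> D) ?\<delta>"
    using t by (simp add: pull_def q_Ident[symmetric] Act_quotient is_arr_Ident)
  then have 5: "D.tri D (q d) E (q e) K (pull \<D> \<E>' D G' \<delta>)"
    using tri_quotientI[OF o(7)] c1 by (simp add: pull_def)
  have 6: "\<delta>' = push \<D> \<E>' C (q e) \<delta>''"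
    using t o(8) by (simp add: push_def q_Ident[symmetric] Act_quotient is_arr_Ident)
  have "Act \<E>' G (Ident \<D> E) \<delta>'' = Act \<E>' \<beta>' (Ident \<D> E) (Act \<E>' (q g) (Ident \<D> E) \<delta>'')"
    using t by (simp add: is_arr_q D.Act_Act D.is_arr_Ident D.comp_Ident_left b(6))
  also have "Act \<E>' (q g) (Ident \<D> E) \<delta>'' = Act \<E>' (Ident \<D> B0) (q d) ?\<delta>"
    using t o(9) by (simp add: push_def pull_def q_Ident[symmetric] Act_quotient is_arr_Ident)
  also have "Act \<E>' \<beta>' (Ident \<D> E) \<dots> = Act \<E>' (Ident \<D> B) (q d) \<delta>"
    using t by (simp add: is_arr_q D.Act_Act D.Act_closed D.is_arr_Ident D.is_arr_comp D.comp_Ident_left D.comp_Ident_right)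
  finally have 7: "push \<D> \<E>' B (q d) \<delta> = pull \<D> \<E>' E G \<delta>''" by (simp add: push_def pull_def)
  have "q d \<in> mor \<D> D E" "q e \<in> mor \<D> E K"
    using D.arrD(6) q_arr tri_arr[OF o(7)] by blast+
  then show ?thesis using 1 2 3 4 5 6 7 by blast
qed

lemma extriangulated_quotient: "extriangulated_category \<D> \<E>' s'"
proof (rule extriangulated_category.intro)
  show "biadditive_bifunctor \<D> \<E>'" by (rule biadditive_quotient)
  show "additive_realization \<D> \<E>' s'"
    unfolding additive_realization_def
    using realization_quotient D.split_realization sum_quotient by blast
qed (fact D.complete_right D.complete_left octahedron_quotient octahedron_op_quotient)+

lemma induced_structure: "induced_structure \<C> \<E> s \<I> \<E>' s'"
  unfolding induced_structure_def
proof (intro conjI ballI allI impI)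
  fix A A' C C' c a \<delta>
  assume o: "A \<in> Ob \<C>" "A' \<in> Ob \<C>" "C \<in> Ob \<C>" "C' \<in> Ob \<C>" "c \<in> mor \<C> C' C" "a \<in> mor \<C> A A'"
    and d: "\<delta> \<in> carrier (Ext \<E> C A)"
  then have "arr c C' C" "arr a A A'" by (auto simp: arr_def)
  then show "Act \<E>' (q c) (q a) \<delta> = Act \<E> c a \<delta>" using d by (auto simp: arr_iff intro: Act_quotient)
qed (simp_all add: s'_class)

text \<open>A lift in the quotient is a lift in \<open>\<C>\<close> up to an error through some
  \<open>N\<close> in \<open>\<I>\<close>. As \<open>N\<close> is projective, the error lifts too
  and is added to the lift.\<close>

lemma Proj_quotient: "Proj \<D> \<E>' s' \<subseteq> Proj \<C> \<E> s"
proof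
  fix P assume P: "P \<in> Proj \<D> \<E>' s'"
  then have PO: "P \<in> Ob \<C>" by (simp add: Proj_def)
  have "\<exists>b\<in>mor \<C> P B. y \<cdot> b = c" if d: "deflation \<C> \<E> s B C y" and c: "c \<in> mor \<C> P C" for B C y c
  proof -
    obtain A x \<delta> where T: "tri A x B y C \<delta>" using d by (auto simp: deflation_def)
    note t = triD[OF T]
    have ca: "arr c P C" using c t PO by (simp add: arr_def)
    have "deflation \<D> \<E>' s' B C (q y)" using tri_quotientI[OF T] by (auto simp: deflation_def)
    then obtain B' where B': "B' \<in> mor \<D> P B" "q y \<cdot>\<^bsub>\<D>\<^esub> B' = q c"
      using P D.arrD(6)[OF q_arr[OF ca]] unfolding Proj_def by blast
    then obtain b where b: "arr b P B" "q y \<cdot>\<^bsub>\<D>\<^esub> q b = q c" using mor_quotient_iff[OF PO t(9)] by auto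
    note b' = arrD[OF b(1)]
    have yb: "arr (y \<cdot> b) P C" using t b' by (simp add: arr_iff is_arr_comp)
    have "q c = q (y \<cdot> b)" using t b' b(2) by (simp add: q_comp)
    then obtain N g h where n: "N \<in> \<I>" "arr g P N" "arr h N C" "c = y \<cdot> b \<oplus> h \<cdot> g"
      using q_eq_iff[OF ca yb] by blast
    obtain k where k: "arr k N B" "y \<cdot> k = h" using lift_projective[OF n(1) T n(3)] .
    note u = arrD[OF n(2)] arrD[OF k(1)]
    have "arr (b \<oplus> k \<cdot> g) P B" "y \<cdot> (b \<oplus> k \<cdot> g) = c"
      using t u b' comp_reassoc[OF k(2)] by (simp_all add: n(4) arr_iff arr_simps)
    then show ?thesis using arrD(6) by blast
  qed
  then show "P \<in> Proj \<C> \<E> s" using PO by (simp add: Proj_def)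
qed

text \<open>Dually, the error of an extension found in the quotient passes through an injective
  object and is itself extended along \<open>x\<close>.\<close>

lemma Inj_quotient: "Inj \<D> \<E>' s' \<subseteq> Inj \<C> \<E> s"
proof
  fix J assume J: "J \<in> Inj \<D> \<E>' s'"
  then have JO: "J \<in> Ob \<C>" by (simp add: Inj_def)
  have "\<exists>b\<in>mor \<C> B J. b \<cdot> x = a" if d: "inflation \<C> \<E> s A B x" and a: "a \<in> mor \<C> A J" for A B x a
  proof -
    obtain C y \<delta> where T: "tri A x B y C \<delta>" using d by (auto simp: inflation_def)
    note t = triD[OF T]
    have aa: "arr a A J" using a t JO by (simp add: arr_def)
    have "inflation \<D> \<E>' s' A B (q x)" using tri_quotientI[OF T] by (auto simp: inflation_def)
    then obtain B' where B': "B' \<in> mor \<D> B J" "B' \<cdot>\<^bsub>\<D>\<^esub> q x = q a"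
      using J D.arrD(6)[OF q_arr[OF aa]] unfolding Inj_def by blast
    then obtain b where b: "arr b B J" "q b \<cdot>\<^bsub>\<D>\<^esub> q x = q a" using mor_quotient_iff[OF t(9) JO] by auto
    note b' = arrD[OF b(1)]
    have bx: "arr (b \<cdot> x) A J" using t b' by (simp add: arr_iff is_arr_comp)
    have "q a = q (b \<cdot> x)" using t b' b(2) by (simp add: q_comp)
    then obtain N g h where n: "N \<in> \<I>" "arr g A N" "arr h N J" "a = b \<cdot> x \<oplus> h \<cdot> g"
      using q_eq_iff[OF aa bx] by blast
    obtain k where k: "arr k B N" "k \<cdot> x = g" using extend_injective[OF n(1) T n(2)] .
    note u = arrD[OF n(3)] arrD[OF k(1)]
    have "arr (b \<oplus> h \<cdot> k) B J" "(b \<oplus> h \<cdot> k) \<cdot> x = a"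
      using t u b' by (simp_all add: n(4) arr_iff arr_simps k(2))
    then show ?thesis using arrD(6) by blast
  qed
  then show "J \<in> Inj \<C> \<E> s" using JO by (simp add: Inj_def)
qed

text \<open>Two parallel morphisms into or out of \<open>N\<close> differ by a morphism that factors
  through \<open>N\<close> itself.\<close>

lemma ideal_zero_object:
  assumes "N \<in> \<I>"
  shows "zero_object \<D> N"
proof -
  have N: "N \<in> Ob \<C>" using assms ideal_Ob by blast
  have eq: "q f = q f'" if "arr f A B" "arr f' A B" "A = N \<or> B = N" for A B f f'
  proof -
    note t = arrD[OF that(1)] arrD[OF that(2)]
    let ?g = "f \<oplus> neg f'"
    \<comment> \<open>The last two equations are the factorizations used when \<open>N\<close> is
      the domain and the codomain, respectively.\<close>
    have g: "arr ?g A B" "f = f' \<oplus> ?g" "?g = ?g \<cdot> Ident \<C> A" "?g = Ident \<C> B \<cdot> ?g"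
      using t plus_neg_cancel[of f' f]
      by (simp_all add: arr_iff is_arr_plus is_arr_neg comp_Ident_left comp_Ident_right)
    then show ?thesis
      unfolding q_eq_iff[OF that(1,2)] using that(3) assms arr_IdentI[OF t(4)] arr_IdentI[OF t(5)] by metis
  qed
  have "(\<exists>!X. X \<in> mor \<D> A N) \<and> (\<exists>!X. X \<in> mor \<D> N A)" if A: "A \<in> Ob \<C>" for A
  proof -
    have "arr (zr A N) A N" "arr (zr N A) N A" using A N by (simp_all add: arr_iff is_arr_zr)
    then show ?thesis
      unfolding mor_quotient_iff[OF A N] mor_quotient_iff[OF N A] using eq[of _ A N] eq[of _ N A] by blast
  qed
  then show ?thesis using N by (simp add: zero_object_def)
qed

end

theorem proposition3p30:
  fixes \<C> :: "('o, 'm) cat"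
    and \<E> :: "('o, 'm, 'e) bifun"
    and s :: "('o, 'm, 'e) realz"
  assumes "extriangulated_category \<C> \<E> s"
  shows "(\<forall>\<I>. additive_subcategory \<C> \<I> \<and> closed_under_isos \<C> \<I> \<and>
            \<I> \<subseteq> Proj \<C> \<E> s \<inter> Inj \<C> \<E> s \<longrightarrow>
            (\<exists>\<E>' s'. induced_structure \<C> \<E> s \<I> \<E>' s' \<and>
               extriangulated_category (quotient_category \<C> \<I>) \<E>' s')) \<and>
         (let \<I> = Proj \<C> \<E> s \<inter> Inj \<C> \<E> s; \<C>' = quotient_category \<C> \<I> in
            \<exists>\<E>' s'. induced_structure \<C> \<E> s \<I> \<E>' s' \<and>
              extriangulated_category \<C>' \<E>' s' \<and>
              Proj \<C>' \<E>' s' \<inter> Inj \<C>' \<E>' s' = {Z. zero_object \<C>' Z})"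
proof -
  interpret extriangulated_category \<C> \<E> s by (rule assms)
  have Q: "extriangulated_quotient \<C> \<E> s \<I>"
    if "additive_subcategory \<C> \<I>" "\<I> \<subseteq> Proj \<C> \<E> s \<inter> Inj \<C> \<E> s" for \<I>
    by (intro extriangulated_quotient.intro ideal_quotient.intro ideal_quotient_axioms.intro
      extriangulated_quotient_axioms.intro extriangulated_category_axioms additive_category_axioms that)
  show ?thesis
    unfolding Let_def
  proof (intro conjI allI impI)
    fix \<I> assume "additive_subcategory \<C> \<I> \<and> closed_under_isos \<C> \<I> \<and> \<I> \<subseteq> Proj \<C> \<E> s \<inter> Inj \<C> \<E> s"
    then interpret Q: extriangulated_quotient \<C> \<E> s \<I> using Q by blast
    show "\<exists>\<E>' s'. induced_structure \<C> \<E> s \<I> \<E>' s' \<and>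
        extriangulated_category (quotient_category \<C> \<I>) \<E>' s'"
      using Q.induced_structure Q.extriangulated_quotient by blast
  next
    let ?\<I> = "Proj \<C> \<E> s \<inter> Inj \<C> \<E> s"
    interpret Q: extriangulated_quotient \<C> \<E> s ?\<I>
      using Q additive_subcategory_Proj_Inj by blast
    \<comment> \<open>An object projective and injective in the quotient is so in
      \<open>\<C>\<close>, hence lies in \<open>?\<I>\<close> and becomes zero. Conversely, zero
      objects of the quotient are projective and injective there.\<close>
    have "Proj Q.\<D> Q.\<E>' Q.s' \<inter> Inj Q.\<D> Q.\<E>' Q.s' = {Z. zero_object Q.\<D> Z}"
      using Q.Proj_quotient Q.Inj_quotient Q.ideal_zero_object Q.D.zero_object_Proj_Inj by blast
    then show "\<exists>\<E>' s'. induced_structure \<C> \<E> s ?\<I> \<E>' s' \<and>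
        extriangulated_category (quotient_category \<C> ?\<I>) \<E>' s' \<and>
        Proj (quotient_category \<C> ?\<I>) \<E>' s' \<inter> Inj (quotient_category \<C> ?\<I>) \<E>' s' =
          {Z. zero_object (quotient_category \<C> ?\<I>) Z}"
      using Q.induced_structure Q.extriangulated_quotient by blast
  qed
qed

end
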